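(* Let the ELISE filter (defined in the context) be uniformly asymptotically stable. Then its state estimate bias $\mathbb E[\tilde x]:=\mathbb E[x-\hat x]$ decays exponentially, i.e. there are constants $\beta$ and $\gamma$ such that $$\|\mathbb E[\tilde x]\|\le\beta e^{-\gamma(t-t_0)}\qquad\text{for all }t\ge t_0 .$$ If, in addition, $\breve A:=\overline A-LC_2$ is bounded, then, with initial bias $\mathbb E[\tilde x(t_0)]$, the constants are given by $$\beta=\sqrt{\frac{\mathbb E[\tilde x(t_0)]^\top S(t_0)\,\mathbb E[\tilde x(t_0)]}{\underline\lambda_{min}(S)}},\qquad \gamma=\frac1{2\overline\lambda_{max}(S)},$$ where $\overline\lambda_{max}(S)$ and $\underline\lambda_{min}(S)$ are the supremum and infimum over $t\ge t_0$ of the largest and smallest eigenvalue, respectively, of $$S(t)=\lim_{T\to\infty}\int_t^T\Phi_{\breve A}(s,t)^\top\Phi_{\breve A}(s,t)\,ds\succ0,$$ and $\Phi_{\breve A}(\cdot,\cdot)$ is the state transition matrix of $\dot x=\breve A x$.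
   Context: **System.** All matrices and signals depend on time $t\ge t_0$ (argument omitted). $\dot x=Ax+Bu+Gd+Ww$, $y=Cx+Du+Hd+v$, with state $x\in\mathbb R^n$, known input $u\in\mathbb R^m$, unknown input $d\in\mathbb R^p$, output $y\in\mathbb R^l$, noises $w\in\mathbb R^q$, $v\in\mathbb R^l$; $A,B,G,C,D,W$ smooth, bounded, known; $H$ analytic, known, of constant rank $p_H$; $n\ge l\ge1$, $l\ge p\ge0$, $m\ge0$. $x(t_0)$ is independent of $v,w$, and an initial estimate $\hat x_0$ with covariance $\mathcal P_0^x$ is given. **Decoupling.** $H=[U_1\ U_2]\begin{bmatrix}\Sigma&0\\0&0\end{bmatrix}[V_1\ V_2]^\top$ is a singular value decomposition with $\Sigma\in\mathbb R^{p_H\times p_H}$ diagonal of full rank, $[U_1\ U_2]$, $[V_1\ V_2]$ unitary. $d_i=V_i^\top d$, $G_i=GV_i$; $T_1=U_1^\top-U_1^\top RU_2(U_2^\top RU_2)^{-1}U_2^\top$, $T_2=U_2^\top$; $z_i=T_iy$, $C_i=T_iC$, $D_i=T_iD$, $v_i=T_iv$, $R_i=T_iRT_i^\top$ ($i=1,2$). **Assumption (A1).** $w,v$ are mutually uncorrelated zero-mean white noises, $\mathbb E[w(t)w(t')^\top]=Q\delta(t-t')$, $\mathbb E[v(t)v(t')^\top]=R\delta(t-t')$, $\mathbb E[w(t)v(t')^\top]=0$, $Q\succeq0$, $R\succ0$. An additional measurement $\overline y=\overline C\dot x+\overline{\overline C}x+\overline D\dot u+\overline{\overline D}u+\overline H\dot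 d+\overline{\overline H}d+\overline v$ is available, with $\mathbb E[\overline v]=0$, $\mathbb E[w(t)\overline v(t')^\top]=0$, $\mathbb E[v(t)\overline v(t')^\top]=\grave R\delta(t-t')$, $\mathbb E[\overline v(t)\overline v(t')^\top]=\overline R\delta(t-t')$, $\overline R\succ0$, $\grave R$ known. With singular value decomposition $\overline H=[\overline U_1\ \overline U_2]\begin{bmatrix}\overline\Sigma&0\\0&0\end{bmatrix}[\overline V_1\ \overline V_2]^\top$ put $\overline T_2=\overline U_2^\top$ (so $\overline T_2\overline H=0$); also $\overline T_2\overline{\overline H}=0$ is assumed. $\overline z_2=\overline T_2\overline y$, $\overline C_2=\overline T_2\overline C$, $\overline D_2=\overline T_2\overline D$, $\overline v_2=\overline T_2\overline v$, $\overline R_2=\overline T_2\overline R\,\overline T_2^\top$, $\grave R_2=T_2\grave R\,\overline T_2^\top$, $\grave R_{12}=T_1\grave R\,\overline T_2^\top$. It is assumed ${\rm rk}(\overline C_2G_2)=p-p_H$. **ELISE filter.** $\hat d_1=M_1(z_1-C_1\hat x-D_1u)$, $\hat d_2=M_2(\overline z_2-(\overline C_2A+\overline T_2\overline{\overline C})\hat x-\overline C_2Bu-\overline C_2G_1\hat d_1-\overline D_2\dot u-\overline T_2\overline{\overline D}u)$, $\hat d=V_1\hat d_1+V_2\hat d_2$, $\dot{\hat x}=A\hat x+Bu+G_1\hat d_1+G_2\hat d_2+L(z_2-C_2\hat x-D_2u)$, $\hat x(t_0)=\hat x_0$, with $M_1=\Sigma^{-1}$, $\hat A=A-G_1M_1C_1$,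 $\hat Q=WQW^\top+G_1M_1R_1M_1^\top G_1^\top$, $\tilde R_2=(\overline C_2\hat A+\overline T_2\overline{\overline C})P^x(\overline C_2\hat A+\overline T_2\overline{\overline C})^\top+\overline C_2\hat Q\overline C_2^\top+\overline R_2-\grave R_{12}^\top M_1^\top G_1^\top\overline C_2^\top-\overline C_2G_1M_1\grave R_{12}$, $M_2=(G_2^\top\overline C_2^\top\tilde R_2^{-1}\overline C_2G_2)^{-1}G_2^\top\overline C_2^\top\tilde R_2^{-1}$, $\overline A=(I-G_2M_2\overline C_2)\hat A-G_2M_2\overline T_2\overline{\overline C}$, $\overline Q=(I-G_2M_2\overline C_2)\hat Q(I-G_2M_2\overline C_2)^\top+G_2M_2\overline R_2M_2^\top G_2^\top$, $L=(P^xC_2^\top-G_2M_2\grave R_2^\top)R_2^{-1}$, $\dot P^x=\overline AP^x+P^x\overline A^\top+\overline Q-LR_2L^\top$, $P^x(t_0)=\mathcal P_0^x$. **Stability.** The filter is called uniformly asymptotically stable if the linear system $\dot\xi=(\overline A-LC_2)\xi$ is uniformly asymptotically stable. *)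

theory Defs
  imports
    "HOL-Probability.Probability"
    "HOL-Library.Function_Algebras"
    "Jordan_Normal_Form.DL_Rank"
    "Jordan_Normal_Form.Spectral_Radius"
begin

unbundle no vec_syntax
unbundle no inner_syntax
hide_type (open) Finite_Cartesian_Product.vec
hide_const (open) Finite_Cartesian_Product.vec Finite_Cartesian_Product.mat
  Finite_Cartesian_Product.transpose Finite_Cartesian_Product.row
  Finite_Cartesian_Product.column Determinants.det

text \<open>
  All dimensions are natural numbers, because the number of inputs, the rank of the feedthrough
  matrices and the sizes of the blocks of their singular value decompositions may be zero.
  Hence vectors and matrices are those of Jordan_Normal_Form. Only times \<open>t \<ge> t0\<close> matter.
\<close>

section \<open>Vectors and matrices\<close>

definition vnorm :: "real vec \<Rightarrow> real" where
  "vnorm x = sqrt (x \<bullet> x)"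

definition pos_semidef :: "nat \<Rightarrow> real mat \<Rightarrow> bool" where
  "pos_semidef n A \<longleftrightarrow> A \<in> carrier_mat n n \<and> transpose_mat A = A \<and>
     (\<forall>x\<in>carrier_vec n. x \<bullet> (A *\<^sub>v x) \<ge> 0)"

definition pos_def :: "nat \<Rightarrow> real mat \<Rightarrow> bool" where
  "pos_def n A \<longleftrightarrow> A \<in> carrier_mat n n \<and> transpose_mat A = A \<and>
     (\<forall>x\<in>carrier_vec n. x \<noteq> 0\<^sub>v n \<longrightarrow> x \<bullet> (A *\<^sub>v x) > 0)"

text \<open>Only meaningful for invertible matrices.\<close>

abbreviation minv :: "real mat \<Rightarrow> real mat" where
  "minv A \<equiv> the (mat_inverse A)"

definition left_cols :: "nat \<Rightarrow> real mat \<Rightarrow> real mat" where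
  "left_cols r A = mat (dim_row A) r (\<lambda>(i, j). A $$ (i, j))"

definition right_cols :: "nat \<Rightarrow> real mat \<Rightarrow> real mat" where
  "right_cols r A = mat (dim_row A) (dim_col A - r) (\<lambda>(i, j). A $$ (i, r + j))"

text \<open>
  Singular value decomposition of an \<open>a \<times> b\<close> matrix of rank \<open>r\<close>: the first \<open>r\<close> columns of
  \<open>U\<close> and \<open>V\<close> belong to the nonzero singular values. These are not required to be sorted,
  since an analytic decomposition of an analytic matrix need not be.
\<close>

definition is_svd :: "nat \<Rightarrow> nat \<Rightarrow> nat \<Rightarrow> real mat \<Rightarrow> real mat \<Rightarrow> real mat \<Rightarrow> real mat \<Rightarrow> bool" where
  "is_svd a b r H U \<Sigma> V \<longleftrightarrow>
     r \<le> a \<and> r \<le> b \<and>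
     U \<in> carrier_mat a a \<and> transpose_mat U * U = 1\<^sub>m a \<and>
     V \<in> carrier_mat b b \<and> transpose_mat V * V = 1\<^sub>m b \<and>
     \<Sigma> \<in> carrier_mat r r \<and> diagonal_mat \<Sigma> \<and> (\<forall>i<r. \<Sigma> $$ (i, i) > 0) \<and>
     H = U * four_block_mat \<Sigma> (0\<^sub>m r (b - r)) (0\<^sub>m (a - r) r) (0\<^sub>m (a - r) (b - r))
           * transpose_mat V"

section \<open>Matrix-valued functions of time\<close>

definition entrywise ::
  "((real \<Rightarrow> real) \<Rightarrow> bool) \<Rightarrow> real \<Rightarrow> nat \<Rightarrow> nat \<Rightarrow> (real \<Rightarrow> real mat) \<Rightarrow> bool" where
  "entrywise \<P> t0 r c F \<longleftrightarrow>
     (\<forall>t\<ge>t0. F t \<in> carrier_mat r c) \<and> (\<forall>i<r. \<forall>j<c. \<P> (\<lambda>t. F t $$ (i, j)))"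

definition smooth_from :: "real \<Rightarrow> (real \<Rightarrow> real) \<Rightarrow> bool" where
  "smooth_from t0 f \<longleftrightarrow>
     (\<exists>D. D 0 = f \<and>
       (\<forall>k. \<forall>t\<ge>t0. (D k has_real_derivative D (Suc k) t) (at t within {t0..})))"

definition analytic_from :: "real \<Rightarrow> (real \<Rightarrow> real) \<Rightarrow> bool" where
  "analytic_from t0 f \<longleftrightarrow>
     (\<forall>t\<ge>t0. \<exists>r>0. \<exists>a. \<forall>s\<ge>t0. \<bar>s - t\<bar> < r \<longrightarrow> (\<lambda>k. a k * (s - t) ^ k) sums f s)"

definition bounded_from :: "real \<Rightarrow> (real \<Rightarrow> real) \<Rightarrow> bool" where
  "bounded_from t0 f \<longleftrightarrow> bounded (f ` {t0..})"

abbreviation cont_mat :: "real \<Rightarrow> nat \<Rightarrow> nat \<Rightarrow> (real \<Rightarrow> real mat) \<Rightarrow> bool" where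
  "cont_mat t0 \<equiv> entrywise (continuous_on {t0..}) t0"

abbreviation bounded_mat :: "real \<Rightarrow> nat \<Rightarrow> nat \<Rightarrow> (real \<Rightarrow> real mat) \<Rightarrow> bool" where
  "bounded_mat t0 \<equiv> entrywise (bounded_from t0) t0"

abbreviation smooth_bounded_mat :: "real \<Rightarrow> nat \<Rightarrow> nat \<Rightarrow> (real \<Rightarrow> real mat) \<Rightarrow> bool" where
  "smooth_bounded_mat t0 \<equiv> entrywise (\<lambda>f. smooth_from t0 f \<and> bounded_from t0 f) t0"

section \<open>Linear time-varying differential equations\<close>

definition lin_solution ::
  "nat \<Rightarrow> (real \<Rightarrow> real mat) \<Rightarrow> real \<Rightarrow> (real \<Rightarrow> real vec) \<Rightarrow> bool" where
  "lin_solution n A s \<xi> \<longleftrightarrow>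
     (\<forall>t\<ge>s. \<xi> t \<in> carrier_vec n \<and>
       (\<forall>i<n. ((\<lambda>\<tau>. \<xi> \<tau> $ i) has_real_derivative (A t *\<^sub>v \<xi> t) $ i) (at t within {s..})))"

text \<open>Uniform stability together with uniform attractivity, both with respect to the initial time.\<close>

definition unif_asymp_stable :: "real \<Rightarrow> nat \<Rightarrow> (real \<Rightarrow> real mat) \<Rightarrow> bool" where
  "unif_asymp_stable t0 n A \<longleftrightarrow>
     (\<forall>\<epsilon>>0. \<exists>\<delta>>0. \<forall>s\<ge>t0. \<forall>\<xi>. lin_solution n A s \<xi> \<and> vnorm (\<xi> s) < \<delta> \<longrightarrow>
        (\<forall>t\<ge>s. vnorm (\<xi> t) < \<epsilon>)) \<and>
     (\<exists>\<delta>>0. \<forall>\<epsilon>>0. \<exists>T>0. \<forall>s\<ge>t0. \<forall>\<xi>. lin_solution n A s \<xi> \<and> vnorm (\<xi> s) < \<delta> \<longrightarrow>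
        (\<forall>t\<ge>s + T. vnorm (\<xi> t) < \<epsilon>))"

definition state_transition ::
  "real \<Rightarrow> nat \<Rightarrow> (real \<Rightarrow> real mat) \<Rightarrow> (real \<Rightarrow> real \<Rightarrow> real mat) \<Rightarrow> bool" where
  "state_transition t0 n A \<Phi> \<longleftrightarrow>
     (\<forall>t\<ge>t0. \<Phi> t t = 1\<^sub>m n) \<and>
     (\<forall>s\<ge>t0. \<forall>t\<ge>t0. \<Phi> s t \<in> carrier_mat n n \<and>
       (\<forall>i<n. \<forall>j<n. ((\<lambda>\<sigma>. \<Phi> \<sigma> t $$ (i, j)) has_real_derivative (A s * \<Phi> s t) $$ (i, j))
          (at s within {t0..})))"

definition gram_to ::
  "nat \<Rightarrow> (real \<Rightarrow> real \<Rightarrow> real mat) \<Rightarrow> real \<Rightarrow> real \<Rightarrow> real mat" where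
  "gram_to n \<Phi> t T =
     mat n n (\<lambda>(i, j). integral {t..T} (\<lambda>s. (transpose_mat (\<Phi> s t) * \<Phi> s t) $$ (i, j)))"

definition gram :: "nat \<Rightarrow> (real \<Rightarrow> real \<Rightarrow> real mat) \<Rightarrow> real \<Rightarrow> real mat" where
  "gram n \<Phi> t = mat n n (\<lambda>(i, j). Lim at_top (\<lambda>T. gram_to n \<Phi> t T $$ (i, j)))"

definition lambda_max_sup :: "real \<Rightarrow> (real \<Rightarrow> real mat) \<Rightarrow> real" where
  "lambda_max_sup t0 S = (SUP t\<in>{t0..}. Max (spectrum (S t)))"

definition lambda_min_inf :: "real \<Rightarrow> (real \<Rightarrow> real mat) \<Rightarrow> real" where
  "lambda_min_inf t0 S = (INF t\<in>{t0..}. Min (spectrum (S t)))"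

section \<open>Generalized stochastic processes\<close>

text \<open>
  White noise has no sample paths, so signals containing it are represented by their action
  \<open>\<zeta> \<phi> = \<integral>\<^bsub>t \<ge> t0\<^esub> \<phi>(t)\<^sup>T \<zeta>(t) dt\<close> on vector-valued test functions. Test functions are bounded,
  measurable and vanish for large times; thus they may be multiplied by continuous matrices, and
  they include the indicators of the intervals \<open>[t0, t]\<close>, on which a generalized process takes
  its increments.
\<close>

type_synonym 'w gproc = "(real \<Rightarrow> real vec) \<Rightarrow> 'w \<Rightarrow> real"

definition test_fun :: "real \<Rightarrow> nat \<Rightarrow> (real \<Rightarrow> real vec) \<Rightarrow> bool" where
  "test_fun t0 k \<phi> \<longleftrightarrow>
     (\<forall>t\<ge>t0. \<phi> t \<in> carrier_vec k) \<and>
     (\<forall>i<k. set_borel_measurable lborel {t0..} (\<lambda>t. \<phi> t $ i) \<and>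
            bounded_from t0 (\<lambda>t. \<phi> t $ i) \<and>
            (\<exists>T. \<forall>t\<ge>t0. t > T \<longrightarrow> \<phi> t $ i = 0))"

text \<open>Linearity, and independence of the values of test functions before \<open>t0\<close>.\<close>

definition gproc :: "'w measure \<Rightarrow> real \<Rightarrow> nat \<Rightarrow> 'w gproc \<Rightarrow> bool" where
  "gproc Pr t0 k \<zeta> \<longleftrightarrow>
     (\<forall>\<phi>. test_fun t0 k \<phi> \<longrightarrow> \<zeta> \<phi> \<in> borel_measurable Pr) \<and>
     (\<forall>\<phi> \<psi> \<chi> a b. test_fun t0 k \<phi> \<and> test_fun t0 k \<psi> \<and> test_fun t0 k \<chi> \<and>
        (\<forall>t\<ge>t0. \<chi> t = a \<cdot>\<^sub>v \<phi> t + b \<cdot>\<^sub>v \<psi> t) \<longrightarrow>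
        (AE \<omega> in Pr. \<zeta> \<chi> \<omega> = a * \<zeta> \<phi> \<omega> + b * \<zeta> \<psi> \<omega>))"

text \<open>The generalized process \<open>M(t) \<zeta>(t)\<close>. Sums and differences are pointwise.\<close>

definition gmult :: "(real \<Rightarrow> real mat) \<Rightarrow> 'w gproc \<Rightarrow> 'w gproc" (infixr "\<odot>" 75) where
  "M \<odot> \<zeta> = (\<lambda>\<phi>. \<zeta> (\<lambda>t. transpose_mat (M t) *\<^sub>v \<phi> t))"

definition regular :: "real \<Rightarrow> (real \<Rightarrow> 'w \<Rightarrow> real vec) \<Rightarrow> 'w gproc" where
  "regular t0 f = (\<lambda>\<phi> \<omega>. LINT t:{t0..}|lborel. \<phi> t \<bullet> f t \<omega>)"

definition has_gderiv ::
  "'w measure \<Rightarrow> real \<Rightarrow> nat \<Rightarrow> (real \<Rightarrow> 'w \<Rightarrow> real vec) \<Rightarrow> 'w gproc \<Rightarrow> bool" where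
  "has_gderiv Pr t0 k f \<zeta> \<longleftrightarrow>
     (\<forall>t\<ge>t0. \<forall>i<k. AE \<omega> in Pr.
        f t \<omega> $ i = f t0 \<omega> $ i + \<zeta> (\<lambda>s. indicator {t0..t} s \<cdot>\<^sub>v unit_vec k i) \<omega>)"

definition process :: "'w measure \<Rightarrow> real \<Rightarrow> nat \<Rightarrow> (real \<Rightarrow> 'w \<Rightarrow> real vec) \<Rightarrow> bool" where
  "process Pr t0 k f \<longleftrightarrow>
     (\<forall>t\<ge>t0. \<forall>\<omega>\<in>space Pr. f t \<omega> \<in> carrier_vec k) \<and>
     (\<forall>i<k.
        (\<forall>t\<ge>t0. (\<lambda>\<omega>. f t \<omega> $ i) \<in> borel_measurable Pr) \<and>
        set_borel_measurable (lborel \<Otimes>\<^sub>M Pr) ({t0..} \<times> space Pr) (\<lambda>(t, \<omega>). f t \<omega> $ i) \<and>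
        (\<forall>T. AE \<omega> in Pr. set_integrable lborel {t0..T} (\<lambda>t. f t \<omega> $ i)))"

definition integrable_process ::
  "'w measure \<Rightarrow> real \<Rightarrow> nat \<Rightarrow> (real \<Rightarrow> 'w \<Rightarrow> real vec) \<Rightarrow> bool" where
  "integrable_process Pr t0 k f \<longleftrightarrow>
     process Pr t0 k f \<and>
     (\<forall>i<k.
        (\<forall>t\<ge>t0. integrable Pr (\<lambda>\<omega>. f t \<omega> $ i)) \<and>
        (\<forall>T. set_integrable (lborel \<Otimes>\<^sub>M Pr) ({t0..T} \<times> space Pr) (\<lambda>(t, \<omega>). f t \<omega> $ i)))"

definition zero_mean :: "'w measure \<Rightarrow> real \<Rightarrow> nat \<Rightarrow> 'w gproc \<Rightarrow> bool" where
  "zero_mean Pr t0 k \<zeta> \<longleftrightarrow>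
     (\<forall>\<phi>. test_fun t0 k \<phi> \<longrightarrow> integrable Pr (\<zeta> \<phi>) \<and> (LINT \<omega>|Pr. \<zeta> \<phi> \<omega>) = 0)"

text \<open>\<open>E[\<zeta>(t) \<eta>(t')\<^sup>T] = K(t) \<delta>(t - t')\<close>, tested with \<open>\<phi>(t)\<close> and \<open>\<psi>(t')\<close>.\<close>

definition delta_correlated ::
  "'w measure \<Rightarrow> real \<Rightarrow> nat \<Rightarrow> nat \<Rightarrow> 'w gproc \<Rightarrow> 'w gproc \<Rightarrow> (real \<Rightarrow> real mat) \<Rightarrow> bool" where
  "delta_correlated Pr t0 k k' \<zeta> \<eta> K \<longleftrightarrow>
     (\<forall>\<phi> \<psi>. test_fun t0 k \<phi> \<and> test_fun t0 k' \<psi> \<longrightarrow>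
        integrable Pr (\<lambda>\<omega>. \<zeta> \<phi> \<omega> * \<eta> \<psi> \<omega>) \<and>
        (LINT \<omega>|Pr. \<zeta> \<phi> \<omega> * \<eta> \<psi> \<omega>) = (LINT t:{t0..}|lborel. \<phi> t \<bullet> (K t *\<^sub>v \<psi> t)))"

definition generated_events :: "'w measure \<Rightarrow> ('w \<Rightarrow> real) set \<Rightarrow> 'w set set" where
  "generated_events Pr \<X> =
     sigma_sets (space Pr) {X -` E \<inter> space Pr | X E. X \<in> \<X> \<and> E \<in> sets borel}"

section \<open>The system\<close>

text \<open>
  \<open>Cbar\<close>, \<open>Cbarbar\<close> etc. are the coefficients of the additional measurement, of dimension
  \<open>dimYbar\<close>: single bars multiply derivatives. \<open>Racute\<close> is the cross-intensity of the two
  measurement noises.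
\<close>

record ise_model =
  t0 :: real
  dimX :: nat
  dimU :: nat
  dimD :: nat
  dimY :: nat
  dimW :: nat
  dimYbar :: nat
  rkH :: nat
  rkHbar :: nat
  matA :: "real \<Rightarrow> real mat"
  matB :: "real \<Rightarrow> real mat"
  matG :: "real \<Rightarrow> real mat"
  matC :: "real \<Rightarrow> real mat"
  matD :: "real \<Rightarrow> real mat"
  matW :: "real \<Rightarrow> real mat"
  matH :: "real \<Rightarrow> real mat"
  Cbar :: "real \<Rightarrow> real mat"
  Cbarbar :: "real \<Rightarrow> real mat"
  Dbar :: "real \<Rightarrow> real mat"
  Dbarbar :: "real \<Rightarrow> real mat"
  Hbar :: "real \<Rightarrow> real mat"
  Hbarbar :: "real \<Rightarrow> real mat"
  svdU :: "real \<Rightarrow> real mat"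
  svd\<Sigma> :: "real \<Rightarrow> real mat"
  svdV :: "real \<Rightarrow> real mat"
  svdUbar :: "real \<Rightarrow> real mat"
  svd\<Sigma>bar :: "real \<Rightarrow> real mat"
  svdVbar :: "real \<Rightarrow> real mat"
  matQ :: "real \<Rightarrow> real mat"
  matR :: "real \<Rightarrow> real mat"
  Rbar :: "real \<Rightarrow> real mat"
  Racute :: "real \<Rightarrow> real mat"
  P0 :: "real mat"

record 'w ise_signals =
  prob :: "'w measure"
  sigX :: "real \<Rightarrow> 'w \<Rightarrow> real vec"
  sigU :: "real \<Rightarrow> 'w \<Rightarrow> real vec"
  sigD :: "real \<Rightarrow> 'w \<Rightarrow> real vec"
  derU :: "'w gproc"
  derD :: "'w gproc"
  noiseW :: "'w gproc"
  noiseV :: "'w gproc"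
  noiseVbar :: "'w gproc"
  xhat0 :: "'w \<Rightarrow> real vec"

subsection \<open>Decoupling\<close>

definition U1 :: "ise_model \<Rightarrow> real \<Rightarrow> real mat" where
  "U1 M t = left_cols (rkH M) (svdU M t)"
definition U2 :: "ise_model \<Rightarrow> real \<Rightarrow> real mat" where
  "U2 M t = right_cols (rkH M) (svdU M t)"
definition V1 :: "ise_model \<Rightarrow> real \<Rightarrow> real mat" where
  "V1 M t = left_cols (rkH M) (svdV M t)"
definition V2 :: "ise_model \<Rightarrow> real \<Rightarrow> real mat" where
  "V2 M t = right_cols (rkH M) (svdV M t)"

definition G1 :: "ise_model \<Rightarrow> real \<Rightarrow> real mat" where
  "G1 M t = matG M t * V1 M t"
definition G2 :: "ise_model \<Rightarrow> real \<Rightarrow> real mat" where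
  "G2 M t = matG M t * V2 M t"

definition T2 :: "ise_model \<Rightarrow> real \<Rightarrow> real mat" where
  "T2 M t = transpose_mat (U2 M t)"
definition T1 :: "ise_model \<Rightarrow> real \<Rightarrow> real mat" where
  "T1 M t = transpose_mat (U1 M t) -
     transpose_mat (U1 M t) * matR M t * U2 M t
       * minv (transpose_mat (U2 M t) * matR M t * U2 M t) * transpose_mat (U2 M t)"

definition C1 :: "ise_model \<Rightarrow> real \<Rightarrow> real mat" where
  "C1 M t = T1 M t * matC M t"
definition C2 :: "ise_model \<Rightarrow> real \<Rightarrow> real mat" where
  "C2 M t = T2 M t * matC M t"
definition D1 :: "ise_model \<Rightarrow> real \<Rightarrow> real mat" where
  "D1 M t = T1 M t * matD M t"
definition D2 :: "ise_model \<Rightarrow> real \<Rightarrow> real mat" where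
  "D2 M t = T2 M t * matD M t"
definition R1 :: "ise_model \<Rightarrow> real \<Rightarrow> real mat" where
  "R1 M t = T1 M t * matR M t * transpose_mat (T1 M t)"
definition R2 :: "ise_model \<Rightarrow> real \<Rightarrow> real mat" where
  "R2 M t = T2 M t * matR M t * transpose_mat (T2 M t)"

definition T2bar :: "ise_model \<Rightarrow> real \<Rightarrow> real mat" where
  "T2bar M t = transpose_mat (right_cols (rkHbar M) (svdUbar M t))"
definition C2bar :: "ise_model \<Rightarrow> real \<Rightarrow> real mat" where
  "C2bar M t = T2bar M t * Cbar M t"
definition D2bar :: "ise_model \<Rightarrow> real \<Rightarrow> real mat" where
  "D2bar M t = T2bar M t * Dbar M t"
definition R2bar :: "ise_model \<Rightarrow> real \<Rightarrow> real mat" where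
  "R2bar M t = T2bar M t * Rbar M t * transpose_mat (T2bar M t)"
definition R2acute :: "ise_model \<Rightarrow> real \<Rightarrow> real mat" where
  "R2acute M t = T2 M t * Racute M t * transpose_mat (T2bar M t)"
definition R12acute :: "ise_model \<Rightarrow> real \<Rightarrow> real mat" where
  "R12acute M t = T1 M t * Racute M t * transpose_mat (T2bar M t)"

text \<open>
  The factors of the decompositions are chosen continuously in time, which is possible for an
  analytic matrix of constant rank. The rank of \<open>Hbar\<close> is constant, too, since the block sizes of
  its decomposition do not depend on time.
\<close>

definition model_assms :: "ise_model \<Rightarrow> bool" where
  "model_assms M \<longleftrightarrow>
     dimX M \<ge> dimY M \<and> dimY M \<ge> 1 \<and> dimY M \<ge> dimD M \<and>
     smooth_bounded_mat (t0 M) (dimX M) (dimX M) (matA M) \<and>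
     smooth_bounded_mat (t0 M) (dimX M) (dimU M) (matB M) \<and>
     smooth_bounded_mat (t0 M) (dimX M) (dimD M) (matG M) \<and>
     smooth_bounded_mat (t0 M) (dimY M) (dimX M) (matC M) \<and>
     smooth_bounded_mat (t0 M) (dimY M) (dimU M) (matD M) \<and>
     smooth_bounded_mat (t0 M) (dimX M) (dimW M) (matW M) \<and>
     entrywise (analytic_from (t0 M)) (t0 M) (dimY M) (dimD M) (matH M) \<and>
     (\<forall>t\<ge>t0 M. vec_space.rank (dimY M) (matH M t) = rkH M) \<and>
     (\<forall>t\<ge>t0 M. is_svd (dimY M) (dimD M) (rkH M) (matH M t) (svdU M t) (svd\<Sigma> M t) (svdV M t)) \<and>
     cont_mat (t0 M) (dimY M) (dimY M) (svdU M) \<and>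
     cont_mat (t0 M) (dimD M) (dimD M) (svdV M) \<and>
     cont_mat (t0 M) (dimYbar M) (dimX M) (Cbar M) \<and>
     cont_mat (t0 M) (dimYbar M) (dimX M) (Cbarbar M) \<and>
     cont_mat (t0 M) (dimYbar M) (dimU M) (Dbar M) \<and>
     cont_mat (t0 M) (dimYbar M) (dimU M) (Dbarbar M) \<and>
     cont_mat (t0 M) (dimYbar M) (dimD M) (Hbar M) \<and>
     cont_mat (t0 M) (dimYbar M) (dimD M) (Hbarbar M) \<and>
     (\<forall>t\<ge>t0 M. is_svd (dimYbar M) (dimD M) (rkHbar M) (Hbar M t)
                  (svdUbar M t) (svd\<Sigma>bar M t) (svdVbar M t)) \<and>
     cont_mat (t0 M) (dimYbar M) (dimYbar M) (svdUbar M) \<and>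
     cont_mat (t0 M) (dimD M) (dimD M) (svdVbar M) \<and>
     (\<forall>t\<ge>t0 M. T2bar M t * Hbarbar M t = 0\<^sub>m (dimYbar M - rkHbar M) (dimD M)) \<and>
     (\<forall>t\<ge>t0 M. vec_space.rank (dimYbar M - rkHbar M) (C2bar M t * G2 M t) = dimD M - rkH M) \<and>
     cont_mat (t0 M) (dimW M) (dimW M) (matQ M) \<and> (\<forall>t\<ge>t0 M. pos_semidef (dimW M) (matQ M t)) \<and>
     cont_mat (t0 M) (dimY M) (dimY M) (matR M) \<and> (\<forall>t\<ge>t0 M. pos_def (dimY M) (matR M t)) \<and>
     cont_mat (t0 M) (dimYbar M) (dimYbar M) (Rbar M) \<and>
     (\<forall>t\<ge>t0 M. pos_def (dimYbar M) (Rbar M t)) \<and>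
     cont_mat (t0 M) (dimY M) (dimYbar M) (Racute M)"

definition noise_assms :: "ise_model \<Rightarrow> 'w ise_signals \<Rightarrow> bool" where
  "noise_assms M \<Xi> \<longleftrightarrow>
     (let Pr = prob \<Xi>; s = t0 M; q = dimW M; l = dimY M; lb = dimYbar M;
          w = noiseW \<Xi>; v = noiseV \<Xi>; vb = noiseVbar \<Xi>
      in
      gproc Pr s q w \<and> gproc Pr s l v \<and> gproc Pr s lb vb \<and>
      zero_mean Pr s q w \<and> zero_mean Pr s l v \<and> zero_mean Pr s lb vb \<and>
      delta_correlated Pr s q q w w (matQ M) \<and>
      delta_correlated Pr s l l v v (matR M) \<and>
      delta_correlated Pr s lb lb vb vb (Rbar M) \<and>
      delta_correlated Pr s q l w v (\<lambda>t. 0\<^sub>m q l) \<and>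
      delta_correlated Pr s q lb w vb (\<lambda>t. 0\<^sub>m q lb) \<and>
      delta_correlated Pr s l lb v vb (Racute M))"

text \<open>The inputs may be random; their derivatives are only required to exist as generalized processes.\<close>

definition input_assms :: "ise_model \<Rightarrow> 'w ise_signals \<Rightarrow> bool" where
  "input_assms M \<Xi> \<longleftrightarrow>
     process (prob \<Xi>) (t0 M) (dimU M) (sigU \<Xi>) \<and>
     gproc (prob \<Xi>) (t0 M) (dimU M) (derU \<Xi>) \<and>
     has_gderiv (prob \<Xi>) (t0 M) (dimU M) (sigU \<Xi>) (derU \<Xi>) \<and>
     process (prob \<Xi>) (t0 M) (dimD M) (sigD \<Xi>) \<and>
     gproc (prob \<Xi>) (t0 M) (dimD M) (derD \<Xi>) \<and>
     has_gderiv (prob \<Xi>) (t0 M) (dimD M) (sigD \<Xi>) (derD \<Xi>)"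

definition initial_assms :: "ise_model \<Rightarrow> 'w ise_signals \<Rightarrow> bool" where
  "initial_assms M \<Xi> \<longleftrightarrow>
     (let Pr = prob \<Xi>; n = dimX M; e = (\<lambda>i \<omega>. (sigX \<Xi> (t0 M) \<omega> - xhat0 \<Xi> \<omega>) $ i)
      in
      prob_space.indep_set Pr
        (generated_events Pr {(\<lambda>\<omega>. sigX \<Xi> (t0 M) \<omega> $ i) | i. i < n})
        (generated_events Pr ({noiseW \<Xi> \<phi> | \<phi>. test_fun (t0 M) (dimW M) \<phi>} \<union>
                              {noiseV \<Xi> \<phi> | \<phi>. test_fun (t0 M) (dimY M) \<phi>})) \<and>
      (\<forall>\<omega>\<in>space Pr. xhat0 \<Xi> \<omega> \<in> carrier_vec n) \<and>
      (\<forall>i<n. (\<lambda>\<omega>. xhat0 \<Xi> \<omega> $ i) \<in> borel_measurable Pr \<and>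
             integrable Pr (\<lambda>\<omega>. xhat0 \<Xi> \<omega> $ i)) \<and>
      P0 M \<in> carrier_mat n n \<and>
      (\<forall>i<n. \<forall>j<n.
         integrable Pr (\<lambda>\<omega>. e i \<omega> * e j \<omega>) \<and>
         P0 M $$ (i, j) =
           (LINT \<omega>|Pr. (e i \<omega> - (LINT \<omega>'|Pr. e i \<omega>')) * (e j \<omega> - (LINT \<omega>'|Pr. e j \<omega>')))))"

definition xdot :: "ise_model \<Rightarrow> 'w ise_signals \<Rightarrow> 'w gproc" where
  "xdot M \<Xi> =
     matA M \<odot> regular (t0 M) (sigX \<Xi>) + matB M \<odot> regular (t0 M) (sigU \<Xi>) +
     matG M \<odot> regular (t0 M) (sigD \<Xi>) + matW M \<odot> noiseW \<Xi>"

definition output_y :: "ise_model \<Rightarrow> 'w ise_signals \<Rightarrow> 'w gproc" where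
  "output_y M \<Xi> =
     matC M \<odot> regular (t0 M) (sigX \<Xi>) + matD M \<odot> regular (t0 M) (sigU \<Xi>) +
     matH M \<odot> regular (t0 M) (sigD \<Xi>) + noiseV \<Xi>"

definition output_ybar :: "ise_model \<Rightarrow> 'w ise_signals \<Rightarrow> 'w gproc" where
  "output_ybar M \<Xi> =
     Cbar M \<odot> xdot M \<Xi> + Cbarbar M \<odot> regular (t0 M) (sigX \<Xi>) +
     Dbar M \<odot> derU \<Xi> + Dbarbar M \<odot> regular (t0 M) (sigU \<Xi>) +
     Hbar M \<odot> derD \<Xi> + Hbarbar M \<odot> regular (t0 M) (sigD \<Xi>) + noiseVbar \<Xi>"

definition ise_system :: "ise_model \<Rightarrow> 'w ise_signals \<Rightarrow> bool" where
  "ise_system M \<Xi> \<longleftrightarrow>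
     prob_space (prob \<Xi>) \<and> model_assms M \<and> noise_assms M \<Xi> \<and> input_assms M \<Xi> \<and>
     integrable_process (prob \<Xi>) (t0 M) (dimX M) (sigX \<Xi>) \<and>
     has_gderiv (prob \<Xi>) (t0 M) (dimX M) (sigX \<Xi>) (xdot M \<Xi>) \<and>
     initial_assms M \<Xi>"

section \<open>The ELISE filter\<close>

text \<open>\<open>P\<close> is the solution of the Riccati equation.\<close>

definition M1 :: "ise_model \<Rightarrow> real \<Rightarrow> real mat" where
  "M1 M t = minv (svd\<Sigma> M t)"

definition Ahat :: "ise_model \<Rightarrow> real \<Rightarrow> real mat" where
  "Ahat M t = matA M t - G1 M t * M1 M t * C1 M t"

definition Qhat :: "ise_model \<Rightarrow> real \<Rightarrow> real mat" where
  "Qhat M t = matW M t * matQ M t * transpose_mat (matW M t) +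
     G1 M t * M1 M t * R1 M t * transpose_mat (M1 M t) * transpose_mat (G1 M t)"

definition R2tilde :: "ise_model \<Rightarrow> (real \<Rightarrow> real mat) \<Rightarrow> real \<Rightarrow> real mat" where
  "R2tilde M P t =
     (C2bar M t * Ahat M t + T2bar M t * Cbarbar M t) * P t
       * transpose_mat (C2bar M t * Ahat M t + T2bar M t * Cbarbar M t) +
     C2bar M t * Qhat M t * transpose_mat (C2bar M t) + R2bar M t -
     transpose_mat (R12acute M t) * transpose_mat (M1 M t) * transpose_mat (G1 M t)
       * transpose_mat (C2bar M t) -
     C2bar M t * G1 M t * M1 M t * R12acute M t"

definition M2_gram :: "ise_model \<Rightarrow> (real \<Rightarrow> real mat) \<Rightarrow> real \<Rightarrow> real mat" where
  "M2_gram M P t =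
     transpose_mat (G2 M t) * transpose_mat (C2bar M t) * minv (R2tilde M P t)
       * C2bar M t * G2 M t"

definition M2 :: "ise_model \<Rightarrow> (real \<Rightarrow> real mat) \<Rightarrow> real \<Rightarrow> real mat" where
  "M2 M P t =
     minv (M2_gram M P t) * transpose_mat (G2 M t) * transpose_mat (C2bar M t)
       * minv (R2tilde M P t)"

definition Abar :: "ise_model \<Rightarrow> (real \<Rightarrow> real mat) \<Rightarrow> real \<Rightarrow> real mat" where
  "Abar M P t =
     (1\<^sub>m (dimX M) - G2 M t * M2 M P t * C2bar M t) * Ahat M t -
     G2 M t * M2 M P t * T2bar M t * Cbarbar M t"

definition Qbar :: "ise_model \<Rightarrow> (real \<Rightarrow> real mat) \<Rightarrow> real \<Rightarrow> real mat" where
  "Qbar M P t =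
     (1\<^sub>m (dimX M) - G2 M t * M2 M P t * C2bar M t) * Qhat M t
       * transpose_mat (1\<^sub>m (dimX M) - G2 M t * M2 M P t * C2bar M t) +
     G2 M t * M2 M P t * R2bar M t * transpose_mat (M2 M P t) * transpose_mat (G2 M t)"

definition gainL :: "ise_model \<Rightarrow> (real \<Rightarrow> real mat) \<Rightarrow> real \<Rightarrow> real mat" where
  "gainL M P t =
     (P t * transpose_mat (C2 M t) - G2 M t * M2 M P t * transpose_mat (R2acute M t))
       * minv (R2 M t)"

definition riccati_rhs :: "ise_model \<Rightarrow> (real \<Rightarrow> real mat) \<Rightarrow> real \<Rightarrow> real mat" where
  "riccati_rhs M P t =
     Abar M P t * P t + P t * transpose_mat (Abar M P t) + Qbar M P t -
     gainL M P t * R2 M t * transpose_mat (gainL M P t)"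

text \<open>The two inverses in the definition of \<open>M2\<close> are required to exist.\<close>

definition filter_covariance :: "ise_model \<Rightarrow> (real \<Rightarrow> real mat) \<Rightarrow> bool" where
  "filter_covariance M P \<longleftrightarrow>
     P (t0 M) = P0 M \<and>
     (\<forall>t\<ge>t0 M.
        P t \<in> carrier_mat (dimX M) (dimX M) \<and>
        invertible_mat (R2tilde M P t) \<and> invertible_mat (M2_gram M P t) \<and>
        (\<forall>i<dimX M. \<forall>j<dimX M.
           ((\<lambda>\<tau>. P \<tau> $$ (i, j)) has_real_derivative riccati_rhs M P t $$ (i, j))
             (at t within {t0 M..})))"

definition d1hat ::
  "ise_model \<Rightarrow> 'w ise_signals \<Rightarrow> (real \<Rightarrow> 'w \<Rightarrow> real vec) \<Rightarrow> 'w gproc" where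
  "d1hat M \<Xi> xh =
     M1 M \<odot> (T1 M \<odot> output_y M \<Xi> - C1 M \<odot> regular (t0 M) xh - D1 M \<odot> regular (t0 M) (sigU \<Xi>))"

definition d2hat ::
  "ise_model \<Rightarrow> 'w ise_signals \<Rightarrow> (real \<Rightarrow> real mat) \<Rightarrow> (real \<Rightarrow> 'w \<Rightarrow> real vec) \<Rightarrow> 'w gproc"
where
  "d2hat M \<Xi> P xh =
     M2 M P \<odot>
       (T2bar M \<odot> output_ybar M \<Xi> -
        (\<lambda>t. C2bar M t * matA M t + T2bar M t * Cbarbar M t) \<odot> regular (t0 M) xh -
        (\<lambda>t. C2bar M t * matB M t) \<odot> regular (t0 M) (sigU \<Xi>) -
        (\<lambda>t. C2bar M t * G1 M t) \<odot> d1hat M \<Xi> xh -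
        D2bar M \<odot> derU \<Xi> -
        (\<lambda>t. T2bar M t * Dbarbar M t) \<odot> regular (t0 M) (sigU \<Xi>))"

definition xhatdot ::
  "ise_model \<Rightarrow> 'w ise_signals \<Rightarrow> (real \<Rightarrow> real mat) \<Rightarrow> (real \<Rightarrow> 'w \<Rightarrow> real vec) \<Rightarrow> 'w gproc"
where
  "xhatdot M \<Xi> P xh =
     matA M \<odot> regular (t0 M) xh + matB M \<odot> regular (t0 M) (sigU \<Xi>) +
     G1 M \<odot> d1hat M \<Xi> xh + G2 M \<odot> d2hat M \<Xi> P xh +
     gainL M P \<odot>
       (T2 M \<odot> output_y M \<Xi> - C2 M \<odot> regular (t0 M) xh - D2 M \<odot> regular (t0 M) (sigU \<Xi>))"

definition elise_filter ::
  "ise_model \<Rightarrow> 'w ise_signals \<Rightarrow> (real \<Rightarrow> real mat) \<Rightarrow> (real \<Rightarrow> 'w \<Rightarrow> real vec) \<Rightarrow> bool" where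
  "elise_filter M \<Xi> P xh \<longleftrightarrow>
     filter_covariance M P \<and>
     integrable_process (prob \<Xi>) (t0 M) (dimX M) xh \<and>
     (AE \<omega> in prob \<Xi>. xh (t0 M) \<omega> = xhat0 \<Xi> \<omega>) \<and>
     has_gderiv (prob \<Xi>) (t0 M) (dimX M) xh (xhatdot M \<Xi> P xh)"

definition Abreve :: "ise_model \<Rightarrow> (real \<Rightarrow> real mat) \<Rightarrow> real \<Rightarrow> real mat" where
  "Abreve M P t = Abar M P t - gainL M P t * C2 M t"

definition elise_unif_asymp_stable :: "ise_model \<Rightarrow> (real \<Rightarrow> real mat) \<Rightarrow> bool" where
  "elise_unif_asymp_stable M P \<longleftrightarrow> unif_asymp_stable (t0 M) (dimX M) (Abreve M P)"

definition bias ::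
  "ise_model \<Rightarrow> 'w ise_signals \<Rightarrow> (real \<Rightarrow> 'w \<Rightarrow> real vec) \<Rightarrow> real \<Rightarrow> real vec" where
  "bias M \<Xi> xh t = vec (dimX M) (\<lambda>i. LINT \<omega>|prob \<Xi>. (sigX \<Xi> t \<omega> - xh t \<omega>) $ i)"

end

theory Submission
  imports Defs
begin

text \<open>
  The bias \<open>b(t) = E[x(t) - xhat(t)]\<close> is a solution of \<open>db/dt = Abreve b\<close>. Once this is known, the theorem is
  about a linear differential equation.

  The error equation. Up to parts of zero mean, \<open>dx/dt\<close> and \<open>dxhat/dt\<close> are combinations of
  \<open>x\<close>, \<open>xhat\<close>, \<open>u\<close>, \<open>d\<close>, \<open>du/dt\<close> and \<open>dd/dt\<close> with matrix coefficients, and these coefficients can be computed by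
  matrix algebra alone (locale \<open>signal_calculus\<close>). The known input cancels because the filter subtracts its
  effect. From \<open>M\<^sub>1 T\<^sub>1 H = V\<^sub>1\<^sup>T\<close> it follows that the estimate of \<open>d\<^sub>1\<close> is \<open>V\<^sub>1\<^sup>T d\<close> plus a linear function of
  \<open>x - xhat\<close>; the additional measurement is premultiplied by a matrix that annihilates the coefficients of
  \<open>dd/dt\<close> and \<open>d\<close>, so that \<open>d\<close> enters it through \<open>dx/dt\<close> only, and as \<open>M\<^sub>2\<close> is a left inverse of \<open>C2bar G\<^sub>2\<close>
  the estimate of \<open>d\<^sub>2\<close> is \<open>V\<^sub>2\<^sup>T d\<close> plus a linear function of \<open>x - xhat\<close>. Since \<open>G = G\<^sub>1 V\<^sub>1\<^sup>T + G\<^sub>2 V\<^sub>2\<^sup>T\<close>, the unknown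
  input cancels, and \<open>Abreve (x - xhat)\<close> is what remains (\<open>rep_error\<close>). Taking expectations of the increments over
  \<open>[t\<^sub>0, t]\<close> and exchanging expectation and integral gives an integral equation for \<open>b\<close>
  (\<open>bias_increment\<close>). It is a differential equation because \<open>Abreve\<close> is continuous (\<open>cont_Abreve\<close>); here the inverses
  are handled by Cramer's rule.

  Exponential decay. For a linear system, uniform attractivity scales with the initial value: some time span
  \<open>T\<close> halves every solution, whatever its initial time. Iteration gives an exponential rate
  (\<open>unif_asymp_stable_imp_exponential\<close>).

  The explicit constants. Along a solution, \<open>V(t) = b(t)\<^sup>T S(t) b(t)\<close> is the integral of \<open>|b|\<^sup>2\<close> over \<open>[t, \<infinity>)\<close>, so that
  \<open>dV/dt = -|b|\<^sup>2 \<le> -V / \<lambda>\<^sub>m\<^sub>a\<^sub>x\<close>. Hence \<open>V\<close> decays at least as \<open>exp (-(t - t\<^sub>0) / \<lambda>\<^sub>m\<^sub>a\<^sub>x)\<close>, and \<open>|b|\<^sup>2 \<le> V / \<lambda>\<^sub>m\<^sub>i\<^sub>n\<close> (\<open>gram_bounds\<close>).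
  The supremum is finite by the exponential decay of solutions. The infimum is positive because a bounded \<open>Abreve\<close> cannot
  make a solution vanish quickly. Both estimates concern the quadratic form of \<open>S(t)\<close>; they carry over to
  eigenvalues because the extreme values of the Rayleigh quotient are eigenvalues
  (\<open>symmetric_spectrum_bounds\<close>).
\<close>

section \<open>Quadratic forms and the spectrum of a symmetric matrix\<close>

lemma scalar_prod_self_sum:
  fixes x :: "real vec" shows "x \<in> carrier_vec n \<Longrightarrow> x \<bullet> x = (\<Sum>i<n. (x $ i)\<^sup>2)"
  by (auto simp: scalar_prod_def power2_eq_square atLeast0LessThan)

lemma scalar_prod_self_nonneg: fixes x :: "real vec" shows "0 \<le> x \<bullet> x"
  by (auto simp: scalar_prod_def intro!: sum_nonneg)

lemma scalar_prod_self_pos: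
  fixes x :: "real vec"
  assumes "x \<in> carrier_vec n" "x \<noteq> 0\<^sub>v n"
  shows "0 < x \<bullet> x"
proof -
  obtain i where i: "i < n" "x $ i \<noteq> 0" using assms by (metis eq_vecI carrier_vecD index_zero_vec)
  have "0 < (\<Sum>i<n. (x $ i)\<^sup>2)" by (rule sum_pos2[of _ i]) (use i in auto)
  then show ?thesis using assms by (simp add: scalar_prod_self_sum)
qed

lemma vnorm_power2: "(vnorm x)\<^sup>2 = x \<bullet> x"
  by (simp add: vnorm_def scalar_prod_self_nonneg)

lemma vnorm_nonneg: "0 \<le> vnorm x"
  by (simp add: vnorm_def scalar_prod_self_nonneg)

lemma vnorm_smult: "vnorm (c \<cdot>\<^sub>v x) = \<bar>c\<bar> * vnorm x"
proof -
  have "(c \<cdot>\<^sub>v x) \<bullet> (c \<cdot>\<^sub>v x) = c\<^sup>2 * (x \<bullet> x)"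
    by (simp add: scalar_prod_def sum_distrib_left power2_eq_square mult_ac)
  then show ?thesis by (simp add: vnorm_def real_sqrt_mult)
qed

lemma symmetric_form_commute:
  fixes A :: "real mat"
  assumes "A \<in> carrier_mat n n" "transpose_mat A = A" "x \<in> carrier_vec n" "y \<in> carrier_vec n"
  shows "x \<bullet> (A *\<^sub>v y) = y \<bullet> (A *\<^sub>v x)"
  using transpose_vec_mult_scalar[OF assms(1,4,3)] assms
  by (metis comm_scalar_prod mult_mat_vec_carrier)

lemma form_add_smult:
  fixes A :: "real mat"
  assumes "A \<in> carrier_mat n n" "transpose_mat A = A" "x \<in> carrier_vec n" "y \<in> carrier_vec n"
  shows "(x + r \<cdot>\<^sub>v y) \<bullet> (A *\<^sub>v (x + r \<cdot>\<^sub>v y)) =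
    x \<bullet> (A *\<^sub>v x) + 2 * r * (x \<bullet> (A *\<^sub>v y)) + r\<^sup>2 * (y \<bullet> (A *\<^sub>v y))"
proof -
  have c: "A *\<^sub>v x \<in> carrier_vec n" "A *\<^sub>v y \<in> carrier_vec n" "r \<cdot>\<^sub>v y \<in> carrier_vec n"
    using assms by auto
  have "A *\<^sub>v (x + r \<cdot>\<^sub>v y) = A *\<^sub>v x + r \<cdot>\<^sub>v (A *\<^sub>v y)"
    using assms c by (simp add: mult_add_distrib_mat_vec[of _ n n] mult_mat_vec[of _ n n])
  then show ?thesis
    using assms c symmetric_form_commute[OF assms]
    by (simp add: scalar_prod_add_distrib[of _ n] add_scalar_prod_distrib[of _ n]
        algebra_simps power2_eq_square)
qed

text \<open>The polynomial \<open>(x + r y)\<^sup>T A (x + r y)\<close> in \<open>r\<close> has no negative values, so its discriminant is not positive.\<close>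

lemma pos_semidef_cauchy_schwarz:
  assumes A: "pos_semidef n A" and x: "x \<in> carrier_vec n" and y: "y \<in> carrier_vec n"
  shows "(x \<bullet> (A *\<^sub>v y))\<^sup>2 \<le> (x \<bullet> (A *\<^sub>v x)) * (y \<bullet> (A *\<^sub>v y))"
proof -
  define a b c where "a = x \<bullet> (A *\<^sub>v x)" and "b = x \<bullet> (A *\<^sub>v y)" and "c = y \<bullet> (A *\<^sub>v y)"
  have q: "0 \<le> a + 2 * r * b + r\<^sup>2 * c" for r
  proof -
    have "x + r \<cdot>\<^sub>v y \<in> carrier_vec n" using x y by auto
    with A have "0 \<le> (x + r \<cdot>\<^sub>v y) \<bullet> (A *\<^sub>v (x + r \<cdot>\<^sub>v y))" by (auto simp: pos_semidef_def)
    moreover have "(x + r \<cdot>\<^sub>v y) \<bullet> (A *\<^sub>v (x + r \<cdot>\<^sub>v y)) = a + 2 * r * b + r\<^sup>2 * c"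
      using A x y form_add_smult[of A n x y r] by (simp add: pos_semidef_def a_def b_def c_def)
    ultimately show ?thesis by simp
  qed
  have "c \<ge> 0" using A y by (auto simp: pos_semidef_def c_def)
  have "b\<^sup>2 \<le> a * c"
  proof (cases "c = 0")
    case True
    have "b = 0"
      \<comment> \<open>The polynomial has degree at most one and is bounded below, hence constant.\<close>
    proof (rule ccontr)
      assume "b \<noteq> 0"
      with q[of "-(a + 1) / (2 * b)"] True show False by (simp add: field_simps)
    qed
    with True show ?thesis by simp
  next
    case False
    with \<open>c \<ge> 0\<close> have "c > 0" by simp
    \<comment> \<open>The minimum is attained at \<open>r = - b / c\<close>.\<close>
    have "0 \<le> a - b\<^sup>2 / c"
      using q[of "- b / c"] \<open>c > 0\<close> by (simp add: field_simps power2_eq_square)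
    with \<open>c > 0\<close> show ?thesis by (simp add: field_simps)
  qed
  then show ?thesis by (simp add: a_def b_def c_def)
qed

text \<open>The constant is explicit so that bounds on the entries that are uniform in time give a bound on the form that is
  uniform in time.\<close>

lemma form_le_entry_sum:
  fixes A :: "real mat"
  assumes A: "A \<in> carrier_mat n n" and x: "x \<in> carrier_vec n"
  shows "\<bar>x \<bullet> (A *\<^sub>v x)\<bar> \<le> (\<Sum>i<n. \<Sum>j<n. \<bar>A $$ (i, j)\<bar>) * (x \<bullet> x)"
proof -
  have xi: "\<bar>x $ i * x $ j\<bar> \<le> x \<bullet> x" if "i < n" "j < n" for i j
  proof -
    have "(x $ i)\<^sup>2 \<le> x \<bullet> x" "(x $ j)\<^sup>2 \<le> x \<bullet> x"
      using that by (auto simp: scalar_prod_self_sum[OF x] intro!: member_le_sum)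
    moreover have "2 * \<bar>x $ i * x $ j\<bar> \<le> (x $ i)\<^sup>2 + (x $ j)\<^sup>2"
      using sum_squares_bound[of "\<bar>x $ i\<bar>" "\<bar>x $ j\<bar>"] by (simp add: abs_mult)
    ultimately show ?thesis by linarith
  qed
  have "x \<bullet> (A *\<^sub>v x) = (\<Sum>i<n. \<Sum>j<n. A $$ (i, j) * (x $ i * x $ j))"
    using A x
    by (auto simp: scalar_prod_def sum_distrib_left mult_ac atLeast0LessThan intro!: sum.cong)
  also have "\<bar>\<dots>\<bar> \<le> (\<Sum>i<n. \<Sum>j<n. \<bar>A $$ (i, j)\<bar> * (x \<bullet> x))"
  proof -
    have "\<bar>A $$ (i, j) * (x $ i * x $ j)\<bar> \<le> \<bar>A $$ (i, j)\<bar> * (x \<bullet> x)" if "i < n" "j < n" for i j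
      unfolding abs_mult[of "A $$ (i, j)"] by (intro mult_left_mono xi that) simp
    then show ?thesis by (intro order.trans[OF sum_abs] sum_mono) simp
  qed
  finally show ?thesis by (simp add: sum_distrib_right)
qed

lemma form_bounded:
  fixes A :: "real mat"
  assumes A: "A \<in> carrier_mat n n"
  shows "\<exists>K>0. \<forall>x\<in>carrier_vec n. \<bar>x \<bullet> (A *\<^sub>v x)\<bar> \<le> K * (x \<bullet> x)"
proof (intro exI conjI ballI)
  let ?K = "\<Sum>i<n. \<Sum>j<n. \<bar>A $$ (i, j)\<bar>"
  show "?K + 1 > 0" by (intro add_nonneg_pos sum_nonneg) auto
  show "\<bar>x \<bullet> (A *\<^sub>v x)\<bar> \<le> (?K + 1) * (x \<bullet> x)" if "x \<in> carrier_vec n" for x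
    using form_le_entry_sum[OF A that] scalar_prod_self_nonneg[of x] by (simp add: distrib_right)
qed

lemma invertible_obtain_inverse:
  fixes A :: "real mat"
  assumes A: "A \<in> carrier_mat n n" and d: "det A \<noteq> 0"
  shows "minv A \<in> carrier_mat n n" "A * minv A = 1\<^sub>m n" "minv A * A = 1\<^sub>m n"
proof -
  from det_non_zero_imp_unit[OF A d, of "()"] mat_inverse(1)[OF A, of "()"]
  obtain B where B: "mat_inverse A = Some B" by (cases "mat_inverse A") auto
  from mat_inverse(2)[OF A B] B
  show "minv A \<in> carrier_mat n n" "A * minv A = 1\<^sub>m n" "minv A * A = 1\<^sub>m n" by auto
qed

text \<open>For \<open>y = A\<^sup>-\<^sup>1 x\<close> the Cauchy-Schwarz inequality reads \<open>|x|\<^sup>4 \<le> (x\<^sup>T A x) (x\<^sup>T A\<^sup>-\<^sup>1 x)\<close>, and the last factor is at most a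
  multiple of \<open>|x|\<^sup>2\<close>.\<close>

lemma pos_semidef_invertible_coercive:
  assumes A: "pos_semidef n A" and d: "det A \<noteq> 0"
  shows "\<exists>c>0. \<forall>x\<in>carrier_vec n. c * (x \<bullet> x) \<le> x \<bullet> (A *\<^sub>v x)"
proof -
  have Ac: "A \<in> carrier_mat n n" using A by (simp add: pos_semidef_def)
  note B = invertible_obtain_inverse[OF Ac d]
  obtain K where K: "K > 0" "\<And>x. x \<in> carrier_vec n \<Longrightarrow> \<bar>x \<bullet> (minv A *\<^sub>v x)\<bar> \<le> K * (x \<bullet> x)"
    using form_bounded[OF B(1)] by blast
  have "1 / K * (x \<bullet> x) \<le> x \<bullet> (A *\<^sub>v x)" if x: "x \<in> carrier_vec n" for x
  proof (cases "x = 0\<^sub>v n")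
    case True
    then show ?thesis using A x by (auto simp: pos_semidef_def)
  next
    case False
    define y where "y = minv A *\<^sub>v x"
    have y: "y \<in> carrier_vec n" using B x by (auto simp: y_def)
    have Ay: "A *\<^sub>v y = x" using B x Ac by (simp add: y_def assoc_mult_mat_vec[symmetric, of _ n n _ n])
    have "(x \<bullet> x)\<^sup>2 \<le> (x \<bullet> (A *\<^sub>v x)) * (y \<bullet> x)"
      using pos_semidef_cauchy_schwarz[OF A x y] by (simp add: Ay)
    also have "\<dots> \<le> (x \<bullet> (A *\<^sub>v x)) * (K * (x \<bullet> x))"
      using K(2)[OF x] A x y comm_scalar_prod[OF y x]
      by (intro mult_left_mono) (auto simp: pos_semidef_def y_def)
    finally have "(x \<bullet> x) * (x \<bullet> x) \<le> (K * (x \<bullet> (A *\<^sub>v x))) * (x \<bullet> x)"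
      by (simp add: power2_eq_square mult_ac)
    then have "x \<bullet> x \<le> K * (x \<bullet> (A *\<^sub>v x))"
      using scalar_prod_self_pos[OF x False] by (simp add: mult_le_cancel_right)
    then show ?thesis using K by (simp add: field_simps)
  qed
  with K show ?thesis by (intro exI[of _ "1 / K"]) auto
qed

text \<open>Let \<open>\<mu>\<close> be the supremum of the Rayleigh quotient. If \<open>\<mu>\<close> were not an eigenvalue, then the semidefinite matrix
  \<open>\<mu> I - A\<close> would be invertible, hence coercive, and the Rayleigh quotient would stay away from \<open>\<mu>\<close>.\<close>

lemma rayleigh_sup_eigenvalue:
  fixes A :: "real mat"
  assumes A: "A \<in> carrier_mat n n" and sym: "transpose_mat A = A" and n: "n > 0"
  shows "\<exists>\<mu>. eigenvalue A \<mu> \<and> (\<forall>x\<in>carrier_vec n. x \<bullet> (A *\<^sub>v x) \<le> \<mu> * (x \<bullet> x))"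
proof -
  define Q where "Q = {x \<bullet> (A *\<^sub>v x) | x. x \<in> carrier_vec n \<and> x \<bullet> x = 1}"
  define \<mu> where "\<mu> = Sup Q"
  obtain K where K: "K > 0" "\<And>x. x \<in> carrier_vec n \<Longrightarrow> \<bar>x \<bullet> (A *\<^sub>v x)\<bar> \<le> K * (x \<bullet> x)"
    using form_bounded[OF A] by blast
  have bdd: "bdd_above Q" unfolding Q_def by (rule bdd_aboveI[of _ K]) (use K in fastforce)
  have ne: "Q \<noteq> {}" unfolding Q_def using n
    by (auto intro!: exI[of _ "unit_vec n 0"])
  have up: "x \<bullet> (A *\<^sub>v x) \<le> \<mu> * (x \<bullet> x)" if x: "x \<in> carrier_vec n" for x
  proof (cases "x = 0\<^sub>v n")
    case True
    then show ?thesis using A x by auto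
  next
    case False
    define r where "r = x \<bullet> x"
    have r: "r > 0" using scalar_prod_self_pos[OF x False] by (simp add: r_def)
    define y where "y = (1 / sqrt r) \<cdot>\<^sub>v x"
    have y: "y \<in> carrier_vec n" using x by (simp add: y_def)
    have Ay: "A *\<^sub>v y = (1 / sqrt r) \<cdot>\<^sub>v (A *\<^sub>v x)" using A x by (simp add: y_def mult_mat_vec)
    have ss: "1 / sqrt r * (1 / sqrt r) = 1 / r" using r by simp
    have "y \<bullet> y = 1" using r x ss by (simp add: y_def r_def[symmetric])
    moreover have "y \<bullet> (A *\<^sub>v y) = (x \<bullet> (A *\<^sub>v x)) / r"
      unfolding Ay using A x r by (simp add: y_def)
    ultimately have "(x \<bullet> (A *\<^sub>v x)) / r \<in> Q" using y unfolding Q_def by force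
    then have "(x \<bullet> (A *\<^sub>v x)) / r \<le> \<mu>" unfolding \<mu>_def by (rule cSup_upper[OF _ bdd])
    then show ?thesis using r by (simp add: r_def field_simps)
  qed
  define B where "B = \<mu> \<cdot>\<^sub>m 1\<^sub>m n - A"
  have Bc: "B \<in> carrier_mat n n" using A by (auto simp: B_def)
  have Bx: "B *\<^sub>v x = \<mu> \<cdot>\<^sub>v x - A *\<^sub>v x" if x: "x \<in> carrier_vec n" for x
  proof -
    have "(\<mu> \<cdot>\<^sub>m 1\<^sub>m n) *\<^sub>v x = \<mu> \<cdot>\<^sub>v x"
      using x by (intro eq_vecI) auto
    then show ?thesis using A x by (simp add: B_def minus_mult_distrib_mat_vec[of _ n n])
  qed
  have form: "x \<bullet> (B *\<^sub>v x) = \<mu> * (x \<bullet> x) - x \<bullet> (A *\<^sub>v x)" if x: "x \<in> carrier_vec n" for x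
    using A x by (simp add: Bx scalar_prod_minus_distrib[of _ n])
  have "transpose_mat B = B"
  proof (rule eq_matI)
    fix i j assume ij: "i < dim_row B" "j < dim_col B"
    then have "A $$ (j, i) = A $$ (i, j)" using A Bc sym by (metis carrier_matD index_transpose_mat(1))
    then show "transpose_mat B $$ (i, j) = B $$ (i, j)" using ij Bc A by (auto simp: B_def)
  qed (use Bc in auto)
  then have psd: "pos_semidef n B" using Bc up by (auto simp: pos_semidef_def form)
  have "det B = 0"
  proof (rule ccontr)
    assume "det B \<noteq> 0"
    then obtain c where c: "c > 0" "\<And>x. x \<in> carrier_vec n \<Longrightarrow> c * (x \<bullet> x) \<le> x \<bullet> (B *\<^sub>v x)"
      using pos_semidef_invertible_coercive[OF psd] by blast
    have "\<mu> \<le> \<mu> - c" unfolding \<mu>_def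
    proof (rule cSup_least[OF ne])
      fix q assume "q \<in> Q"
      then obtain x where x: "x \<in> carrier_vec n" "x \<bullet> x = 1" "q = x \<bullet> (A *\<^sub>v x)" by (auto simp: Q_def)
      then show "q \<le> Sup Q - c" using c(2)[OF x(1)] form[OF x(1)] by (simp add: \<mu>_def)
    qed
    then show False using c by simp
  qed
  then obtain v where v: "v \<in> carrier_vec n" "v \<noteq> 0\<^sub>v n" "B *\<^sub>v v = 0\<^sub>v n"
    using det_0_iff_vec_prod_zero_field[OF Bc] by blast
  have "A *\<^sub>v v = \<mu> \<cdot>\<^sub>v v"
  proof (rule eq_vecI)
    fix i assume i: "i < dim_vec (\<mu> \<cdot>\<^sub>v v)"
    then have "(\<mu> \<cdot>\<^sub>v v - A *\<^sub>v v) $ i = 0" using v Bx[OF v(1)] by simp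
    then show "(A *\<^sub>v v) $ i = (\<mu> \<cdot>\<^sub>v v) $ i" using i v A
      by (subst (asm) index_minus_vec) (auto simp del: index_mult_mat_vec)
  qed (use v A in auto)
  then have "eigenvalue A \<mu>" using v A by (auto simp: eigenvalue_def eigenvector_def)
  with up show ?thesis by blast
qed

lemma rayleigh_inf_eigenvalue:
  fixes A :: "real mat"
  assumes A: "A \<in> carrier_mat n n" and sym: "transpose_mat A = A" and n: "n > 0"
  shows "\<exists>\<mu>. eigenvalue A \<mu> \<and> (\<forall>x\<in>carrier_vec n. \<mu> * (x \<bullet> x) \<le> x \<bullet> (A *\<^sub>v x))"
proof -
  have "transpose_mat (- A) = - A" using sym A
    by (metis transpose_uminus)
  then obtain \<mu> where \<mu>: "eigenvalue (- A) \<mu>"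
      "\<And>x. x \<in> carrier_vec n \<Longrightarrow> x \<bullet> (- A *\<^sub>v x) \<le> \<mu> * (x \<bullet> x)"
    using rayleigh_sup_eigenvalue[of "- A" n] A n by auto
  have neg: "- A *\<^sub>v x = - (A *\<^sub>v x)" if "x \<in> carrier_vec n" for x
    using that A by auto
  from \<mu>(1) obtain v where v: "v \<in> carrier_vec n" "v \<noteq> 0\<^sub>v n" "- A *\<^sub>v v = \<mu> \<cdot>\<^sub>v v"
    using A by (auto simp: eigenvalue_def eigenvector_def)
  have "A *\<^sub>v v = - (\<mu> \<cdot>\<^sub>v v)"
    using v(3) neg[OF v(1)] by (metis uminus_uminus_vec)
  also have "\<dots> = (- \<mu>) \<cdot>\<^sub>v v" by auto
  finally have "A *\<^sub>v v = (- \<mu>) \<cdot>\<^sub>v v" .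
  then have "eigenvalue A (- \<mu>)" using v A by (auto simp: eigenvalue_def eigenvector_def)
  moreover have "(- \<mu>) * (x \<bullet> x) \<le> x \<bullet> (A *\<^sub>v x)" if x: "x \<in> carrier_vec n" for x
    using \<mu>(2)[OF x] x A by (simp add: neg)
  ultimately show ?thesis by blast
qed

lemma eigenvalue_form:
  fixes A :: "real mat"
  assumes "eigenvalue A \<mu>" "A \<in> carrier_mat n n"
  obtains v where "v \<in> carrier_vec n" "0 < v \<bullet> v" "v \<bullet> (A *\<^sub>v v) = \<mu> * (v \<bullet> v)"
proof -
  obtain v where v: "v \<in> carrier_vec n" "v \<noteq> 0\<^sub>v n" "A *\<^sub>v v = \<mu> \<cdot>\<^sub>v v"
    using assms by (auto simp: eigenvalue_def eigenvector_def)
  then show thesis using that[of v] scalar_prod_self_pos[of v n] by simp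
qed

text \<open>The extreme eigenvalues, in which the rate of decay is expressed, are thus the best constants in bounds on the
  quadratic form, which can be estimated along solutions.\<close>

lemma symmetric_spectrum_bounds:
  fixes A :: "real mat"
  assumes A: "A \<in> carrier_mat n n" and sym: "transpose_mat A = A" and n: "n > 0"
  shows "x \<in> carrier_vec n \<Longrightarrow> x \<bullet> (A *\<^sub>v x) \<le> Max (spectrum A) * (x \<bullet> x)"
    and "x \<in> carrier_vec n \<Longrightarrow> Min (spectrum A) * (x \<bullet> x) \<le> x \<bullet> (A *\<^sub>v x)"
    and "(\<And>y. y \<in> carrier_vec n \<Longrightarrow> y \<bullet> (A *\<^sub>v y) \<le> C * (y \<bullet> y)) \<Longrightarrow> Max (spectrum A) \<le> C"
    and "(\<And>y. y \<in> carrier_vec n \<Longrightarrow> c * (y \<bullet> y) \<le> y \<bullet> (A *\<^sub>v y)) \<Longrightarrow> c \<le> Min (spectrum A)"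
    and "Min (spectrum A) \<le> Max (spectrum A)"
proof -
  have fin: "finite (spectrum A)" using card_finite_spectrum[OF A] by simp
  obtain \<mu> where \<mu>: "eigenvalue A \<mu>" "\<And>x. x \<in> carrier_vec n \<Longrightarrow> x \<bullet> (A *\<^sub>v x) \<le> \<mu> * (x \<bullet> x)"
    using rayleigh_sup_eigenvalue[OF assms] by blast
  obtain \<nu> where \<nu>: "eigenvalue A \<nu>" "\<And>x. x \<in> carrier_vec n \<Longrightarrow> \<nu> * (x \<bullet> x) \<le> x \<bullet> (A *\<^sub>v x)"
    using rayleigh_inf_eigenvalue[OF assms] by blast
  have le: "\<mu> \<le> Max (spectrum A)" "Min (spectrum A) \<le> \<nu>"
    using \<mu>(1) \<nu>(1) fin by (auto simp: spectrum_def)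
  have ne: "spectrum A \<noteq> {}" using \<mu>(1) by (auto simp: spectrum_def)
  show "x \<bullet> (A *\<^sub>v x) \<le> Max (spectrum A) * (x \<bullet> x)" if "x \<in> carrier_vec n" for x
    using \<mu>(2)[OF that] mult_right_mono[OF le(1) scalar_prod_self_nonneg[of x]] by linarith
  show "Min (spectrum A) * (x \<bullet> x) \<le> x \<bullet> (A *\<^sub>v x)" if "x \<in> carrier_vec n" for x
    using \<nu>(2)[OF that] mult_right_mono[OF le(2) scalar_prod_self_nonneg[of x]] by linarith
  have "Max (spectrum A) \<in> spectrum A" "Min (spectrum A) \<in> spectrum A" using fin ne by auto
  then have ev: "eigenvalue A (Max (spectrum A))" "eigenvalue A (Min (spectrum A))"
    by (auto simp: spectrum_def)
  show "Max (spectrum A) \<le> C" if C: "\<And>y. y \<in> carrier_vec n \<Longrightarrow> y \<bullet> (A *\<^sub>v y) \<le> C * (y \<bullet> y)"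
    using ev(1) A by (rule eigenvalue_form) (use C in \<open>metis mult_le_cancel_right_pos\<close>)
  show "c \<le> Min (spectrum A)" if C: "\<And>y. y \<in> carrier_vec n \<Longrightarrow> c * (y \<bullet> y) \<le> y \<bullet> (A *\<^sub>v y)"
    using ev(2) A by (rule eigenvalue_form) (use C in \<open>metis mult_le_cancel_right_pos\<close>)
  show "Min (spectrum A) \<le> Max (spectrum A)" using fin ne by (auto intro: order.trans[OF Min_le Max_ge])
qed

section \<open>Linear differential equations and exponential stability\<close>

lemma lin_solution_carrier: "lin_solution n A s \<xi> \<Longrightarrow> t \<ge> s \<Longrightarrow> \<xi> t \<in> carrier_vec n"
  by (simp add: lin_solution_def)

lemma lin_solution_restrict:
  assumes "lin_solution n A s \<xi>" "s \<le> s'"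
  shows "lin_solution n A s' \<xi>"
  using assms unfolding lin_solution_def
  by (auto intro: DERIV_subset[where s = "{s..}"])

lemma lin_solution_smult:
  assumes "lin_solution n A s \<xi>" and A: "\<And>t. t \<ge> s \<Longrightarrow> A t \<in> carrier_mat n n"
  shows "lin_solution n A s (\<lambda>t. c \<cdot>\<^sub>v \<xi> t)"
  unfolding lin_solution_def
proof (intro allI impI conjI)
  fix t i assume t: "t \<ge> s" and i: "i < n"
  have \<xi>: "\<And>\<tau>. \<tau> \<ge> s \<Longrightarrow> \<xi> \<tau> \<in> carrier_vec n" using assms by (simp add: lin_solution_def)
  have d: "((\<lambda>\<tau>. \<xi> \<tau> $ i) has_real_derivative (A t *\<^sub>v \<xi> t) $ i) (at t within {s..})"
    using assms t i by (simp add: lin_solution_def)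
  have e: "A t *\<^sub>v (c \<cdot>\<^sub>v \<xi> t) = c \<cdot>\<^sub>v (A t *\<^sub>v \<xi> t)"
    using A[OF t] \<xi>[OF t] by (simp add: mult_mat_vec)
  have "((\<lambda>\<tau>. c * \<xi> \<tau> $ i) has_real_derivative c * (A t *\<^sub>v \<xi> t) $ i) (at t within {s..})"
    by (rule DERIV_cmult[OF d])
  moreover have "(c \<cdot>\<^sub>v \<xi> \<tau>) $ i = c * \<xi> \<tau> $ i" if "\<tau> \<ge> s" for \<tau> using \<xi>[OF that] i by simp
  moreover have "(A t *\<^sub>v (c \<cdot>\<^sub>v \<xi> t)) $ i = c * (A t *\<^sub>v \<xi> t) $ i"
    unfolding e using A[OF t] i by simp
  ultimately show "((\<lambda>\<tau>. (c \<cdot>\<^sub>v \<xi> \<tau>) $ i) has_real_derivative (A t *\<^sub>v (c \<cdot>\<^sub>v \<xi> t)) $ i) (at t within {s..})"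
    using t by (auto intro: has_field_derivative_transform_within[where d = 1])
qed (use assms in \<open>auto simp: lin_solution_def\<close>)

lemma lin_solution_diff:
  assumes "lin_solution n A s \<xi>" "lin_solution n A s \<eta>" and A: "\<And>t. t \<ge> s \<Longrightarrow> A t \<in> carrier_mat n n"
  shows "lin_solution n A s (\<lambda>t. \<xi> t - \<eta> t)"
  unfolding lin_solution_def
proof (intro allI impI conjI)
  fix t i assume t: "t \<ge> s" and i: "i < n"
  have c: "\<xi> \<tau> \<in> carrier_vec n" "\<eta> \<tau> \<in> carrier_vec n" if "\<tau> \<ge> s" for \<tau>
    using assms that by (simp_all add: lin_solution_def)
  have d: "((\<lambda>\<tau>. \<xi> \<tau> $ i - \<eta> \<tau> $ i) has_real_derivative (A t *\<^sub>v \<xi> t) $ i - (A t *\<^sub>v \<eta> t) $ i) (at t within {s..})"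
    using assms t i by (intro DERIV_diff) (simp_all add: lin_solution_def)
  have e: "A t *\<^sub>v (\<xi> t - \<eta> t) = A t *\<^sub>v \<xi> t - A t *\<^sub>v \<eta> t"
    using A[OF t] c[OF t] by (simp add: mult_minus_distrib_mat_vec)
  have f: "(\<xi> \<tau> - \<eta> \<tau>) $ i = \<xi> \<tau> $ i - \<eta> \<tau> $ i" if "\<tau> \<ge> s" for \<tau> using c[OF that] i by simp
  have g: "(A t *\<^sub>v (\<xi> t - \<eta> t)) $ i = (A t *\<^sub>v \<xi> t) $ i - (A t *\<^sub>v \<eta> t) $ i"
    unfolding e using A[OF t] i by simp
  show "((\<lambda>\<tau>. (\<xi> \<tau> - \<eta> \<tau>) $ i) has_real_derivative (A t *\<^sub>v (\<xi> t - \<eta> t)) $ i) (at t within {s..})"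
    unfolding g by (rule has_field_derivative_transform_within[where d = 1, OF d]) (use t f in auto)
qed (use assms in \<open>auto simp: lin_solution_def\<close>)

lemma lin_solution_energy_deriv:
  assumes "lin_solution n A s \<xi>" and A: "\<And>t. t \<ge> s \<Longrightarrow> A t \<in> carrier_mat n n" and t: "t \<ge> s"
  shows "((\<lambda>\<tau>. \<xi> \<tau> \<bullet> \<xi> \<tau>) has_real_derivative 2 * (\<xi> t \<bullet> (A t *\<^sub>v \<xi> t))) (at t within {s..})"
proof -
  have c: "\<xi> \<tau> \<in> carrier_vec n" if "\<tau> \<ge> s" for \<tau> using assms that by (simp add: lin_solution_def)
  have "((\<lambda>\<tau>. \<Sum>i<n. (\<xi> \<tau> $ i)\<^sup>2) has_real_derivative (\<Sum>i<n. 2 * (\<xi> t $ i * (A t *\<^sub>v \<xi> t) $ i))) (at t within {s..})"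
  proof (rule DERIV_sum)
    fix i assume "i \<in> {..<n}"
    then have "((\<lambda>\<tau>. \<xi> \<tau> $ i) has_real_derivative (A t *\<^sub>v \<xi> t) $ i) (at t within {s..})"
      using assms by (simp add: lin_solution_def)
    then show "((\<lambda>\<tau>. (\<xi> \<tau> $ i)\<^sup>2) has_real_derivative 2 * (\<xi> t $ i * (A t *\<^sub>v \<xi> t) $ i)) (at t within {s..})"
      by (auto intro!: derivative_eq_intros)
  qed
  moreover have "(\<Sum>i<n. 2 * (\<xi> t $ i * (A t *\<^sub>v \<xi> t) $ i)) = 2 * (\<xi> t \<bullet> (A t *\<^sub>v \<xi> t))"
    unfolding scalar_prod_def sum_distrib_left using A[OF t] by (intro sum.cong) auto
  ultimately have d: "((\<lambda>\<tau>. \<Sum>i<n. (\<xi> \<tau> $ i)\<^sup>2) has_real_derivative 2 * (\<xi> t \<bullet> (A t *\<^sub>v \<xi> t))) (at t within {s..})"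
    by simp
  show ?thesis
    by (rule has_field_derivative_transform_within[where d = 1, OF d]) (use t scalar_prod_self_sum[OF c] in auto)
qed

text \<open>If the energy decreases at a rate of at most \<open>2 a\<close>, then multiplication with \<open>exp (2 a (t - s))\<close> makes it
  nondecreasing.\<close>

lemma energy_nondecreasing_weighted:
  assumes \<xi>: "lin_solution n A s \<xi>" and A: "\<And>t. t \<ge> s \<Longrightarrow> A t \<in> carrier_mat n n"
    and a: "\<And>t x. t \<ge> s \<Longrightarrow> x \<in> carrier_vec n \<Longrightarrow> - a * (x \<bullet> x) \<le> x \<bullet> (A t *\<^sub>v x)"
    and t: "t \<ge> s"
  shows "exp (- (2 * a * (t - s))) * (\<xi> s \<bullet> \<xi> s) \<le> \<xi> t \<bullet> \<xi> t"
proof -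
  define g where "g = (\<lambda>\<tau>. exp (2 * a * (\<tau> - s)) * (\<xi> \<tau> \<bullet> \<xi> \<tau>))"
  have d: "(g has_real_derivative exp (2 * a * (\<tau> - s)) * (2 * (a * (\<xi> \<tau> \<bullet> \<xi> \<tau>) + \<xi> \<tau> \<bullet> (A \<tau> *\<^sub>v \<xi> \<tau>)))) (at \<tau> within {s..})"
    if "\<tau> \<ge> s" for \<tau>
    unfolding g_def using lin_solution_energy_deriv[OF \<xi> A that]
    by (auto intro!: derivative_eq_intros simp: algebra_simps)
  have "g s \<le> g t"
  proof (rule DERIV_nonneg_imp_increasing_open[OF t])
    show "continuous_on {s..t} g"
      by (rule continuous_on_subset[of "{s..}"])
        (use d in \<open>auto simp: continuous_on_eq_continuous_within intro!: DERIV_continuous\<close>)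
    fix \<tau> assume \<tau>: "s < \<tau>" "\<tau> < t"
    have "at \<tau> within {s..} = at \<tau>" using \<tau> by (intro at_within_interior) auto
    moreover have "0 \<le> a * (\<xi> \<tau> \<bullet> \<xi> \<tau>) + \<xi> \<tau> \<bullet> (A \<tau> *\<^sub>v \<xi> \<tau>)"
      using a[of \<tau> "\<xi> \<tau>"] \<tau> lin_solution_carrier[OF \<xi>, of \<tau>] by simp
    ultimately show "\<exists>y. DERIV g \<tau> :> y \<and> 0 \<le> y" using d[of \<tau>] \<tau>
      by (intro exI[of _ "exp (2 * a * (\<tau> - s)) * (2 * (a * (\<xi> \<tau> \<bullet> \<xi> \<tau>) + \<xi> \<tau> \<bullet> (A \<tau> *\<^sub>v \<xi> \<tau>)))"]) auto
  qed
  then have "\<xi> s \<bullet> \<xi> s \<le> exp (2 * a * (t - s)) * (\<xi> t \<bullet> \<xi> t)" by (simp add: g_def)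
  then have "exp (- (2 * a * (t - s))) * (\<xi> s \<bullet> \<xi> s) \<le> exp (- (2 * a * (t - s))) * (exp (2 * a * (t - s)) * (\<xi> t \<bullet> \<xi> t))"
    by (rule mult_left_mono) simp
  also have "\<dots> = \<xi> t \<bullet> \<xi> t" by (simp add: mult.assoc[symmetric] exp_add[symmetric])
  finally show ?thesis .
qed

text \<open>Solutions of linear systems can be scaled, so both halves of uniform asymptotic stability hold relative to the size of
  the initial value. Attractivity then halves the norm over every time span of some length \<open>T\<close>, and iteration gives an
  exponential rate.\<close>

lemma unif_asymp_stable_imp_exponential:
  assumes uas: "unif_asymp_stable s0 n A" and A: "\<And>t. t \<ge> s0 \<Longrightarrow> A t \<in> carrier_mat n n"
  obtains k \<kappa> :: real where "k > 0" "\<kappa> > 0"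
    "\<And>s \<xi> t. s \<ge> s0 \<Longrightarrow> lin_solution n A s \<xi> \<Longrightarrow> t \<ge> s \<Longrightarrow> vnorm (\<xi> t) \<le> k * exp (- \<kappa> * (t - s)) * vnorm (\<xi> s)"
proof -
  have scale: "vnorm (\<xi> t) \<le> e / \<delta> * vnorm (\<xi> s)"
    if bnd: "\<And>\<xi>. lin_solution n A s \<xi> \<Longrightarrow> vnorm (\<xi> s) < \<delta> \<Longrightarrow> vnorm (\<xi> t) < e"
      and pos: "\<delta> > 0" "e > 0" and s: "s \<ge> s0" and \<xi>: "lin_solution n A s \<xi>" for \<xi> s t and e \<delta> :: real
  proof (rule dense_ge)
    fix r assume r: "e / \<delta> * vnorm (\<xi> s) < r"
    then have "r > 0" using pos vnorm_nonneg[of "\<xi> s"]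
      by (intro order.strict_trans1[OF _ r]) simp
    \<comment> \<open>This multiple of the solution starts within distance \<open>\<delta>\<close> of the origin.\<close>
    let ?c = "e / r"
    have "?c > 0" using \<open>r > 0\<close> pos by simp
    have "lin_solution n A s (\<lambda>t. ?c \<cdot>\<^sub>v \<xi> t)" using \<xi> A s by (intro lin_solution_smult) auto
    moreover have "vnorm (?c \<cdot>\<^sub>v \<xi> s) < \<delta>" using r \<open>?c > 0\<close> \<open>r > 0\<close> pos by (simp add: vnorm_smult field_simps)
    ultimately have "vnorm (?c \<cdot>\<^sub>v \<xi> t) < e" by (rule bnd)
    then show "vnorm (\<xi> t) \<le> r" using \<open>?c > 0\<close> \<open>r > 0\<close> pos by (simp add: vnorm_smult field_simps)
  qed
  note stable_attractive = uas[unfolded unif_asymp_stable_def]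
  from stable_attractive[THEN conjunct1, rule_format, of 1]
  obtain \<delta>1 where \<delta>1: "\<delta>1 > 0" "\<And>s \<xi> t. s \<ge> s0 \<Longrightarrow> lin_solution n A s \<xi> \<Longrightarrow> vnorm (\<xi> s) < \<delta>1 \<Longrightarrow> t \<ge> s \<Longrightarrow> vnorm (\<xi> t) < 1"
    by auto
  define K where "K = 1 / \<delta>1"
  have K: "K > 0" using \<delta>1 by (simp add: K_def)
  have stab: "vnorm (\<xi> t) \<le> K * vnorm (\<xi> s)" if "s \<ge> s0" "lin_solution n A s \<xi>" "t \<ge> s" for \<xi> s t
    unfolding K_def using \<delta>1 that by (intro scale) auto
  from stable_attractive[THEN conjunct2] obtain \<delta>2 where \<delta>2: "\<delta>2 > 0"
    and att: "\<forall>\<epsilon>>0. \<exists>T>0. \<forall>s\<ge>s0. \<forall>\<xi>. lin_solution n A s \<xi> \<and> vnorm (\<xi> s) < \<delta>2 \<longrightarrow> (\<forall>t\<ge>s + T. vnorm (\<xi> t) < \<epsilon>)"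
    by (elim exE conjE)
  from att[rule_format, of "\<delta>2 / 2"] \<delta>2 obtain T where T: "T > 0"
    and half: "\<And>s \<xi> t. s \<ge> s0 \<Longrightarrow> lin_solution n A s \<xi> \<Longrightarrow> vnorm (\<xi> s) < \<delta>2 \<Longrightarrow> t \<ge> s + T \<Longrightarrow> vnorm (\<xi> t) < \<delta>2 / 2"
    by auto
  have half: "vnorm (\<xi> t) \<le> 1 / 2 * vnorm (\<xi> s)" if "s \<ge> s0" "lin_solution n A s \<xi>" "t \<ge> s + T" for \<xi> s t
    using scale[of s \<delta>2 t "\<delta>2 / 2" \<xi>] half \<delta>2 that by auto
  have iter: "vnorm (\<xi> t) \<le> K * (1 / 2) ^ m * vnorm (\<xi> s)"
    if "s \<ge> s0" "lin_solution n A s \<xi>" "t \<ge> s + real m * T" for \<xi> s t m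
    using that
  proof (induction m arbitrary: s)
    case 0
    then show ?case using stab by simp
  next
    case (Suc m)
    have "lin_solution n A (s + T) \<xi>" by (rule lin_solution_restrict[OF Suc.prems(2)]) (use T in simp)
    then have "vnorm (\<xi> t) \<le> K * (1 / 2) ^ m * vnorm (\<xi> (s + T))"
      using Suc.prems T by (intro Suc.IH) (auto simp: algebra_simps)
    also have "\<dots> \<le> K * (1 / 2) ^ m * (1 / 2 * vnorm (\<xi> s))"
      using half[of s \<xi> "s + T"] Suc.prems K by (intro mult_left_mono) auto
    finally show ?case by simp
  qed
  \<comment> \<open>Halving over each span \<open>T\<close>; the factor 2 in the constant accounts for the incomplete last span.\<close>
  define \<kappa> where "\<kappa> = ln 2 / T"
  show thesis
  proof (rule that[of "2 * K" \<kappa>])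
    show "2 * K > 0" "\<kappa> > 0" using K T by (auto simp: \<kappa>_def)
    fix s \<xi> t assume s: "s \<ge> s0" "lin_solution n A s \<xi>" and t: "t \<ge> (s::real)"
    define m where "m = nat \<lfloor>(t - s) / T\<rfloor>"
    have m: "real m \<le> (t - s) / T" "(t - s) / T < real m + 1"
      using t T unfolding m_def by (auto simp: le_floor_iff)
    have "real m * T \<le> t - s" using m(1) T by (simp add: field_simps)
    then have "vnorm (\<xi> t) \<le> K * (1 / 2) ^ m * vnorm (\<xi> s)" using s by (intro iter) auto
    moreover have "(1 / 2 :: real) ^ m \<le> 2 * exp (- \<kappa> * (t - s))"
    proof -
      have "(1 / 2 :: real) ^ m = exp (- ln 2 * real m)"
        by (simp only: exp_of_nat2_mult) (simp add: exp_minus)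
      also have "\<dots> \<le> exp (ln 2 - \<kappa> * (t - s))"
      proof -
        have "ln 2 * ((t - s) / T) \<le> ln 2 * (real m + 1)" using m(2) by (intro mult_left_mono) auto
        then show ?thesis by (simp add: \<kappa>_def algebra_simps)
      qed
      also have "\<dots> = 2 * exp (- \<kappa> * (t - s))" by (simp add: exp_diff exp_minus divide_inverse)
      finally show ?thesis .
    qed
    then have "K * (1 / 2) ^ m * vnorm (\<xi> s) \<le> K * (2 * exp (- \<kappa> * (t - s))) * vnorm (\<xi> s)"
      using K by (intro mult_right_mono mult_left_mono vnorm_nonneg) auto
    ultimately show "vnorm (\<xi> t) \<le> 2 * K * exp (- \<kappa> * (t - s)) * vnorm (\<xi> s)" by simp
  qed
qed

text \<open>Gives the convergence of the integrals that define the Gramian as well as their upper bound.\<close>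

lemma integral_exp_dominated:
  fixes f :: "real \<Rightarrow> real"
  assumes f: "continuous_on {t..} f" and C: "\<And>s. s \<ge> t \<Longrightarrow> \<bar>f s\<bar> \<le> C * exp (- \<mu> * (s - t))" and \<mu>: "\<mu> > 0"
  shows "\<exists>L. ((\<lambda>T. integral {t..T} f) \<longlongrightarrow> L) at_top \<and> \<bar>L\<bar> \<le> C / \<mu>"
proof -
  let ?g = "\<lambda>s. C * exp (\<mu> * t) * exp (- \<mu> * s)"
  have g: "(?g has_integral C / \<mu>) {t..}"
  proof -
    have "C * exp (\<mu> * t) * (exp (- \<mu> * t) / \<mu>) = C / \<mu>" by (simp add: exp_minus)
    then show ?thesis
      using has_integral_mult_right[OF has_integral_exp_minus_to_infinity[OF \<mu>, of t], of "C * exp (\<mu> * t)"]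
      by (simp only:)
  qed
  have bd: "norm (f s) \<le> ?g s" if "s \<in> {t..}" for s
    using C[of s] that by (simp add: right_diff_distrib exp_diff exp_minus divide_inverse mult.assoc)
  have "f absolutely_integrable_on {t..}"
  proof (rule measurable_bounded_by_integrable_imp_absolutely_integrable)
    show "f \<in> borel_measurable (lebesgue_on {t..})"
      by (rule continuous_imp_measurable_on_sets_lebesgue[OF f]) auto
    show "?g integrable_on {t..}" using g by blast
  qed (use bd in auto)
  then have ai: "set_integrable lebesgue {t..} f" .
  have lim: "((\<lambda>T. set_lebesgue_integral lebesgue {t..T} f) \<longlongrightarrow> set_lebesgue_integral lebesgue {t..} f) at_top"
    by (rule tendsto_set_lebesgue_integral_at_top[OF _ ai]) auto
  have eq: "set_lebesgue_integral lebesgue {t..T} f = integral {t..T} f" for T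
    by (intro set_lebesgue_integral_eq_integral set_integrable_subset[OF ai]) auto
  have eq': "set_lebesgue_integral lebesgue {t..} f = integral {t..} f"
    by (intro set_lebesgue_integral_eq_integral ai)
  have "norm (integral {t..} f) \<le> integral {t..} ?g"
    using ai g bd by (intro integral_norm_bound_integral) (auto simp: set_lebesgue_integral_eq_integral)
  then have "\<bar>integral {t..} f\<bar> \<le> C / \<mu>" unfolding integral_unique[OF g] by simp
  with lim show ?thesis unfolding eq eq' by blast
qed

section \<open>The Gramian of a stable system\<close>

lemma mult_mat_vec_index_sum:
  fixes A :: "real mat"
  assumes "A \<in> carrier_mat nr n" "c \<in> carrier_vec n" "i < nr"
  shows "(A *\<^sub>v c) $ i = (\<Sum>j<n. A $$ (i, j) * c $ j)"
  using assms by (auto simp: scalar_prod_def atLeast0LessThan intro!: sum.cong)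

lemma mult_mat_unit_vec:
  fixes A :: "real mat"
  assumes "A \<in> carrier_mat nr n" "j < n"
  shows "A *\<^sub>v unit_vec n j = col A j"
  using assms by (intro eq_vecI) auto

lemma transition_solution:
  assumes \<Phi>: "state_transition s0 n A \<Phi>" and A: "\<And>t. t \<ge> s0 \<Longrightarrow> A t \<in> carrier_mat n n"
    and t: "t \<ge> s0" and c: "c \<in> carrier_vec n"
  shows "lin_solution n A t (\<lambda>s. \<Phi> s t *\<^sub>v c)"
proof -
  have \<Phi>c: "\<Phi> s t \<in> carrier_mat n n" if "s \<ge> t" for s using \<Phi> t that by (simp add: state_transition_def)
  show ?thesis unfolding lin_solution_def
  proof (intro allI impI conjI)
  fix s i assume s: "s \<ge> t" and i: "i < n"
  have "((\<lambda>\<sigma>. \<Sum>j<n. \<Phi> \<sigma> t $$ (i, j) * c $ j) has_real_derivative (\<Sum>j<n. (A s * \<Phi> s t) $$ (i, j) * c $ j)) (at s within {t..})"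
    using \<Phi> t s i
    by (intro DERIV_sum DERIV_cmult_right DERIV_subset[where s = "{s0..}" and t = "{t..}"]) (auto simp: state_transition_def)
  moreover have "(\<Sum>j<n. (A s * \<Phi> s t) $$ (i, j) * c $ j) = (A s *\<^sub>v (\<Phi> s t *\<^sub>v c)) $ i"
  proof -
    have "A s *\<^sub>v (\<Phi> s t *\<^sub>v c) = (A s * \<Phi> s t) *\<^sub>v c"
      using A[of s] \<Phi>c[OF s] c s t by (subst assoc_mult_mat_vec) auto
    moreover have "A s * \<Phi> s t \<in> carrier_mat n n" using A[of s] \<Phi>c[OF s] s t by auto
    ultimately show ?thesis using i c by (simp add: mult_mat_vec_index_sum[of _ n n] del: index_mult_mat_vec)
  qed
  ultimately have d: "((\<lambda>\<sigma>. \<Sum>j<n. \<Phi> \<sigma> t $$ (i, j) * c $ j) has_real_derivative (A s *\<^sub>v (\<Phi> s t *\<^sub>v c)) $ i) (at s within {t..})"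
    by simp
  show "((\<lambda>\<sigma>. (\<Phi> \<sigma> t *\<^sub>v c) $ i) has_real_derivative (A s *\<^sub>v (\<Phi> s t *\<^sub>v c)) $ i) (at s within {t..})"
  proof (rule has_field_derivative_transform_within[where d = 1, OF d])
    fix \<sigma> assume "\<sigma> \<in> {t..}"
    then have "\<Phi> \<sigma> t \<in> carrier_mat n n" using \<Phi>c by auto
    then show "(\<Sum>j<n. \<Phi> \<sigma> t $$ (i, j) * c $ j) = (\<Phi> \<sigma> t *\<^sub>v c) $ i"
      using i c by (simp add: mult_mat_vec_index_sum[of _ n n] del: index_mult_mat_vec)
  qed (use s in auto)
  qed (rule mult_mat_vec_carrier[OF \<Phi>c c])
qed

lemma lin_solution_energy_continuous:
  assumes "lin_solution n A s \<xi>" "\<And>t. t \<ge> s \<Longrightarrow> A t \<in> carrier_mat n n"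
  shows "continuous_on {s..} (\<lambda>t. \<xi> t \<bullet> \<xi> t)"
  unfolding continuous_on_eq_continuous_within
  using lin_solution_energy_deriv[OF assms] by (auto intro!: DERIV_continuous)

text \<open>The constants of the exponential decay are parameters, because they occur in the bounds on the Gramian.\<close>

locale exp_stable_system =
  fixes s0 :: real and n :: nat and A :: "real \<Rightarrow> real mat" and k \<kappa> :: real
  assumes A_carrier: "\<And>t. t \<ge> s0 \<Longrightarrow> A t \<in> carrier_mat n n"
    and \<kappa>_pos: "\<kappa> > 0"
    and decay: "\<And>s \<xi> t. s \<ge> s0 \<Longrightarrow> lin_solution n A s \<xi> \<Longrightarrow> t \<ge> s \<Longrightarrow>
      vnorm (\<xi> t) \<le> k * exp (- \<kappa> * (t - s)) * vnorm (\<xi> s)"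
begin

lemma energy_decay:
  assumes "s \<ge> s0" "lin_solution n A s \<xi>" "t \<ge> s"
  shows "\<xi> t \<bullet> \<xi> t \<le> k\<^sup>2 * (\<xi> s \<bullet> \<xi> s) * exp (- (2 * \<kappa>) * (t - s))"
proof -
  have "(vnorm (\<xi> t))\<^sup>2 \<le> (k * exp (- \<kappa> * (t - s)) * vnorm (\<xi> s))\<^sup>2"
    by (intro power_mono decay assms vnorm_nonneg)
  also have "\<dots> = k\<^sup>2 * (\<xi> s \<bullet> \<xi> s) * (exp (- \<kappa> * (t - s)))\<^sup>2"
    by (simp add: power_mult_distrib vnorm_power2)
  also have "(exp (- \<kappa> * (t - s)))\<^sup>2 = exp (- (2 * \<kappa>) * (t - s))"
    by (simp add: exp_double[symmetric] algebra_simps)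
  finally show ?thesis by (simp add: vnorm_power2)
qed

text \<open>The difference of two solutions with the same initial value decays from zero.\<close>

lemma solution_unique:
  assumes s: "s \<ge> s0" and \<xi>: "lin_solution n A s \<xi>" and \<eta>: "lin_solution n A s \<eta>"
    and eq: "\<xi> s = \<eta> s" and t: "t \<ge> s"
  shows "\<xi> t = \<eta> t"
proof -
  have c: "\<xi> t \<in> carrier_vec n" "\<eta> t \<in> carrier_vec n" "\<eta> s \<in> carrier_vec n"
    using lin_solution_carrier \<xi> \<eta> t by auto
  have "lin_solution n A s (\<lambda>t. \<xi> t - \<eta> t)"
    by (rule lin_solution_diff[OF \<xi> \<eta>]) (use A_carrier s in auto)
  from energy_decay[OF s this t]
  have "(\<xi> t - \<eta> t) \<bullet> (\<xi> t - \<eta> t) \<le> 0" using c by (simp add: eq)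
  with scalar_prod_self_pos[of "\<xi> t - \<eta> t" n] c have z: "\<xi> t - \<eta> t = 0\<^sub>v n" by fastforce
  show ?thesis
  proof (rule eq_vecI)
    fix i assume i: "i < dim_vec (\<eta> t)"
    then have "(\<xi> t - \<eta> t) $ i = 0" using c z by simp
    then show "\<xi> t $ i = \<eta> t $ i" using i c by simp
  qed (use c in auto)
qed

end

locale exp_stable_transition = exp_stable_system +
  fixes \<Phi> :: "real \<Rightarrow> real \<Rightarrow> real mat"
  assumes transition: "state_transition s0 n A \<Phi>"
begin

lemma \<Phi>_carrier: "s \<ge> s0 \<Longrightarrow> t \<ge> s0 \<Longrightarrow> \<Phi> s t \<in> carrier_mat n n"
  using transition by (simp add: state_transition_def)

lemma \<Phi>_solution:
  "t \<ge> s0 \<Longrightarrow> c \<in> carrier_vec n \<Longrightarrow> lin_solution n A t (\<lambda>s. \<Phi> s t *\<^sub>v c)"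
  using transition_solution[OF transition A_carrier] .

lemma \<Phi>_start: "t \<ge> s0 \<Longrightarrow> c \<in> carrier_vec n \<Longrightarrow> \<Phi> t t *\<^sub>v c = c"
  using transition by (simp add: state_transition_def)

lemma \<Phi>_energy_decay:
  assumes "t \<ge> s0" "c \<in> carrier_vec n" "s \<ge> t"
  shows "(\<Phi> s t *\<^sub>v c) \<bullet> (\<Phi> s t *\<^sub>v c) \<le> k\<^sup>2 * (c \<bullet> c) * exp (- (2 * \<kappa>) * (s - t))"
  using energy_decay[OF assms(1) \<Phi>_solution[OF assms(1,2)] assms(3)] assms \<Phi>_start by simp

lemma \<Phi>_gram_entry:
  assumes "s \<ge> s0" "t \<ge> s0" "i < n" "j < n"
  shows "(transpose_mat (\<Phi> s t) * \<Phi> s t) $$ (i, j) = (\<Phi> s t *\<^sub>v unit_vec n i) \<bullet> (\<Phi> s t *\<^sub>v unit_vec n j)"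
  using \<Phi>_carrier[OF assms(1,2)] assms(3,4) by (simp add: mult_mat_unit_vec[of _ n n])

lemma \<Phi>_gram_entry_continuous:
  assumes "t \<ge> s0" "i < n" "j < n"
  shows "continuous_on {t..} (\<lambda>s. (transpose_mat (\<Phi> s t) * \<Phi> s t) $$ (i, j))"
proof -
  have "continuous_on {t..} (\<lambda>s. \<Sum>l<n. \<Phi> s t $$ (l, i) * \<Phi> s t $$ (l, j))"
  proof (intro continuous_intros)
    have "continuous_on {t..} (\<lambda>s. \<Phi> s t $$ (a, b))" if "a < n" "b < n" for a b
      unfolding continuous_on_eq_continuous_within
    proof
      fix s assume "s \<in> {t..}"
      then have "((\<lambda>s. \<Phi> s t $$ (a, b)) has_real_derivative (A s * \<Phi> s t) $$ (a, b)) (at s within {t..})"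
        using transition assms(1) that
        by (intro DERIV_subset[where s = "{s0..}" and t = "{t..}"]) (auto simp: state_transition_def)
      then show "continuous (at s within {t..}) (\<lambda>s. \<Phi> s t $$ (a, b))" by (rule DERIV_continuous)
    qed
    then show "continuous_on {t..} (\<lambda>s. \<Phi> s t $$ (l, i))" "continuous_on {t..} (\<lambda>s. \<Phi> s t $$ (l, j))"
      if "l \<in> {..<n}" for l using that assms by auto
  qed
  then show ?thesis
  proof (rule continuous_on_eq)
    fix s assume "s \<in> {t..}"
    then have "\<Phi> s t \<in> carrier_mat n n" using \<Phi>_carrier assms by simp
    then show "(\<Sum>l<n. \<Phi> s t $$ (l, i) * \<Phi> s t $$ (l, j)) = (transpose_mat (\<Phi> s t) * \<Phi> s t) $$ (i, j)"
      using assms by (auto simp: scalar_prod_def atLeast0LessThan)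
  qed
qed

text \<open>An entry of \<open>\<Phi>\<^sup>T \<Phi>\<close> is an inner product of two solutions, hence at most the mean of their exponentially decaying
  energies.\<close>

lemma gram_to_tendsto_gram:
  assumes t: "t \<ge> s0" and ij: "i < n" "j < n"
  shows "((\<lambda>T. gram_to n \<Phi> t T $$ (i, j)) \<longlongrightarrow> gram n \<Phi> t $$ (i, j)) at_top"
proof -
  have bound: "\<bar>(transpose_mat (\<Phi> s t) * \<Phi> s t) $$ (i, j)\<bar> \<le> k\<^sup>2 * exp (- (2 * \<kappa>) * (s - t))" if s: "s \<ge> t" for s
  proof -
    let ?u = "\<Phi> s t *\<^sub>v unit_vec n i" and ?v = "\<Phi> s t *\<^sub>v unit_vec n j"
    have c: "?u \<in> carrier_vec n" "?v \<in> carrier_vec n"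
      using \<Phi>_carrier[of s t] s t by auto
    have "?u \<bullet> ?u \<le> k\<^sup>2 * exp (- (2 * \<kappa>) * (s - t))" "?v \<bullet> ?v \<le> k\<^sup>2 * exp (- (2 * \<kappa>) * (s - t))"
      using \<Phi>_energy_decay[OF t, of "unit_vec n i" s] \<Phi>_energy_decay[OF t, of "unit_vec n j" s] s ij by auto
    moreover have "2 * \<bar>?u \<bullet> ?v\<bar> \<le> ?u \<bullet> ?u + ?v \<bullet> ?v"
    proof -
      have "0 \<le> (?u + r \<cdot>\<^sub>v ?v) \<bullet> (1\<^sub>m n *\<^sub>v (?u + r \<cdot>\<^sub>v ?v))" for r
        using c by (simp add: scalar_prod_self_nonneg)
      \<comment> \<open>Both \<open>|u + v|\<^sup>2\<close> and \<open>|u - v|\<^sup>2\<close> are nonnegative.\<close>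
      from this[of 1] this[of "-1"] form_add_smult[of "1\<^sub>m n" n ?u ?v 1] form_add_smult[of "1\<^sub>m n" n ?u ?v "-1"]
      show ?thesis using c by (simp add: abs_if)
    qed
    ultimately show ?thesis using s t ij by (simp add: \<Phi>_gram_entry)
  qed
  have "\<exists>L. ((\<lambda>T. integral {t..T} (\<lambda>s. (transpose_mat (\<Phi> s t) * \<Phi> s t) $$ (i, j))) \<longlongrightarrow> L) at_top"
    using integral_exp_dominated[OF \<Phi>_gram_entry_continuous[OF assms] bound] \<kappa>_pos by auto
  then obtain L where L: "((\<lambda>T. gram_to n \<Phi> t T $$ (i, j)) \<longlongrightarrow> L) at_top"
    using ij by (auto simp: gram_to_def)
  have "gram n \<Phi> t $$ (i, j) = Lim at_top (\<lambda>T. gram_to n \<Phi> t T $$ (i, j))"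
    using ij by (simp add: gram_def)
  also have "\<dots> = L" using L by (intro tendsto_Lim) auto
  finally show ?thesis using L by simp
qed

lemma gram_carrier: "gram n \<Phi> t \<in> carrier_mat n n"
  by (simp add: gram_def)

lemma gram_symmetric:
  assumes t: "t \<ge> s0"
  shows "transpose_mat (gram n \<Phi> t) = gram n \<Phi> t"
proof (rule eq_matI)
  fix i j assume "i < dim_row (gram n \<Phi> t)" "j < dim_col (gram n \<Phi> t)"
  then have ij: "i < n" "j < n" by (auto simp: gram_def)
  have "gram_to n \<Phi> t T $$ (j, i) = gram_to n \<Phi> t T $$ (i, j)" for T
  proof -
    have "(transpose_mat (\<Phi> s t) * \<Phi> s t) $$ (j, i) = (transpose_mat (\<Phi> s t) * \<Phi> s t) $$ (i, j)" if "s \<in> {t..T}" for s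
    proof -
      have "\<Phi> s t \<in> carrier_mat n n" using \<Phi>_carrier that t by simp
      then show ?thesis using that t ij by (subst (1 2) \<Phi>_gram_entry) (auto intro: comm_scalar_prod[of _ n])
    qed
    then show ?thesis using ij by (auto simp: gram_to_def intro: integral_cong)
  qed
  then have "gram n \<Phi> t $$ (j, i) = gram n \<Phi> t $$ (i, j)" using ij by (simp add: gram_def)
  then show "transpose_mat (gram n \<Phi> t) $$ (i, j) = gram n \<Phi> t $$ (i, j)" using ij by (simp add: gram_def)
qed (auto simp: gram_def)

text \<open>The quadratic form is a finite combination of entries, and for the truncated Gramian it is the integral of the
  energy of the solution that starts from \<open>x\<close>.\<close>

lemma gram_form:
  assumes t: "t \<ge> s0" and x: "x \<in> carrier_vec n"
  shows "((\<lambda>T. integral {t..T} (\<lambda>s. (\<Phi> s t *\<^sub>v x) \<bullet> (\<Phi> s t *\<^sub>v x))) \<longlongrightarrow> x \<bullet> (gram n \<Phi> t *\<^sub>v x)) at_top"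
proof -
  have form: "x \<bullet> (G *\<^sub>v x) = (\<Sum>i<n. \<Sum>j<n. x $ i * x $ j * G $$ (i, j))" if "G \<in> carrier_mat n n" for G :: "real mat"
    using that x by (auto simp: scalar_prod_def sum_distrib_left mult_ac atLeast0LessThan intro!: sum.cong)
  have "((\<lambda>T. \<Sum>i<n. \<Sum>j<n. x $ i * x $ j * gram_to n \<Phi> t T $$ (i, j)) \<longlongrightarrow> x \<bullet> (gram n \<Phi> t *\<^sub>v x)) at_top"
    unfolding form[OF gram_carrier] by (intro tendsto_intros gram_to_tendsto_gram t) auto
  moreover have "(\<Sum>i<n. \<Sum>j<n. x $ i * x $ j * gram_to n \<Phi> t T $$ (i, j)) = integral {t..T} (\<lambda>s. (\<Phi> s t *\<^sub>v x) \<bullet> (\<Phi> s t *\<^sub>v x))" for T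
  proof -
    have int: "(\<lambda>s. (transpose_mat (\<Phi> s t) * \<Phi> s t) $$ (i, j)) integrable_on {t..T}" if "i < n" "j < n" for i j
      by (intro integrable_continuous_real continuous_on_subset[OF \<Phi>_gram_entry_continuous[OF t that]]) auto
    have "(\<Sum>i<n. \<Sum>j<n. x $ i * x $ j * gram_to n \<Phi> t T $$ (i, j)) =
        (\<Sum>i<n. \<Sum>j<n. integral {t..T} (\<lambda>s. x $ i * x $ j * (transpose_mat (\<Phi> s t) * \<Phi> s t) $$ (i, j)))"
      by (intro sum.cong refl) (simp add: gram_to_def del: index_mult_mat)
    also have "\<dots> = integral {t..T} (\<lambda>s. \<Sum>i<n. \<Sum>j<n. x $ i * x $ j * (transpose_mat (\<Phi> s t) * \<Phi> s t) $$ (i, j))"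
    proof -
      have int': "(\<lambda>s. x $ i * x $ j * (transpose_mat (\<Phi> s t) * \<Phi> s t) $$ (i, j)) integrable_on {t..T}"
        if "i < n" "j < n" for i j
        using integrable_on_cmult_left[OF int[OF that], of "x $ i * x $ j"] by (simp only: of_real_eq_id id_apply)
      have "(\<Sum>i<n. \<Sum>j<n. integral {t..T} (\<lambda>s. x $ i * x $ j * (transpose_mat (\<Phi> s t) * \<Phi> s t) $$ (i, j))) =
          (\<Sum>i<n. integral {t..T} (\<lambda>s. \<Sum>j<n. x $ i * x $ j * (transpose_mat (\<Phi> s t) * \<Phi> s t) $$ (i, j)))"
        by (intro sum.cong refl integral_sum[symmetric] int') auto
      also have "\<dots> = integral {t..T} (\<lambda>s. \<Sum>i<n. \<Sum>j<n. x $ i * x $ j * (transpose_mat (\<Phi> s t) * \<Phi> s t) $$ (i, j))"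
        by (intro integral_sum[symmetric] integrable_sum int') auto
      finally show ?thesis .
    qed
    also have "\<dots> = integral {t..T} (\<lambda>s. (\<Phi> s t *\<^sub>v x) \<bullet> (\<Phi> s t *\<^sub>v x))"
    proof (rule integral_cong)
      fix s assume "s \<in> {t..T}"
      then have c: "\<Phi> s t \<in> carrier_mat n n" using \<Phi>_carrier t by simp
      have "x \<bullet> ((transpose_mat (\<Phi> s t) * \<Phi> s t) *\<^sub>v x) = (\<Phi> s t *\<^sub>v x) \<bullet> (\<Phi> s t *\<^sub>v x)"
      proof -
        have "(transpose_mat (\<Phi> s t) * \<Phi> s t) *\<^sub>v x = transpose_mat (\<Phi> s t) *\<^sub>v (\<Phi> s t *\<^sub>v x)"
          using c x by (subst assoc_mult_mat_vec) auto
        then show ?thesis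
          using c x transpose_vec_mult_scalar[OF c x, of "\<Phi> s t *\<^sub>v x"]
          by (metis comm_scalar_prod mult_mat_vec_carrier transpose_carrier_mat)
      qed
      then show "(\<Sum>i<n. \<Sum>j<n. x $ i * x $ j * (transpose_mat (\<Phi> s t) * \<Phi> s t) $$ (i, j)) = (\<Phi> s t *\<^sub>v x) \<bullet> (\<Phi> s t *\<^sub>v x)"
        using form[of "transpose_mat (\<Phi> s t) * \<Phi> s t"] c by simp
    qed
    finally show ?thesis .
  qed
  ultimately show ?thesis by simp
qed

lemma gram_upper:
  assumes t: "t \<ge> s0" and x: "x \<in> carrier_vec n"
  shows "x \<bullet> (gram n \<Phi> t *\<^sub>v x) \<le> k\<^sup>2 / (2 * \<kappa>) * (x \<bullet> x)"
proof -
  have "continuous_on {t..} (\<lambda>s. (\<Phi> s t *\<^sub>v x) \<bullet> (\<Phi> s t *\<^sub>v x))"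
    by (rule lin_solution_energy_continuous[OF \<Phi>_solution[OF assms]]) (use A_carrier t in auto)
  moreover have "\<bar>(\<Phi> s t *\<^sub>v x) \<bullet> (\<Phi> s t *\<^sub>v x)\<bar> \<le> k\<^sup>2 * (x \<bullet> x) * exp (- (2 * \<kappa>) * (s - t))" if "s \<ge> t" for s
    using \<Phi>_energy_decay[OF t x that] by (simp add: scalar_prod_self_nonneg)
  ultimately obtain L where L: "((\<lambda>T. integral {t..T} (\<lambda>s. (\<Phi> s t *\<^sub>v x) \<bullet> (\<Phi> s t *\<^sub>v x))) \<longlongrightarrow> L) at_top"
      "\<bar>L\<bar> \<le> k\<^sup>2 * (x \<bullet> x) / (2 * \<kappa>)"
    using integral_exp_dominated[of t _ "k\<^sup>2 * (x \<bullet> x)" "2 * \<kappa>"] \<kappa>_pos by fastforce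
  have "x \<bullet> (gram n \<Phi> t *\<^sub>v x) = L"
    by (rule tendsto_unique[OF _ gram_form[OF assms] L(1)]) simp
  with L(2) show ?thesis by (simp add: mult.commute)
qed

text \<open>A solution keeps at least the share \<open>exp (- 2 a)\<close> of its energy during one unit of time, and the integral over this
  unit already suffices.\<close>

lemma gram_lower:
  assumes a: "\<And>t x. t \<ge> s0 \<Longrightarrow> x \<in> carrier_vec n \<Longrightarrow> - a * (x \<bullet> x) \<le> x \<bullet> (A t *\<^sub>v x)" and a0: "a \<ge> 0"
    and t: "t \<ge> s0" and x: "x \<in> carrier_vec n"
  shows "exp (- (2 * a)) * (x \<bullet> x) \<le> x \<bullet> (gram n \<Phi> t *\<^sub>v x)"
proof (rule tendsto_lowerbound[OF gram_form[OF t x]])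
  let ?f = "\<lambda>s. (\<Phi> s t *\<^sub>v x) \<bullet> (\<Phi> s t *\<^sub>v x)"
  note sol = \<Phi>_solution[OF t x]
  have cont: "continuous_on {t..} ?f"
    by (rule lin_solution_energy_continuous[OF sol]) (use A_carrier t in auto)
  then have int: "?f integrable_on {t..T}" for T
    by (intro integrable_continuous_real continuous_on_subset[OF cont]) auto
  have "exp (- (2 * a)) * (x \<bullet> x) \<le> integral {t..T} ?f" if T: "T \<ge> t + 1" for T
  proof -
    have "exp (- (2 * a)) * (x \<bullet> x) = integral {t..t+1} (\<lambda>s. exp (- (2 * a)) * (x \<bullet> x))" by simp
    also have "\<dots> \<le> integral {t..t+1} ?f"
    proof (rule integral_le)
      fix s assume s: "s \<in> {t..t+1}"
      have "exp (- (2 * a)) * (x \<bullet> x) \<le> exp (- (2 * a * (s - t))) * (x \<bullet> x)"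
        using s a0 mult_left_mono[of "s - t" 1 "2 * a"] by (intro mult_right_mono scalar_prod_self_nonneg) auto
      also have "\<dots> \<le> ?f s"
        using energy_nondecreasing_weighted[OF sol, of a s] A_carrier a s t x \<Phi>_start by auto
      finally show "exp (- (2 * a)) * (x \<bullet> x) \<le> ?f s" .
    qed (use int in auto)
    also have "\<dots> \<le> integral {t..T} ?f"
      using T int by (intro integral_subset_le) (auto simp: scalar_prod_self_nonneg)
    finally show ?thesis .
  qed
  then show "\<forall>\<^sub>F T in at_top. exp (- (2 * a)) * (x \<bullet> x) \<le> integral {t..T} ?f"
    by (rule eventually_at_top_linorderI)
qed auto

end

section \<open>The Gramian as a Lyapunov function\<close>

context exp_stable_transition begin

text \<open>By uniqueness \<open>b(s) = \<Phi>(s, t) b(t)\<close>. Hence the left-hand side is the integral of \<open>|b|\<^sup>2\<close> over \<open>[t, \<infinity>)\<close>, of which the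
  right-hand side is the integral over \<open>[s0, \<infinity>)\<close> minus the one over \<open>[s0, t]\<close>.\<close>

lemma gram_along_solution:
  assumes b: "lin_solution n A s0 b" and t: "t \<ge> s0"
  shows "b t \<bullet> (gram n \<Phi> t *\<^sub>v b t) =
    b s0 \<bullet> (gram n \<Phi> s0 *\<^sub>v b s0) - integral {s0..t} (\<lambda>s. b s \<bullet> b s)"
proof -
  have bc: "b s \<in> carrier_vec n" if "s \<ge> s0" for s using lin_solution_carrier[OF b that] .
  have cont: "continuous_on {s0..} (\<lambda>s. b s \<bullet> b s)"
    by (rule lin_solution_energy_continuous[OF b A_carrier])
  have int: "(\<lambda>s. b s \<bullet> b s) integrable_on {a..c}" if "a \<ge> s0" for a c
    by (intro integrable_continuous_real continuous_on_subset[OF cont]) (use that in auto)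
  have flow: "\<Phi> s u *\<^sub>v b u = b s" if "s0 \<le> u" "u \<le> s" for s u
    using that bc by (intro solution_unique[of u "\<lambda>s. \<Phi> s u *\<^sub>v b u" b s] \<Phi>_solution lin_solution_restrict[OF b] \<Phi>_start) auto
  have lim: "((\<lambda>T. integral {u..T} (\<lambda>s. b s \<bullet> b s)) \<longlongrightarrow> b u \<bullet> (gram n \<Phi> u *\<^sub>v b u)) at_top"
    if u: "u \<ge> s0" for u
  proof -
    have "integral {u..T} (\<lambda>s. (\<Phi> s u *\<^sub>v b u) \<bullet> (\<Phi> s u *\<^sub>v b u)) = integral {u..T} (\<lambda>s. b s \<bullet> b s)" for T
      by (rule integral_cong) (simp add: flow u)
    with gram_form[OF u bc[OF u]] show ?thesis by simp
  qed
  have "((\<lambda>T. integral {s0..T} (\<lambda>s. b s \<bullet> b s) - integral {s0..t} (\<lambda>s. b s \<bullet> b s)) \<longlongrightarrow>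
      b s0 \<bullet> (gram n \<Phi> s0 *\<^sub>v b s0) - integral {s0..t} (\<lambda>s. b s \<bullet> b s)) at_top"
    by (intro tendsto_intros lim order_refl)
  moreover have "\<forall>\<^sub>F T in at_top. integral {s0..T} (\<lambda>s. b s \<bullet> b s) - integral {s0..t} (\<lambda>s. b s \<bullet> b s) = integral {t..T} (\<lambda>s. b s \<bullet> b s)"
  proof (rule eventually_at_top_linorderI)
    fix T assume "T \<ge> t"
    then show "integral {s0..T} (\<lambda>s. b s \<bullet> b s) - integral {s0..t} (\<lambda>s. b s \<bullet> b s) = integral {t..T} (\<lambda>s. b s \<bullet> b s)"
      using Henstock_Kurzweil_Integration.integral_combine[OF t _ int] by (simp add: algebra_simps)
  qed
  ultimately have "((\<lambda>T. integral {t..T} (\<lambda>s. b s \<bullet> b s)) \<longlongrightarrow>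
      b s0 \<bullet> (gram n \<Phi> s0 *\<^sub>v b s0) - integral {s0..t} (\<lambda>s. b s \<bullet> b s)) at_top"
    by (rule Lim_transform_eventually)
  then show ?thesis by (intro tendsto_unique[OF _ lim[OF t]]) simp
qed

text \<open>The left-hand side \<open>V\<close> has the derivative \<open>- |b|\<^sup>2 \<le> - V / \<Lambda>\<close>, so \<open>exp ((t - s0) / \<Lambda>) V(t)\<close> is nonincreasing.\<close>

lemma gram_lyapunov_decay:
  assumes b: "lin_solution n A s0 b" and t: "t \<ge> s0" and \<Lambda>: "\<Lambda> > 0"
    and up: "\<And>t. t \<ge> s0 \<Longrightarrow> b t \<bullet> (gram n \<Phi> t *\<^sub>v b t) \<le> \<Lambda> * (b t \<bullet> b t)"
  shows "b t \<bullet> (gram n \<Phi> t *\<^sub>v b t) \<le> b s0 \<bullet> (gram n \<Phi> s0 *\<^sub>v b s0) * exp (- (t - s0) / \<Lambda>)"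
proof -
  define V where "V = (\<lambda>t. b s0 \<bullet> (gram n \<Phi> s0 *\<^sub>v b s0) - integral {s0..t} (\<lambda>s. b s \<bullet> b s))"
  have V: "b u \<bullet> (gram n \<Phi> u *\<^sub>v b u) = V u" if "u \<ge> s0" for u
    unfolding V_def by (rule gram_along_solution[OF b that])
  have cont: "continuous_on {s0..t} (\<lambda>s. b s \<bullet> b s)"
    by (rule continuous_on_subset[OF lin_solution_energy_continuous[OF b A_carrier]]) auto
  define W where "W = (\<lambda>u. exp ((u - s0) / \<Lambda>) * V u)"
  have d: "(W has_real_derivative exp ((u - s0) / \<Lambda>) * (V u / \<Lambda> - b u \<bullet> b u)) (at u within {s0..t})"
    if u: "u \<in> {s0..t}" for u
  proof -
    have "((\<lambda>u. integral {s0..u} (\<lambda>s. b s \<bullet> b s)) has_real_derivative b u \<bullet> b u) (at u within {s0..t})"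
      by (rule integral_has_real_derivative[OF cont u])
    then have dV: "(V has_real_derivative - (b u \<bullet> b u)) (at u within {s0..t})"
      unfolding V_def by (auto intro!: derivative_eq_intros)
    have dE: "((\<lambda>u. exp ((u - s0) / \<Lambda>)) has_real_derivative exp ((u - s0) / \<Lambda>) / \<Lambda>) (at u within {s0..t})"
      using \<Lambda> by (auto intro!: derivative_eq_intros)
    show ?thesis unfolding W_def using DERIV_mult[OF dE dV] by (simp add: algebra_simps)
  qed
  have "W t \<le> W s0"
  proof (rule DERIV_nonpos_imp_decreasing_open[OF t])
    show "continuous_on {s0..t} W"
      unfolding continuous_on_eq_continuous_within using DERIV_continuous[OF d] by blast
    fix u assume u: "s0 < u" "u < t"
    have "at u within {s0..t} = at u" using u by (intro at_within_interior) auto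
    then have "DERIV W u :> exp ((u - s0) / \<Lambda>) * (V u / \<Lambda> - b u \<bullet> b u)" using d[of u] u by simp
    moreover have "V u / \<Lambda> - b u \<bullet> b u \<le> 0"
      using up[of u] V[of u] u \<Lambda> by (simp add: pos_divide_le_eq mult.commute)
    ultimately show "\<exists>y. DERIV W u :> y \<and> y \<le> 0"
      by (intro exI[of _ "exp ((u - s0) / \<Lambda>) * (V u / \<Lambda> - b u \<bullet> b u)"] conjI mult_nonneg_nonpos) auto
  qed
  then have "exp ((t - s0) / \<Lambda>) * V t \<le> V s0" by (simp add: W_def)
  then have "exp (- ((t - s0) / \<Lambda>)) * (exp ((t - s0) / \<Lambda>) * V t) \<le> exp (- ((t - s0) / \<Lambda>)) * V s0"
    by (rule mult_left_mono) simp
  then have "V t \<le> exp (- ((t - s0) / \<Lambda>)) * V s0"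
    by (simp add: mult.assoc[symmetric] exp_add[symmetric])
  then show ?thesis using t by (simp add: V mult.commute minus_divide_left)
qed

text \<open>The constants \<open>C\<close> and \<open>c\<close> in the proof bound the quadratic form of the Gramian from above and below, uniformly in time;
  the former comes from the exponential decay, the latter from the bound on the coefficient matrix.\<close>

lemma gram_bounds:
  assumes bd: "bounded_mat s0 n n A" and n: "n > 0" and b: "lin_solution n A s0 b"
  defines "S \<equiv> gram n \<Phi>"
  defines "\<beta> \<equiv> sqrt ((b s0 \<bullet> (S s0 *\<^sub>v b s0)) / lambda_min_inf s0 S)"
    and "\<gamma> \<equiv> 1 / (2 * lambda_max_sup s0 S)"
  shows "\<forall>t\<ge>s0. pos_def n (S t)" and "lambda_min_inf s0 S > 0"
    and "bdd_above ((\<lambda>t. Max (spectrum (S t))) ` {s0..})" and "\<gamma> > 0"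
    and "\<forall>t\<ge>s0. vnorm (b t) \<le> \<beta> * exp (- \<gamma> * (t - s0))"
proof -
  have Sc: "S t \<in> carrier_mat n n" for t unfolding S_def by (rule gram_carrier)
  have Ssym: "transpose_mat (S t) = S t" if "t \<ge> s0" for t unfolding S_def by (rule gram_symmetric[OF that])
  define B where "B i j = (SOME c. \<forall>t\<ge>s0. \<bar>A t $$ (i, j)\<bar> \<le> c)" for i j
  have B: "\<bar>A t $$ (i, j)\<bar> \<le> B i j" if "i < n" "j < n" "t \<ge> s0" for i j t
  proof -
    have "bounded ((\<lambda>t. A t $$ (i, j)) ` {s0..})"
      using bd that by (simp add: entrywise_def bounded_from_def)
    then have "\<exists>c. \<forall>t\<ge>s0. \<bar>A t $$ (i, j)\<bar> \<le> c"
      by (auto simp: bounded_iff)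
    from someI_ex[OF this] that show ?thesis unfolding B_def by simp
  qed
  define a where "a = (\<Sum>i<n. \<Sum>j<n. \<bar>B i j\<bar>)"
  have a0: "a \<ge> 0" unfolding a_def by (intro sum_nonneg) auto
  have a: "- a * (x \<bullet> x) \<le> x \<bullet> (A t *\<^sub>v x)" if t: "t \<ge> s0" and x: "x \<in> carrier_vec n" for t x
  proof -
    have "(\<Sum>i<n. \<Sum>j<n. \<bar>A t $$ (i, j)\<bar>) \<le> a" unfolding a_def
      by (intro sum_mono order.trans[OF B[OF _ _ t] abs_ge_self]) auto
    then have "\<bar>x \<bullet> (A t *\<^sub>v x)\<bar> \<le> a * (x \<bullet> x)"
      by (rule order.trans[OF form_le_entry_sum[OF A_carrier[OF t] x] mult_right_mono[OF _ scalar_prod_self_nonneg]])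
    then show ?thesis by linarith
  qed
  define c C where "c = exp (- (2 * a))" and "C = k\<^sup>2 / (2 * \<kappa>)"
  have c0: "c > 0" by (simp add: c_def)
  have lo: "c * (x \<bullet> x) \<le> x \<bullet> (S t *\<^sub>v x)" if "t \<ge> s0" "x \<in> carrier_vec n" for t x
    unfolding c_def S_def by (rule gram_lower[OF a a0 that])
  have hi: "x \<bullet> (S t *\<^sub>v x) \<le> C * (x \<bullet> x)" if "t \<ge> s0" "x \<in> carrier_vec n" for t x
    unfolding C_def S_def by (rule gram_upper[OF that])
  note spec = symmetric_spectrum_bounds[OF Sc Ssym n]
  have min: "c \<le> Min (spectrum (S t))" and max: "Max (spectrum (S t)) \<le> C" if "t \<ge> s0" for t
    by (rule spec(4)[OF that lo[OF that]], assumption) (rule spec(3)[OF that hi[OF that]])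
  have bdb: "bdd_below ((\<lambda>t. Min (spectrum (S t))) ` {s0..})" by (rule bdd_belowI2[of _ c]) (use min in auto)
  show bda: "bdd_above ((\<lambda>t. Max (spectrum (S t))) ` {s0..})" by (rule bdd_aboveI2[of _ _ C]) (use max in auto)
  have "c \<le> lambda_min_inf s0 S" unfolding lambda_min_inf_def
    by (rule cINF_greatest) (use min in auto)
  with c0 show lmin: "lambda_min_inf s0 S > 0" by linarith
  have minle: "lambda_min_inf s0 S \<le> Min (spectrum (S t))" if "t \<ge> s0" for t
    unfolding lambda_min_inf_def by (rule cINF_lower[OF bdb]) (use that in auto)
  have maxle: "Max (spectrum (S t)) \<le> lambda_max_sup s0 S" if "t \<ge> s0" for t
    unfolding lambda_max_sup_def by (rule cSUP_upper[OF _ bda]) (use that in auto)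
  have lmax: "lambda_max_sup s0 S > 0"
    using min[of s0] maxle[of s0] spec(5)[of s0] c0 by linarith
  then show "\<gamma> > 0" by (simp add: \<gamma>_def)
  show "\<forall>t\<ge>s0. pos_def n (S t)"
    unfolding pos_def_def
  proof (intro allI impI conjI ballI)
    fix t and x :: "real vec" assume t: "t \<ge> s0" and x: "x \<in> carrier_vec n" "x \<noteq> 0\<^sub>v n"
    show "0 < x \<bullet> (S t *\<^sub>v x)"
      using lo[OF t x(1)] mult_pos_pos[OF c0 scalar_prod_self_pos[OF x]] by linarith
  qed (use Sc Ssym in auto)
  show "\<forall>t\<ge>s0. vnorm (b t) \<le> \<beta> * exp (- \<gamma> * (t - s0))"
  proof (intro allI impI)
    fix t assume t: "t \<ge> s0"
    have bc: "b u \<in> carrier_vec n" if "u \<ge> s0" for u using lin_solution_carrier[OF b that] .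
    let ?V = "\<lambda>t. b t \<bullet> (S t *\<^sub>v b t)"
    have "?V u \<le> lambda_max_sup s0 S * (b u \<bullet> b u)" if u: "u \<ge> s0" for u
      using spec(1)[OF u bc[OF u]] mult_right_mono[OF maxle[OF u] scalar_prod_self_nonneg[of "b u"]] by linarith
    then have "?V t \<le> ?V s0 * exp (- (t - s0) / lambda_max_sup s0 S)"
      unfolding S_def by (intro gram_lyapunov_decay[OF b t]) (use lmax in \<open>auto simp: S_def\<close>)
    moreover have "lambda_min_inf s0 S * (b t \<bullet> b t) \<le> ?V t"
      using spec(2)[OF t bc[OF t]] mult_right_mono[OF minle[OF t] scalar_prod_self_nonneg[of "b t"]] by linarith
    ultimately have "b t \<bullet> b t \<le> ?V s0 / lambda_min_inf s0 S * exp (- (t - s0) / lambda_max_sup s0 S)"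
      using lmin by (simp add: field_simps)
    then have "vnorm (b t) \<le> sqrt (?V s0 / lambda_min_inf s0 S * exp (- (t - s0) / lambda_max_sup s0 S))"
      unfolding vnorm_def by (rule real_sqrt_le_mono)
    also have "\<dots> = \<beta> * sqrt (exp (- (t - s0) / lambda_max_sup s0 S))"
      unfolding \<beta>_def by (rule real_sqrt_mult)
    also have "sqrt (exp (- (t - s0) / lambda_max_sup s0 S)) = exp (- \<gamma> * (t - s0))"
    proof (rule real_sqrt_unique)
      have "2 * (- \<gamma> * (t - s0)) = - (t - s0) / lambda_max_sup s0 S"
        using lmax by (simp add: \<gamma>_def field_simps)
      then show "(exp (- \<gamma> * (t - s0)))\<^sup>2 = exp (- (t - s0) / lambda_max_sup s0 S)"
        unfolding exp_double[symmetric] by simp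
    qed simp
    finally show "vnorm (b t) \<le> \<beta> * exp (- \<gamma> * (t - s0))" .
  qed
qed

end

section \<open>Continuity of matrix-valued functions\<close>

lemma cont_mat_carrier: "cont_mat s0 r c F \<Longrightarrow> t \<ge> s0 \<Longrightarrow> F t \<in> carrier_mat r c"
  by (simp add: entrywise_def)

lemma cont_mat_entry:
  "cont_mat s0 r c F \<Longrightarrow> i < r \<Longrightarrow> j < c \<Longrightarrow> continuous_on {s0..} (\<lambda>t. F t $$ (i, j))"
  by (simp add: entrywise_def)

lemma cont_matI:
  assumes "\<And>t. t \<ge> s0 \<Longrightarrow> F t \<in> carrier_mat r c"
    and "\<And>i j. i < r \<Longrightarrow> j < c \<Longrightarrow> continuous_on {s0..} (f i j)"
    and "\<And>i j t. i < r \<Longrightarrow> j < c \<Longrightarrow> t \<ge> s0 \<Longrightarrow> F t $$ (i, j) = f i j t"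
  shows "cont_mat s0 r c F"
  unfolding entrywise_def
proof (intro conjI allI impI)
  fix i j assume "i < r" "j < c"
  then show "continuous_on {s0..} (\<lambda>t. F t $$ (i, j))"
    using continuous_on_cong[OF refl, of "{s0..}" "\<lambda>t. F t $$ (i, j)" "f i j"] assms by auto
qed (use assms in auto)

lemma cont_mat_cong:
  assumes "cont_mat s0 r c F" "\<And>t. t \<ge> s0 \<Longrightarrow> G t = F t"
  shows "cont_mat s0 r c G"
  by (rule cont_matI[where f = "\<lambda>i j t. F t $$ (i, j)"])
    (use assms in \<open>auto simp: cont_mat_carrier cont_mat_entry\<close>)

lemma cont_mat_const: "F \<in> carrier_mat r c \<Longrightarrow> cont_mat s0 r c (\<lambda>_. F)"
  by (auto simp: entrywise_def)

lemma cont_mat_mult: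
  assumes F: "cont_mat s0 a b F" and G: "cont_mat s0 b c G"
  shows "cont_mat s0 a c (\<lambda>t. F t * G t)"
proof (rule cont_matI[where f = "\<lambda>i j t. \<Sum>k<b. F t $$ (i, k) * G t $$ (k, j)"])
  fix i j assume "i < a" "j < c"
  then show "continuous_on {s0..} (\<lambda>t. \<Sum>k<b. F t $$ (i, k) * G t $$ (k, j))"
    by (intro continuous_intros cont_mat_entry[OF F] cont_mat_entry[OF G]) auto
next
  fix i j t assume "i < a" "j < c" "t \<ge> s0"
  then show "(F t * G t) $$ (i, j) = (\<Sum>k<b. F t $$ (i, k) * G t $$ (k, j))"
    using cont_mat_carrier[OF F, of t] cont_mat_carrier[OF G, of t]
    by (auto simp: scalar_prod_def atLeast0LessThan)
qed (rule mult_carrier_mat[OF cont_mat_carrier[OF F] cont_mat_carrier[OF G]])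

lemma cont_mat_add:
  assumes F: "cont_mat s0 a b F" and G: "cont_mat s0 a b G"
  shows "cont_mat s0 a b (\<lambda>t. F t + G t)"
proof (rule cont_matI[where f = "\<lambda>i j t. F t $$ (i, j) + G t $$ (i, j)"])
  fix i j t assume "i < a" "j < b" "t \<ge> s0"
  then show "(F t + G t) $$ (i, j) = F t $$ (i, j) + G t $$ (i, j)"
    using cont_mat_carrier[OF F, of t] cont_mat_carrier[OF G, of t] by simp
qed (auto intro!: continuous_intros cont_mat_entry[OF F] cont_mat_entry[OF G]
      add_carrier_mat cont_mat_carrier[OF G])

lemma cont_mat_minus:
  assumes F: "cont_mat s0 a b F" and G: "cont_mat s0 a b G"
  shows "cont_mat s0 a b (\<lambda>t. F t - G t)"
proof (rule cont_matI[where f = "\<lambda>i j t. F t $$ (i, j) - G t $$ (i, j)"])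
  fix i j t assume "i < a" "j < b" "t \<ge> s0"
  then show "(F t - G t) $$ (i, j) = F t $$ (i, j) - G t $$ (i, j)"
    using cont_mat_carrier[OF F, of t] cont_mat_carrier[OF G, of t] by simp
qed (auto intro!: continuous_intros cont_mat_entry[OF F] cont_mat_entry[OF G]
      minus_carrier_mat cont_mat_carrier[OF G])

lemma cont_mat_transpose:
  assumes F: "cont_mat s0 a b F"
  shows "cont_mat s0 b a (\<lambda>t. transpose_mat (F t))"
proof (rule cont_matI[where f = "\<lambda>i j t. F t $$ (j, i)"])
  fix i j t assume "i < b" "j < a" "t \<ge> s0"
  then show "transpose_mat (F t) $$ (i, j) = F t $$ (j, i)" using cont_mat_carrier[OF F, of t] by simp
qed (auto intro!: cont_mat_entry[OF F] cont_mat_carrier[OF F])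

lemma cont_mat_left_cols:
  assumes F: "cont_mat s0 a b F" and r: "r \<le> b"
  shows "cont_mat s0 a r (\<lambda>t. left_cols r (F t))"
proof (rule cont_matI[where f = "\<lambda>i j t. F t $$ (i, j)"])
  fix t assume "t \<ge> s0"
  then have c: "F t \<in> carrier_mat a b" by (rule cont_mat_carrier[OF F])
  then show "left_cols r (F t) \<in> carrier_mat a r" by (simp add: left_cols_def)
  show "left_cols r (F t) $$ (i, j) = F t $$ (i, j)" if "i < a" "j < r" for i j
    using c that by (simp add: left_cols_def)
qed (use r in \<open>auto intro!: cont_mat_entry[OF F]\<close>)

lemma cont_mat_right_cols:
  assumes F: "cont_mat s0 a b F" and r: "r \<le> b"
  shows "cont_mat s0 a (b - r) (\<lambda>t. right_cols r (F t))"
proof (rule cont_matI[where f = "\<lambda>i j t. F t $$ (i, r + j)"])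
  fix t assume "t \<ge> s0"
  then have c: "F t \<in> carrier_mat a b" by (rule cont_mat_carrier[OF F])
  then show "right_cols r (F t) \<in> carrier_mat a (b - r)" by (simp add: right_cols_def)
  show "right_cols r (F t) $$ (i, j) = F t $$ (i, r + j)" if "i < a" "j < b - r" for i j
    using c that by (simp add: right_cols_def)
qed (use r in \<open>auto intro!: cont_mat_entry[OF F]\<close>)

lemma continuous_on_det:
  assumes F: "cont_mat s0 n n F"
  shows "continuous_on {s0..} (\<lambda>t. det (F t))"
proof -
  have "continuous_on {s0..} (\<lambda>t. \<Sum>p\<in>{p. p permutes {0..<n}}. signof p * (\<Prod>i = 0..<n. F t $$ (i, p i)))"
  proof (intro continuous_intros)
    fix p i assume "p \<in> {p. p permutes {0..<n}}" "i \<in> {0..<n}"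
    then have "p i < n" "i < n" using permutes_in_image[of p "{0..<n}" i] by auto
    then show "continuous_on {s0..} (\<lambda>t. F t $$ (i, p i))" by (intro cont_mat_entry[OF F])
  qed
  then show ?thesis
    by (rule continuous_on_eq) (simp add: det_def'[OF cont_mat_carrier[OF F]])
qed

text \<open>Cramer's rule makes the entries of the inverse continuous functions of the entries of the matrix.\<close>

lemma minv_entry:
  fixes A :: "real mat"
  assumes A: "A \<in> carrier_mat n n" and d: "det A \<noteq> 0" and ij: "i < n" "j < n"
  shows "minv A $$ (i, j) = cofactor A j i / det A"
proof -
  note inv = invertible_obtain_inverse[OF A d]
  note adj = adj_mat[OF A]
  have "adj_mat A = minv A * A * adj_mat A" using inv adj by simp
  also have "\<dots> = minv A * (A * adj_mat A)" using inv(1) A adj(1) by (rule assoc_mult_mat)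
  also have "\<dots> = det A \<cdot>\<^sub>m minv A" unfolding adj(2) using inv(1) by (simp add: mult_smult_distrib[of _ n n _ n])
  finally have "adj_mat A $$ (i, j) = (det A \<cdot>\<^sub>m minv A) $$ (i, j)" by simp
  then show ?thesis using A inv(1) ij d by (simp add: adj_mat_def field_simps)
qed

lemma cont_mat_minv:
  assumes F: "cont_mat s0 n n F" and d: "\<And>t. t \<ge> s0 \<Longrightarrow> det (F t) \<noteq> 0"
  shows "cont_mat s0 n n (\<lambda>t. minv (F t))"
proof (rule cont_matI[where f = "\<lambda>i j t. (-1) ^ (j + i) * det (mat_delete (F t) j i) / det (F t)"])
  fix t assume t: "t \<ge> s0"
  then show "minv (F t) \<in> carrier_mat n n" using invertible_obtain_inverse(1) cont_mat_carrier[OF F] d by blast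
  show "minv (F t) $$ (i, j) = (-1) ^ (j + i) * det (mat_delete (F t) j i) / det (F t)" if "i < n" "j < n" for i j
    using minv_entry[OF cont_mat_carrier[OF F t] d[OF t] that] by (simp add: cofactor_def)
next
  fix i j assume ij: "i < n" "j < n"
  have "cont_mat s0 (n - 1) (n - 1) (\<lambda>t. mat_delete (F t) j i)"
  proof (rule cont_matI[where f = "\<lambda>i' j' t. F t $$ (if i' < j then i' else Suc i', if j' < i then j' else Suc j')"])
    fix t assume "t \<ge> s0"
    then have c: "F t \<in> carrier_mat n n" by (rule cont_mat_carrier[OF F])
    then show "mat_delete (F t) j i \<in> carrier_mat (n - 1) (n - 1)" by (rule mat_delete_carrier)
    show "mat_delete (F t) j i $$ (i', j') = F t $$ (if i' < j then i' else Suc i', if j' < i then j' else Suc j')"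
      if "i' < n - 1" "j' < n - 1" for i' j'
      using that c by (simp add: mat_delete_def)
  qed (intro cont_mat_entry[OF F], auto)
  then show "continuous_on {s0..} (\<lambda>t. (-1) ^ (j + i) * det (mat_delete (F t) j i) / det (F t))"
    by (intro continuous_intros continuous_on_det[OF F] continuous_on_det) (use d in auto)
qed

lemma invertible_mat_det:
  fixes A :: "real mat"
  assumes A: "A \<in> carrier_mat n n" and inv: "invertible_mat A"
  shows "det A \<noteq> 0"
proof -
  obtain B where B: "A * B = 1\<^sub>m (dim_row A)" "B * A = 1\<^sub>m (dim_row B)"
    using inv by (auto simp: invertible_mat_def inverts_mat_def)
  have "dim_col B = n" using arg_cong[OF B(1), of dim_col] A by simp
  moreover have "dim_row B = n" using arg_cong[OF B(2), of dim_col] A by simp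
  ultimately have "B \<in> carrier_mat n n" by auto
  then have "det A * det B = 1" using det_mult[OF A, of B] B(1) A by simp
  then show ?thesis by auto
qed

text \<open>Orthonormal columns make \<open>U\<close> injective, so a kernel vector \<open>v\<close> of \<open>U\<^sup>T A U\<close> would give \<open>w = U v \<noteq> 0\<close> with \<open>w\<^sup>T A w = 0\<close>.\<close>

lemma pos_def_congruence_det:
  fixes A U :: "real mat"
  assumes A: "pos_def n A" and U: "U \<in> carrier_mat n m" and UU: "transpose_mat U * U = 1\<^sub>m m"
  shows "det (transpose_mat U * A * U) \<noteq> 0"
proof
  have Ac: "A \<in> carrier_mat n n" using A by (simp add: pos_def_def)
  have Uc: "transpose_mat U \<in> carrier_mat m n" using U by simp
  have c: "transpose_mat U * A * U \<in> carrier_mat m m" using Ac U by auto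
  assume "det (transpose_mat U * A * U) = 0"
  then obtain v where v: "v \<in> carrier_vec m" "v \<noteq> 0\<^sub>v m" "(transpose_mat U * A * U) *\<^sub>v v = 0\<^sub>v m"
    using det_0_iff_vec_prod_zero_field[OF c] by blast
  define w where "w = U *\<^sub>v v"
  have w: "w \<in> carrier_vec n" using U v by (auto simp: w_def)
  have Uw: "transpose_mat U *\<^sub>v w = v"
    unfolding w_def using assoc_mult_mat_vec[OF Uc U v(1)] UU v(1) by simp
  have "w \<noteq> 0\<^sub>v n"
  proof
    assume "w = 0\<^sub>v n"
    then have "v = 0\<^sub>v m" using Uw Uc by auto
    then show False using v by simp
  qed
  then have "0 < w \<bullet> (A *\<^sub>v w)" using A w by (simp add: pos_def_def)
  also have "w \<bullet> (A *\<^sub>v w) = (A *\<^sub>v w) \<bullet> (U *\<^sub>v v)"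
    using Ac w by (simp add: w_def[symmetric] comm_scalar_prod[of _ n])
  also have "\<dots> = (transpose_mat U *\<^sub>v (A *\<^sub>v w)) \<bullet> v"
    using transpose_vec_mult_scalar[OF U v(1), of "A *\<^sub>v w"] Ac w by simp
  also have "transpose_mat U *\<^sub>v (A *\<^sub>v w) = (transpose_mat U * A * U) *\<^sub>v v"
    unfolding w_def using assoc_mult_mat_vec[OF mult_carrier_mat[OF Uc Ac] U v(1)]
      assoc_mult_mat_vec[OF Uc Ac w] by (simp add: w_def)
  also have "\<dots> \<bullet> v = 0" using v by simp
  finally show False by simp
qed

lemma smooth_from_continuous: "smooth_from s0 f \<Longrightarrow> continuous_on {s0..} f"
  unfolding smooth_from_def continuous_on_eq_continuous_within
  by (metis DERIV_continuous atLeast_iff)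

text \<open>The power series at \<open>t\<close> converges at some point to the right of \<open>t\<close>, hence defines a function that is continuous at \<open>t\<close>.\<close>

lemma analytic_from_continuous:
  assumes "analytic_from s0 f"
  shows "continuous_on {s0..} f"
  unfolding continuous_on_eq_continuous_within
proof
  fix t assume "t \<in> {s0..}"
  then obtain r a where r: "r > 0" and a: "\<And>s. s \<ge> s0 \<Longrightarrow> \<bar>s - t\<bar> < r \<Longrightarrow> (\<lambda>k. a k * (s - t) ^ k) sums f s"
    using assms unfolding analytic_from_def by (metis atLeast_iff)
  let ?g = "\<lambda>x. \<Sum>k. a k * x ^ k"
  have "summable (\<lambda>k. a k * (r / 2) ^ k)"
    using a[of "t + r / 2"] r \<open>t \<in> {s0..}\<close> by (auto simp: sums_iff)
  then have "isCont ?g (t - t)" by (intro isCont_powser[of a "r / 2"]) (use r in auto)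
  then have "isCont (\<lambda>s. ?g (s - t)) t" by (intro continuous_intros isCont_o2[where f = "\<lambda>s. s - t" and g = ?g]) auto
  then have "continuous (at t within {s0..}) (\<lambda>s. ?g (s - t))" by (rule continuous_at_imp_continuous_within)
  then show "continuous (at t within {s0..}) f"
  proof (rule continuous_transform_within[of _ _ _ r])
    fix s assume "s \<in> {s0..}" "dist s t < r"
    then show "?g (s - t) = f s" using a[of s] by (simp add: dist_real_def sums_iff)
  qed (use r \<open>t \<in> {s0..}\<close> in auto)
qed

section \<open>Singular value decompositions\<close>

lemma is_svd_inner:
  assumes svd: "is_svd a b r H U \<Sigma> V"
  shows "H \<in> carrier_mat a b"
    and "transpose_mat U * H = four_block_mat \<Sigma> (0\<^sub>m r (b - r)) (0\<^sub>m (a - r) r) (0\<^sub>m (a - r) (b - r)) * transpose_mat V"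
    and "transpose_mat U * H * V = four_block_mat \<Sigma> (0\<^sub>m r (b - r)) (0\<^sub>m (a - r) r) (0\<^sub>m (a - r) (b - r))"
proof -
  let ?F = "four_block_mat \<Sigma> (0\<^sub>m r (b - r)) (0\<^sub>m (a - r) r) (0\<^sub>m (a - r) (b - r))"
  have r: "r \<le> a" "r \<le> b" and U: "U \<in> carrier_mat a a" "transpose_mat U * U = 1\<^sub>m a"
    and V: "V \<in> carrier_mat b b" "transpose_mat V * V = 1\<^sub>m b" and \<Sigma>: "\<Sigma> \<in> carrier_mat r r"
    and H: "H = U * ?F * transpose_mat V"
    using svd by (auto simp: is_svd_def)
  have F: "?F \<in> carrier_mat a b" using four_block_carrier_mat[OF \<Sigma>, of "0\<^sub>m (a - r) (b - r)" "a - r" "b - r"] r by simp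
  show Hc: "H \<in> carrier_mat a b" using H U V F by auto
  have UT: "transpose_mat U \<in> carrier_mat a a" and VT: "transpose_mat V \<in> carrier_mat b b" using U V by auto
  have "transpose_mat U * H = transpose_mat U * (U * (?F * transpose_mat V))"
    using H assoc_mult_mat[OF U(1) F VT] by simp
  also have "\<dots> = (transpose_mat U * U) * (?F * transpose_mat V)"
    using assoc_mult_mat[OF UT U(1), of "?F * transpose_mat V" b] F VT by simp
  also have "\<dots> = ?F * transpose_mat V"
    unfolding U(2) by (rule left_mult_one_mat[OF mult_carrier_mat[OF F VT]])
  finally show *: "transpose_mat U * H = ?F * transpose_mat V" .
  show "transpose_mat U * H * V = ?F"
    unfolding * assoc_mult_mat[OF F VT V(1)] V(2) by (rule right_mult_one_mat[OF F])
qed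

text \<open>In the coordinates given by the columns of \<open>U\<close>, the first \<open>r\<close> components of \<open>H d\<close> determine \<open>V\<^sub>1\<^sup>T d\<close> and the
  others vanish.\<close>

lemma is_svd_decoupling:
  assumes svd: "is_svd a b r H U \<Sigma> V"
  shows "transpose_mat (left_cols r U) * H = \<Sigma> * transpose_mat (left_cols r V)"
    and "transpose_mat (right_cols r U) * H = 0\<^sub>m (a - r) b"
proof -
  let ?F = "four_block_mat \<Sigma> (0\<^sub>m r (b - r)) (0\<^sub>m (a - r) r) (0\<^sub>m (a - r) (b - r))"
  have r: "r \<le> a" "r \<le> b" and U: "U \<in> carrier_mat a a" 
    and V: "V \<in> carrier_mat b b" and \<Sigma>: "\<Sigma> \<in> carrier_mat r r"
    using svd by (auto simp: is_svd_def)
  have H: "H \<in> carrier_mat a b" by (rule is_svd_inner(1)[OF svd])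
  have F: "?F \<in> carrier_mat a b" using four_block_carrier_mat[OF \<Sigma>, of "0\<^sub>m (a - r) (b - r)" "a - r" "b - r"] r by simp
  have row: "(\<Sum>k<a. U $$ (k, i) * H $$ (k, j)) = (\<Sum>k<b. ?F $$ (i, k) * V $$ (j, k))" if "i < a" "j < b" for i j
  proof -
    have "(transpose_mat U * H) $$ (i, j) = (?F * transpose_mat V) $$ (i, j)"
      by (simp add: is_svd_inner(2)[OF svd])
    moreover have "(transpose_mat U * H) $$ (i, j) = (\<Sum>k<a. U $$ (k, i) * H $$ (k, j))"
      using that U H by (auto simp: scalar_prod_def atLeast0LessThan)
    moreover have "(?F * transpose_mat V) $$ (i, j) = (\<Sum>k<b. ?F $$ (i, k) * V $$ (j, k))"
      using that F V by (subst index_mult_mat(1)) (auto simp: scalar_prod_def atLeast0LessThan simp del: index_mat_four_block)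
    ultimately show ?thesis by simp
  qed
  show "transpose_mat (left_cols r U) * H = \<Sigma> * transpose_mat (left_cols r V)"
  proof (rule eq_matI)
    fix i j assume "i < dim_row (\<Sigma> * transpose_mat (left_cols r V))" "j < dim_col (\<Sigma> * transpose_mat (left_cols r V))"
    then have ij: "i < r" "j < b" using \<Sigma> V by (auto simp: left_cols_def)
    have "(transpose_mat (left_cols r U) * H) $$ (i, j) = (\<Sum>k<a. U $$ (k, i) * H $$ (k, j))"
      using ij U H r by (auto simp: left_cols_def scalar_prod_def atLeast0LessThan)
    also have "\<dots> = (\<Sum>k<b. ?F $$ (i, k) * V $$ (j, k))" using ij r by (intro row) auto
    also have "\<dots> = (\<Sum>k<r. ?F $$ (i, k) * V $$ (j, k))"
      using r ij \<Sigma> by (intro sum.mono_neutral_right) auto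
    also have "\<dots> = (\<Sum>k<r. \<Sigma> $$ (i, k) * V $$ (j, k))"
      using r ij \<Sigma> by (intro sum.cong) auto
    also have "\<dots> = (\<Sigma> * transpose_mat (left_cols r V)) $$ (i, j)"
      using ij V \<Sigma> r by (auto simp: left_cols_def scalar_prod_def atLeast0LessThan)
    finally show "(transpose_mat (left_cols r U) * H) $$ (i, j) = (\<Sigma> * transpose_mat (left_cols r V)) $$ (i, j)" .
  qed (use U V H \<Sigma> in \<open>auto simp: left_cols_def\<close>)
  show "transpose_mat (right_cols r U) * H = 0\<^sub>m (a - r) b"
  proof (rule eq_matI)
    fix i j assume "i < dim_row (0\<^sub>m (a - r) b :: real mat)" "j < dim_col (0\<^sub>m (a - r) b :: real mat)"
    then have ij: "i < a - r" "j < b" by auto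
    have "(transpose_mat (right_cols r U) * H) $$ (i, j) = (\<Sum>k<a. U $$ (k, r + i) * H $$ (k, j))"
      using ij U H r by (auto simp: right_cols_def scalar_prod_def atLeast0LessThan)
    also have "\<dots> = (\<Sum>k<b. ?F $$ (r + i, k) * V $$ (j, k))" using ij r by (intro row) auto
    also have "\<dots> = 0"
      using r ij \<Sigma> by (intro sum.neutral) auto
    finally show "(transpose_mat (right_cols r U) * H) $$ (i, j) = 0\<^sub>m (a - r) b $$ (i, j)" using ij by simp
  qed (use U H in \<open>auto simp: right_cols_def\<close>)
qed

lemma sum_lessThan_add:
  fixes f :: "nat \<Rightarrow> real"
  shows "(\<Sum>k<r + d. f k) = (\<Sum>k<r. f k) + (\<Sum>k<d. f (r + k))"
  by (induction d) simp_all

lemma orthogonal_blocks: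
  fixes V :: "real mat"
  assumes V: "V \<in> carrier_mat b b" "transpose_mat V * V = 1\<^sub>m b" and r: "r \<le> b"
  shows "transpose_mat (right_cols r V) * right_cols r V = 1\<^sub>m (b - r)"
    and "left_cols r V * transpose_mat (left_cols r V) + right_cols r V * transpose_mat (right_cols r V) = 1\<^sub>m b"
proof -
  have col: "(\<Sum>k<b. V $$ (k, i) * V $$ (k, j)) = (if i = j then 1 else 0)" if "i < b" "j < b" for i j
  proof -
    have "(transpose_mat V * V) $$ (i, j) = (\<Sum>k<b. V $$ (k, i) * V $$ (k, j))"
      using that V(1) by (auto simp: scalar_prod_def atLeast0LessThan)
    then show ?thesis using V(2) that by simp
  qed
  have VV: "V * transpose_mat V = 1\<^sub>m b"
    by (rule mat_mult_left_right_inverse[OF _ V(1) V(2)]) (use V in auto)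
  have rw: "(\<Sum>k<b. V $$ (i, k) * V $$ (j, k)) = (if i = j then 1 else 0)" if "i < b" "j < b" for i j
  proof -
    have "(V * transpose_mat V) $$ (i, j) = (\<Sum>k<b. V $$ (i, k) * V $$ (j, k))"
      using that V(1) by (auto simp: scalar_prod_def atLeast0LessThan)
    then show ?thesis using VV that by simp
  qed
  show "transpose_mat (right_cols r V) * right_cols r V = 1\<^sub>m (b - r)"
    by (rule eq_matI) (use V(1) r col in \<open>auto simp: right_cols_def scalar_prod_def atLeast0LessThan\<close>)
  show "left_cols r V * transpose_mat (left_cols r V) + right_cols r V * transpose_mat (right_cols r V) = 1\<^sub>m b"
  proof (rule eq_matI)
    fix i j assume "i < dim_row (1\<^sub>m b :: real mat)" "j < dim_col (1\<^sub>m b :: real mat)"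
    then have ij: "i < b" "j < b" by auto
    have "(left_cols r V * transpose_mat (left_cols r V) + right_cols r V * transpose_mat (right_cols r V)) $$ (i, j)
        = (\<Sum>k<r. V $$ (i, k) * V $$ (j, k)) + (\<Sum>k<b - r. V $$ (i, r + k) * V $$ (j, r + k))"
      using ij V(1) r by (auto simp: left_cols_def right_cols_def scalar_prod_def atLeast0LessThan)
    also have "\<dots> = (\<Sum>k<r + (b - r). V $$ (i, k) * V $$ (j, k))"
      by (rule sum_lessThan_add[symmetric])
    also have "\<dots> = 1\<^sub>m b $$ (i, j)" using rw[OF ij] r ij by simp
    finally show "(left_cols r V * transpose_mat (left_cols r V) + right_cols r V * transpose_mat (right_cols r V)) $$ (i, j) = 1\<^sub>m b $$ (i, j)" .
  qed (use V(1) in \<open>auto simp: left_cols_def right_cols_def\<close>)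
qed

lemma smooth_bounded_cont_mat: "smooth_bounded_mat s0 a b F \<Longrightarrow> cont_mat s0 a b F"
  by (auto simp: entrywise_def smooth_from_continuous)

lemma analytic_cont_mat: "entrywise (analytic_from s0) s0 a b F \<Longrightarrow> cont_mat s0 a b F"
  by (auto simp: entrywise_def analytic_from_continuous)

section \<open>The error matrix of the filter\<close>

locale elise_model =
  fixes M :: ise_model and P :: "real \<Rightarrow> real mat"
  assumes model: "model_assms M" and covariance: "filter_covariance M P"
begin

abbreviation "s0 \<equiv> t0 M"
abbreviation "n \<equiv> dimX M"
abbreviation "m \<equiv> dimU M"
abbreviation "p \<equiv> dimD M"
abbreviation "l \<equiv> dimY M"
abbreviation "lb \<equiv> dimYbar M"
abbreviation "r \<equiv> rkH M"
abbreviation "rb \<equiv> rkHbar M"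

lemma smooth_coefficients:
  shows "smooth_bounded_mat s0 n n (matA M)" "smooth_bounded_mat s0 n m (matB M)"
    "smooth_bounded_mat s0 n p (matG M)" "smooth_bounded_mat s0 l n (matC M)"
    "smooth_bounded_mat s0 l m (matD M)" "smooth_bounded_mat s0 n (dimW M) (matW M)"
    "entrywise (analytic_from s0) s0 l p (matH M)"
  by (insert model[unfolded model_assms_def], (elim conjE, assumption)+)

lemmas cont_system =
  smooth_coefficients(1-6)[THEN smooth_bounded_cont_mat] smooth_coefficients(7)[THEN analytic_cont_mat]

lemma cont_additional:
  shows "cont_mat s0 l l (svdU M)" "cont_mat s0 p p (svdV M)"
    "cont_mat s0 lb n (Cbar M)" "cont_mat s0 lb n (Cbarbar M)"
    "cont_mat s0 lb m (Dbar M)" "cont_mat s0 lb m (Dbarbar M)"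
    "cont_mat s0 lb p (Hbar M)" "cont_mat s0 lb p (Hbarbar M)"
    "cont_mat s0 lb lb (svdUbar M)"
    "cont_mat s0 (dimW M) (dimW M) (matQ M)" "cont_mat s0 l l (matR M)" "cont_mat s0 lb lb (Rbar M)"
    "cont_mat s0 l lb (Racute M)"
  by (insert model[unfolded model_assms_def], (elim conjE, assumption)+)

lemma dims: "n \<ge> l" "l \<ge> 1"
  by (insert model[unfolded model_assms_def], (elim conjE, assumption)+)

lemma svd: "t \<ge> s0 \<Longrightarrow> is_svd l p r (matH M t) (svdU M t) (svd\<Sigma> M t) (svdV M t)"
  and svdbar: "t \<ge> s0 \<Longrightarrow> is_svd lb p rb (Hbar M t) (svdUbar M t) (svd\<Sigma>bar M t) (svdVbar M t)"
  and T2bar_Hbarbar: "t \<ge> s0 \<Longrightarrow> T2bar M t * Hbarbar M t = 0\<^sub>m (lb - rb) p"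
  and R_pos_def: "t \<ge> s0 \<Longrightarrow> pos_def l (matR M t)"
  using model unfolding model_assms_def by (elim conjE, simp)+

lemma rank_bounds: "r \<le> l" "r \<le> p" "rb \<le> lb"
  using svd[of s0] svdbar[of s0] by (auto simp: is_svd_def)

lemma cont_P: "cont_mat s0 n n P"
  and R2tilde_invertible: "t \<ge> s0 \<Longrightarrow> invertible_mat (R2tilde M P t)"
  and M2_gram_invertible: "t \<ge> s0 \<Longrightarrow> invertible_mat (M2_gram M P t)"
proof -
  have d: "((\<lambda>\<tau>. P \<tau> $$ (i, j)) has_real_derivative riccati_rhs M P t $$ (i, j)) (at t within {s0..})"
    if "i < n" "j < n" "t \<ge> s0" for i j t
    using covariance that by (simp add: filter_covariance_def)
  show "cont_mat s0 n n P"
    unfolding entrywise_def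
    using covariance by (auto simp: filter_covariance_def continuous_on_eq_continuous_within intro!: DERIV_continuous[OF d])
qed (use covariance in \<open>simp_all add: filter_covariance_def\<close>)

lemma U2_orthonormal:
  assumes "t \<ge> s0"
  shows "transpose_mat (U2 M t) * U2 M t = 1\<^sub>m (l - r)"
  unfolding U2_def
  by (rule orthogonal_blocks; use svd[OF assms] in \<open>auto simp: is_svd_def\<close>)

lemma V_complete:
  assumes "t \<ge> s0"
  shows "V1 M t * transpose_mat (V1 M t) + V2 M t * transpose_mat (V2 M t) = 1\<^sub>m p"
  unfolding V1_def V2_def
  by (rule orthogonal_blocks; use svd[OF assms] in \<open>auto simp: is_svd_def\<close>)

text \<open>\<open>\<Sigma>\<close> is the leading block of \<open>U\<^sup>T H V\<close>, whose factors are continuous.\<close>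

lemma cont_\<Sigma>: "cont_mat s0 r r (svd\<Sigma> M)"
proof (rule cont_matI[where f = "\<lambda>i j t. (transpose_mat (svdU M t) * matH M t * svdV M t) $$ (i, j)"])
  fix t assume t: "t \<ge> s0"
  then show \<Sigma>: "svd\<Sigma> M t \<in> carrier_mat r r" using svd by (auto simp: is_svd_def)
  fix i j assume "i < r" "j < r"
  then show "svd\<Sigma> M t $$ (i, j) = (transpose_mat (svdU M t) * matH M t * svdV M t) $$ (i, j)"
    unfolding is_svd_inner(3)[OF svd[OF t]] using \<Sigma> rank_bounds by simp
next
  have "cont_mat s0 l p (\<lambda>t. transpose_mat (svdU M t) * matH M t * svdV M t)"
    by (intro cont_mat_mult[OF cont_mat_mult[OF cont_mat_transpose[OF cont_additional(1)] cont_system(7)] cont_additional(2)])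
  then show "continuous_on {s0..} (\<lambda>t. (transpose_mat (svdU M t) * matH M t * svdV M t) $$ (i, j))"
    if "i < r" "j < r" for i j
    by (rule cont_mat_entry) (use that rank_bounds in auto)
qed

lemma \<Sigma>_det: "t \<ge> s0 \<Longrightarrow> det (svd\<Sigma> M t) \<noteq> 0"
proof -
  assume t: "t \<ge> s0"
  then have \<Sigma>: "svd\<Sigma> M t \<in> carrier_mat r r" "diagonal_mat (svd\<Sigma> M t)" "\<And>i. i < r \<Longrightarrow> svd\<Sigma> M t $$ (i, i) > 0"
    using svd[OF t] by (auto simp: is_svd_def)
  have "upper_triangular (svd\<Sigma> M t)" using \<Sigma> by (auto simp: diagonal_mat_def)
  then have "det (svd\<Sigma> M t) = prod_list (diag_mat (svd\<Sigma> M t))" using \<Sigma>(1) by (rule det_upper_triangular)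
  also have "\<dots> \<noteq> 0" using \<Sigma>(1,3) by (fastforce simp: diag_mat_def prod_list_zero_iff)
  finally show ?thesis .
qed

lemma cont_blocks:
  shows "cont_mat s0 l r (U1 M)" "cont_mat s0 l (l - r) (U2 M)"
    "cont_mat s0 p r (V1 M)" "cont_mat s0 p (p - r) (V2 M)"
  unfolding U1_def[abs_def] U2_def[abs_def] V1_def[abs_def] V2_def[abs_def]
  by (rule cont_mat_left_cols[OF cont_additional(1) rank_bounds(1)] cont_mat_right_cols[OF cont_additional(1) rank_bounds(1)]
      cont_mat_left_cols[OF cont_additional(2) rank_bounds(2)] cont_mat_right_cols[OF cont_additional(2) rank_bounds(2)])+

lemma cont_G1: "cont_mat s0 n r (G1 M)" and cont_G2: "cont_mat s0 n (p - r) (G2 M)"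
  unfolding G1_def[abs_def] G2_def[abs_def]
  by (intro cont_mat_mult[of _ _ p] cont_blocks cont_system)+

lemma cont_T2: "cont_mat s0 (l - r) l (T2 M)"
  unfolding T2_def[abs_def] by (intro cont_mat_transpose cont_blocks)

lemma U2RU2_det: "t \<ge> s0 \<Longrightarrow> det (transpose_mat (U2 M t) * matR M t * U2 M t) \<noteq> 0"
  by (rule pos_def_congruence_det[OF R_pos_def cont_mat_carrier[OF cont_blocks(2)] U2_orthonormal])

lemma cont_T1: "cont_mat s0 r l (T1 M)"
  unfolding T1_def[abs_def]
  by (intro cont_mat_minus cont_mat_mult[of _ _ "l - r"] cont_mat_mult[of _ _ l] cont_mat_minv cont_mat_transpose cont_blocks
      cont_additional U2RU2_det)

lemma cont_C1: "cont_mat s0 r n (C1 M)" and cont_C2: "cont_mat s0 (l - r) n (C2 M)"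
  and cont_D1: "cont_mat s0 r m (D1 M)" and cont_D2: "cont_mat s0 (l - r) m (D2 M)"
  unfolding C1_def[abs_def] C2_def[abs_def] D1_def[abs_def] D2_def[abs_def]
  by (intro cont_mat_mult[of _ _ l] cont_T1 cont_T2 cont_system)+

lemma cont_R1: "cont_mat s0 r r (R1 M)" and cont_R2: "cont_mat s0 (l - r) (l - r) (R2 M)"
  unfolding R1_def[abs_def] R2_def[abs_def]
  by (intro cont_mat_mult[of _ _ l] cont_mat_transpose cont_T1 cont_T2 cont_additional)+

lemma cont_T2bar: "cont_mat s0 (lb - rb) lb (T2bar M)"
  unfolding T2bar_def[abs_def]
  by (intro cont_mat_transpose cont_mat_right_cols cont_additional rank_bounds)

lemma cont_C2bar: "cont_mat s0 (lb - rb) n (C2bar M)" and cont_D2bar: "cont_mat s0 (lb - rb) m (D2bar M)"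
  and cont_R2bar: "cont_mat s0 (lb - rb) (lb - rb) (R2bar M)"
  and cont_R2acute: "cont_mat s0 (l - r) (lb - rb) (R2acute M)"
  and cont_R12acute: "cont_mat s0 r (lb - rb) (R12acute M)"
  unfolding C2bar_def[abs_def] D2bar_def[abs_def] R2bar_def[abs_def] R2acute_def[abs_def] R12acute_def[abs_def]
  by (intro cont_mat_mult[of _ _ lb] cont_mat_mult[of _ _ l] cont_mat_transpose cont_T2bar cont_T1 cont_T2 cont_additional)+

lemma R2_det: "t \<ge> s0 \<Longrightarrow> det (R2 M t) \<noteq> 0"
  using U2RU2_det by (simp add: R2_def T2_def)

lemma cont_M1: "cont_mat s0 r r (M1 M)"
  unfolding M1_def[abs_def] by (intro cont_mat_minv cont_\<Sigma> \<Sigma>_det)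

lemma M1_\<Sigma>: "t \<ge> s0 \<Longrightarrow> M1 M t * svd\<Sigma> M t = 1\<^sub>m r"
  unfolding M1_def by (rule invertible_obtain_inverse(3)[OF cont_mat_carrier[OF cont_\<Sigma>] \<Sigma>_det])

lemma cont_Ahat: "cont_mat s0 n n (Ahat M)"
  unfolding Ahat_def[abs_def]
  by (intro cont_mat_minus cont_mat_mult[of _ _ r] cont_system cont_G1 cont_M1 cont_C1)

lemma cont_Qhat: "cont_mat s0 n n (Qhat M)"
  unfolding Qhat_def[abs_def]
  by (intro cont_mat_add cont_mat_mult[of _ n r] cont_mat_mult[of _ n "dimW M"] cont_mat_transpose
      cont_system cont_additional cont_G1 cont_M1 cont_R1)

lemma cont_R2tilde: "cont_mat s0 (lb - rb) (lb - rb) (R2tilde M P)"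
proof -
  let ?C = "\<lambda>t. C2bar M t * Ahat M t + T2bar M t * Cbarbar M t"
  have C: "cont_mat s0 (lb - rb) n ?C"
    by (intro cont_mat_add cont_mat_mult[OF cont_C2bar cont_Ahat] cont_mat_mult[OF cont_T2bar cont_additional(4)])
  show ?thesis
    unfolding R2tilde_def[abs_def]
    by (intro cont_mat_add cont_mat_minus cont_R2bar
      cont_mat_mult[OF cont_mat_mult[OF C cont_P] cont_mat_transpose[OF C]]
      cont_mat_mult[OF cont_mat_mult[OF cont_C2bar cont_Qhat] cont_mat_transpose[OF cont_C2bar]]
      cont_mat_mult[OF cont_mat_mult[OF cont_mat_mult[OF cont_C2bar cont_G1] cont_M1] cont_R12acute]
      cont_mat_mult[OF cont_mat_mult[OF cont_mat_mult[OF cont_mat_transpose[OF cont_R12acute] cont_mat_transpose[OF cont_M1]]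
        cont_mat_transpose[OF cont_G1]] cont_mat_transpose[OF cont_C2bar]])
qed

lemma cont_R2tilde_inv: "cont_mat s0 (lb - rb) (lb - rb) (\<lambda>t. minv (R2tilde M P t))"
  by (intro cont_mat_minv cont_R2tilde invertible_mat_det[OF cont_mat_carrier[OF cont_R2tilde] R2tilde_invertible])

lemma cont_M2_prefix:
  "cont_mat s0 (p - r) (lb - rb) (\<lambda>t. transpose_mat (G2 M t) * transpose_mat (C2bar M t) * minv (R2tilde M P t))"
  by (intro cont_mat_mult[OF cont_mat_mult[OF cont_mat_transpose[OF cont_G2] cont_mat_transpose[OF cont_C2bar]] cont_R2tilde_inv])

lemma cont_M2_gram: "cont_mat s0 (p - r) (p - r) (M2_gram M P)"
  unfolding M2_gram_def[abs_def]
  by (intro cont_mat_mult[OF cont_mat_mult[OF cont_M2_prefix cont_C2bar] cont_G2])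

lemma M2_gram_det: "t \<ge> s0 \<Longrightarrow> det (M2_gram M P t) \<noteq> 0"
  by (rule invertible_mat_det[OF cont_mat_carrier[OF cont_M2_gram] M2_gram_invertible])

lemma cont_M2: "cont_mat s0 (p - r) (lb - rb) (M2 M P)"
  unfolding M2_def[abs_def]
  by (intro cont_mat_mult[OF cont_mat_mult[OF cont_mat_mult[OF cont_mat_minv[OF cont_M2_gram M2_gram_det]
      cont_mat_transpose[OF cont_G2]] cont_mat_transpose[OF cont_C2bar]] cont_R2tilde_inv])

lemma cont_L: "cont_mat s0 n (l - r) (gainL M P)"
  unfolding gainL_def[abs_def]
  by (intro cont_mat_mult[OF cont_mat_minus[OF cont_mat_mult[OF cont_P cont_mat_transpose[OF cont_C2]]
      cont_mat_mult[OF cont_mat_mult[OF cont_G2 cont_M2] cont_mat_transpose[OF cont_R2acute]]]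
      cont_mat_minv[OF cont_R2 R2_det]])

lemma cont_Abar: "cont_mat s0 n n (Abar M P)"
  unfolding Abar_def[abs_def]
  by (intro cont_mat_minus cont_mat_mult[OF cont_mat_minus[OF cont_mat_const
      cont_mat_mult[OF cont_mat_mult[OF cont_G2 cont_M2] cont_C2bar]] cont_Ahat]
      cont_mat_mult[OF cont_mat_mult[OF cont_mat_mult[OF cont_G2 cont_M2] cont_T2bar] cont_additional(4)] one_carrier_mat)

lemma cont_Abreve: "cont_mat s0 n n (Abreve M P)"
  unfolding Abreve_def[abs_def]
  by (intro cont_mat_minus cont_Abar cont_mat_mult[OF cont_L cont_C2])

end

section \<open>Calculus of generalized processes\<close>

text \<open>The condition that \<open>test_fun\<close> imposes on each component; it is easier to propagate through matrix products.\<close>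

definition scalar_test_fun :: "real \<Rightarrow> (real \<Rightarrow> real) \<Rightarrow> bool" where
  "scalar_test_fun s0 g \<longleftrightarrow>
     set_borel_measurable lborel {s0..} g \<and> bounded_from s0 g \<and> (\<exists>T. \<forall>t\<ge>s0. t > T \<longrightarrow> g t = 0)"

lemma test_fun_iff:
  "test_fun s0 k \<phi> \<longleftrightarrow> (\<forall>t\<ge>s0. \<phi> t \<in> carrier_vec k) \<and> (\<forall>i<k. scalar_test_fun s0 (\<lambda>t. \<phi> t $ i))"
  by (simp add: test_fun_def scalar_test_fun_def)

lemma scalar_test_fun_cong:
  assumes "scalar_test_fun s0 g" "\<And>t. t \<ge> s0 \<Longrightarrow> h t = g t"
  shows "scalar_test_fun s0 h"
proof -
  have "set_borel_measurable lborel {s0..} h = set_borel_measurable lborel {s0..} g"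
    unfolding set_borel_measurable_def using assms(2)
    by (intro arg_cong[where f = "\<lambda>f. f \<in> borel_measurable lborel"] ext) (auto simp: indicator_def)
  moreover have "h ` {s0..} = g ` {s0..}" using assms(2) by (intro image_cong) auto
  ultimately show ?thesis using assms by (simp add: scalar_test_fun_def bounded_from_def)
qed

text \<open>A continuous function need not be bounded, but it is bounded on the compact interval outside of which \<open>g\<close> vanishes.\<close>

lemma scalar_test_fun_continuous_mult:
  assumes f: "continuous_on {s0..} f" and g: "scalar_test_fun s0 g"
  shows "scalar_test_fun s0 (\<lambda>t. f t * g t)"
  unfolding scalar_test_fun_def
proof (intro conjI)
  have "(\<lambda>t. indicator {s0..} t *\<^sub>R f t) \<in> borel_measurable borel"
    by (rule borel_measurable_continuous_on_indicator[OF _ f]) auto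
  then have "(\<lambda>t. (indicator {s0..} t *\<^sub>R f t) * (indicator {s0..} t *\<^sub>R g t)) \<in> borel_measurable lborel"
    using g unfolding scalar_test_fun_def set_borel_measurable_def by (intro borel_measurable_times) auto
  also have "(\<lambda>t. (indicator {s0..} t *\<^sub>R f t) * (indicator {s0..} t *\<^sub>R g t)) = (\<lambda>t. indicator {s0..} t *\<^sub>R (f t * g t))"
    by (auto simp: indicator_def)
  finally show "set_borel_measurable lborel {s0..} (\<lambda>t. f t * g t)" by (simp add: set_borel_measurable_def)
  obtain T where T: "\<And>t. t \<ge> s0 \<Longrightarrow> t > T \<Longrightarrow> g t = 0" using g by (auto simp: scalar_test_fun_def)
  then show "\<exists>T. \<forall>t\<ge>s0. t > T \<longrightarrow> f t * g t = 0" by (intro exI[of _ T]) auto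
  have "compact (f ` {s0..T})" by (intro compact_continuous_image continuous_on_subset[OF f]) auto
  then obtain B where B: "\<And>t. t \<in> {s0..T} \<Longrightarrow> \<bar>f t\<bar> \<le> B"
    using compact_imp_bounded[of "f ` {s0..T}"] unfolding bounded_iff by fastforce
  obtain C where C: "\<And>t. t \<ge> s0 \<Longrightarrow> \<bar>g t\<bar> \<le> C"
    using g by (auto simp: scalar_test_fun_def bounded_from_def bounded_iff)
  have "\<bar>f t * g t\<bar> \<le> \<bar>B\<bar> * \<bar>C\<bar>" if t: "t \<ge> s0" for t
  proof (cases "t \<le> T")
    case True
    then show ?thesis using B[of t] C[of t] t unfolding abs_mult by (intro mult_mono) auto
  next
    case False
    then show ?thesis using T[of t] t by simp
  qed
  then show "bounded_from s0 (\<lambda>t. f t * g t)"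
    unfolding bounded_from_def bounded_iff by (auto intro!: exI[of _ "\<bar>B\<bar> * \<bar>C\<bar>"])
qed

lemma scalar_test_fun_zero: "scalar_test_fun s0 (\<lambda>t. 0)"
  by (auto simp: scalar_test_fun_def set_borel_measurable_def bounded_from_def bounded_iff)

lemma scalar_test_fun_add:
  assumes f: "scalar_test_fun s0 f" and g: "scalar_test_fun s0 g"
  shows "scalar_test_fun s0 (\<lambda>t. f t + g t)"
  unfolding scalar_test_fun_def
proof (intro conjI)
  have "(\<lambda>t. indicator {s0..} t *\<^sub>R f t + indicator {s0..} t *\<^sub>R g t) \<in> borel_measurable lborel"
    using f g unfolding scalar_test_fun_def set_borel_measurable_def by (intro borel_measurable_add) auto
  then show "set_borel_measurable lborel {s0..} (\<lambda>t. f t + g t)"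
    by (simp add: set_borel_measurable_def distrib_left)
  obtain T where T: "\<And>t. t \<ge> s0 \<Longrightarrow> t > T \<Longrightarrow> f t = 0" using f by (auto simp: scalar_test_fun_def)
  obtain T' where T': "\<And>t. t \<ge> s0 \<Longrightarrow> t > T' \<Longrightarrow> g t = 0" using g by (auto simp: scalar_test_fun_def)
  show "\<exists>T. \<forall>t\<ge>s0. t > T \<longrightarrow> f t + g t = 0"
    by (intro exI[of _ "max T T'"]) (simp add: T T')
  obtain B where B: "\<And>t. t \<ge> s0 \<Longrightarrow> \<bar>f t\<bar> \<le> B"
    using f by (auto simp: scalar_test_fun_def bounded_from_def bounded_iff)
  obtain C where C: "\<And>t. t \<ge> s0 \<Longrightarrow> \<bar>g t\<bar> \<le> C"
    using g by (auto simp: scalar_test_fun_def bounded_from_def bounded_iff)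
  have "\<bar>f t + g t\<bar> \<le> B + C" if "t \<ge> s0" for t
    using B[OF that] C[OF that] by linarith
  then show "bounded_from s0 (\<lambda>t. f t + g t)"
    unfolding bounded_from_def bounded_iff by (auto intro!: exI[of _ "B + C"])
qed

lemma scalar_test_fun_sum:
  "finite I \<Longrightarrow> (\<And>i. i \<in> I \<Longrightarrow> scalar_test_fun s0 (f i)) \<Longrightarrow> scalar_test_fun s0 (\<lambda>t. \<Sum>i\<in>I. f i t)"
  by (induction I rule: finite_induct) (auto simp: scalar_test_fun_zero scalar_test_fun_add)

lemma test_fun_mult:
  assumes F: "cont_mat s0 a b F" and \<phi>: "test_fun s0 a \<phi>"
  shows "test_fun s0 b (\<lambda>t. transpose_mat (F t) *\<^sub>v \<phi> t)"
  unfolding test_fun_iff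
proof (intro conjI allI impI)
  have c: "\<phi> t \<in> carrier_vec a" "F t \<in> carrier_mat a b" if "t \<ge> s0" for t
    using \<phi> cont_mat_carrier[OF F that] that by (auto simp: test_fun_iff)
  show "transpose_mat (F t) *\<^sub>v \<phi> t \<in> carrier_vec b" if "t \<ge> s0" for t
    using c[OF that] by (intro mult_mat_vec_carrier[of _ b a]) auto
  fix i assume i: "i < b"
  have "scalar_test_fun s0 (\<lambda>t. \<Sum>j<a. F t $$ (j, i) * \<phi> t $ j)"
    using \<phi> i by (intro scalar_test_fun_sum scalar_test_fun_continuous_mult cont_mat_entry[OF F]) (auto simp: test_fun_iff)
  then show "scalar_test_fun s0 (\<lambda>t. (transpose_mat (F t) *\<^sub>v \<phi> t) $ i)"
  proof (rule scalar_test_fun_cong)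
    fix t assume "t \<ge> s0"
    then show "(transpose_mat (F t) *\<^sub>v \<phi> t) $ i = (\<Sum>j<a. F t $$ (j, i) * \<phi> t $ j)"
      using c[of t] i mult_mat_vec_index_sum[of "transpose_mat (F t)" b a "\<phi> t" i] by simp
  qed
qed

lemma test_fun_indicator: "test_fun s0 k (\<lambda>s. indicator {s0..t} s \<cdot>\<^sub>v unit_vec k i)"
  unfolding test_fun_iff
proof (intro conjI allI impI)
  fix j assume j: "j < k"
  have "scalar_test_fun s0 (\<lambda>s. indicator {s0..t} s * (if j = i then 1 else 0))"
    unfolding scalar_test_fun_def
  proof (intro conjI)
    show "bounded_from s0 (\<lambda>s. indicator {s0..t} s * (if j = i then 1 else 0))"
      unfolding bounded_from_def bounded_iff by (intro exI[of _ 1]) (auto simp: indicator_def)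
    show "\<exists>T. \<forall>s\<ge>s0. s > T \<longrightarrow> indicator {s0..t} s * (if j = i then 1 else 0) = (0::real)"
      by (intro exI[of _ t]) (auto simp: indicator_def)
  qed (simp add: set_borel_measurable_def)
  then show "scalar_test_fun s0 (\<lambda>s. (indicator {s0..t} s \<cdot>\<^sub>v unit_vec k i) $ j)"
    by (rule scalar_test_fun_cong) (use j in \<open>auto simp: unit_vec_def\<close>)
qed auto

text \<open>The linearity clause of \<open>gproc\<close>, which generalized processes share with the action of ordinary processes.\<close>

definition linear_gproc :: "'w measure \<Rightarrow> real \<Rightarrow> nat \<Rightarrow> 'w gproc \<Rightarrow> bool" where
  "linear_gproc Pr s0 k \<zeta> \<longleftrightarrow>
     (\<forall>\<phi> \<psi> \<chi> a b. test_fun s0 k \<phi> \<longrightarrow> test_fun s0 k \<psi> \<longrightarrow> test_fun s0 k \<chi> \<longrightarrow>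
        (\<forall>t\<ge>s0. \<chi> t = a \<cdot>\<^sub>v \<phi> t + b \<cdot>\<^sub>v \<psi> t) \<longrightarrow>
        (AE \<omega> in Pr. \<zeta> \<chi> \<omega> = a * \<zeta> \<phi> \<omega> + b * \<zeta> \<psi> \<omega>))"

lemma gproc_imp_linear: "gproc Pr s0 k \<zeta> \<Longrightarrow> linear_gproc Pr s0 k \<zeta>"
  by (simp add: gproc_def linear_gproc_def)

lemma linear_gprocD:
  assumes "linear_gproc Pr s0 k \<zeta>" "test_fun s0 k \<phi>" "test_fun s0 k \<psi>" "test_fun s0 k \<chi>"
    "\<And>t. t \<ge> s0 \<Longrightarrow> \<chi> t = a \<cdot>\<^sub>v \<phi> t + b \<cdot>\<^sub>v \<psi> t"
  shows "AE \<omega> in Pr. \<zeta> \<chi> \<omega> = a * \<zeta> \<phi> \<omega> + b * \<zeta> \<psi> \<omega>"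
  using assms unfolding linear_gproc_def by blast

lemma linear_gproc_cong:
  assumes "linear_gproc Pr s0 k \<zeta>" "test_fun s0 k \<phi>" "test_fun s0 k \<chi>"
    and eq: "\<And>t. t \<ge> s0 \<Longrightarrow> \<chi> t = \<phi> t"
  shows "AE \<omega> in Pr. \<zeta> \<chi> \<omega> = \<zeta> \<phi> \<omega>"
proof -
  have "\<chi> t = 1 \<cdot>\<^sub>v \<phi> t + 0 \<cdot>\<^sub>v \<phi> t" if "t \<ge> s0" for t
    using assms(2) that by (auto simp: eq[OF that] test_fun_iff)
  from linear_gprocD[OF assms(1,2,2,3) this] show ?thesis by simp
qed

lemma linear_gproc_zero:
  assumes "linear_gproc Pr s0 k \<zeta>" "test_fun s0 k \<chi>"
    and eq: "\<And>t. t \<ge> s0 \<Longrightarrow> \<chi> t = 0\<^sub>v k"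
  shows "AE \<omega> in Pr. \<zeta> \<chi> \<omega> = 0"
proof -
  have "\<chi> t = 0 \<cdot>\<^sub>v \<chi> t + 0 \<cdot>\<^sub>v \<chi> t" if "t \<ge> s0" for t
    using eq[OF that] by auto
  from linear_gprocD[OF assms(1,2,2,2) this] show ?thesis by simp
qed

text \<open>
  Almost every path of a process is integrable over bounded intervals; on such a path \<open>regular\<close> is an
  honest integral, hence linear.
\<close>

lemma regular_linear:
  assumes "process Pr s0 k f"
  shows "linear_gproc Pr s0 k (regular s0 f)"
  unfolding linear_gproc_def
proof (intro allI impI)
  fix \<phi> \<psi> \<chi> and a b :: real
  assume \<phi>: "test_fun s0 k \<phi>" and \<psi>: "test_fun s0 k \<psi>" and \<chi>: "test_fun s0 k \<chi>"
    and eq: "\<forall>t\<ge>s0. \<chi> t = a \<cdot>\<^sub>v \<phi> t + b \<cdot>\<^sub>v \<psi> t"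
  have int: "AE \<omega> in Pr. \<omega> \<in> space Pr \<longrightarrow> set_integrable lborel {s0..} (\<lambda>t. \<eta> t \<bullet> f t \<omega>)" if \<eta>: "test_fun s0 k \<eta>" for \<eta>
  proof -
    have "AE \<omega> in Pr. set_integrable lborel {s0..} (\<lambda>t. \<eta> t $ i * f t \<omega> $ i)" if i: "i < k" for i
    proof -
      have s: "scalar_test_fun s0 (\<lambda>t. \<eta> t $ i)" using \<eta> i by (simp add: test_fun_iff)
      then obtain T where T: "\<And>t. t \<ge> s0 \<Longrightarrow> t > T \<Longrightarrow> \<eta> t $ i = 0" by (auto simp: scalar_test_fun_def)
      obtain B where B: "\<And>t. t \<ge> s0 \<Longrightarrow> \<bar>\<eta> t $ i\<bar> \<le> B"
        using s by (auto simp: scalar_test_fun_def bounded_from_def bounded_iff)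
      have meas: "(\<lambda>t. indicator {s0..} t *\<^sub>R \<eta> t $ i) \<in> borel_measurable lborel"
        using s by (simp add: scalar_test_fun_def set_borel_measurable_def)
      have "AE \<omega> in Pr. set_integrable lborel {s0..T} (\<lambda>t. f t \<omega> $ i)"
        using assms i by (simp add: process_def)
      then show ?thesis
      proof (rule AE_mp, intro AE_I2 impI)
        fix \<omega> assume "set_integrable lborel {s0..T} (\<lambda>t. f t \<omega> $ i)"
        then have fi: "integrable lborel (\<lambda>t. indicator {s0..T} t *\<^sub>R f t \<omega> $ i)" by (simp add: set_integrable_def)
        have "integrable lborel (\<lambda>t. (indicator {s0..} t *\<^sub>R \<eta> t $ i) * (indicator {s0..T} t *\<^sub>R f t \<omega> $ i))"
        proof (rule Bochner_Integration.integrable_bound[OF integrable_mult_right[OF integrable_abs[OF fi], of B]])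
          show "(\<lambda>t. (indicator {s0..} t *\<^sub>R \<eta> t $ i) * (indicator {s0..T} t *\<^sub>R f t \<omega> $ i)) \<in> borel_measurable lborel"
            by (intro borel_measurable_times meas borel_measurable_integrable fi)
          show "AE t in lborel. norm ((indicator {s0..} t *\<^sub>R \<eta> t $ i) * (indicator {s0..T} t *\<^sub>R f t \<omega> $ i))
              \<le> norm (B * \<bar>indicator {s0..T} t *\<^sub>R f t \<omega> $ i\<bar>)"
            using B by (intro AE_I2) (auto simp: indicator_def abs_mult intro!: mult_right_mono order.trans[OF B])
        qed
        moreover have "(\<lambda>t. (indicator {s0..} t *\<^sub>R \<eta> t $ i) * (indicator {s0..T} t *\<^sub>R f t \<omega> $ i)) =
            (\<lambda>t. indicator {s0..} t *\<^sub>R (\<eta> t $ i * f t \<omega> $ i))"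
        proof
          fix t
          show "(indicator {s0..} t *\<^sub>R \<eta> t $ i) * (indicator {s0..T} t *\<^sub>R f t \<omega> $ i) =
              indicator {s0..} t *\<^sub>R (\<eta> t $ i * f t \<omega> $ i)"
            using T[of t] by (cases "t > T") (auto simp: indicator_def)
        qed
        ultimately show "set_integrable lborel {s0..} (\<lambda>t. \<eta> t $ i * f t \<omega> $ i)" by (simp add: set_integrable_def)
      qed
    qed
    then have "AE \<omega> in Pr. \<forall>i\<in>{..<k}. set_integrable lborel {s0..} (\<lambda>t. \<eta> t $ i * f t \<omega> $ i)"
      by (intro AE_finite_allI) auto
    then show ?thesis
    proof (rule AE_mp, intro AE_I2 impI)
      fix \<omega> assume \<omega>: "\<omega> \<in> space Pr" and si: "\<forall>i\<in>{..<k}. set_integrable lborel {s0..} (\<lambda>t. \<eta> t $ i * f t \<omega> $ i)"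
      have "set_integrable lborel {s0..} (\<lambda>t. \<Sum>i<k. \<eta> t $ i * f t \<omega> $ i)"
        using si unfolding set_integrable_def scaleR_sum_right by (intro Bochner_Integration.integrable_sum) auto
      moreover have "\<eta> t \<bullet> f t \<omega> = (\<Sum>i<k. \<eta> t $ i * f t \<omega> $ i)" if "t \<ge> s0" for t
      proof -
        have "f t \<omega> \<in> carrier_vec k" using assms \<omega> that by (simp add: process_def)
        then show ?thesis by (simp add: scalar_prod_def atLeast0LessThan)
      qed
      ultimately show "set_integrable lborel {s0..} (\<lambda>t. \<eta> t \<bullet> f t \<omega>)"
        by (subst set_integrable_cong[OF refl refl, where f' = "\<lambda>t. \<Sum>i<k. \<eta> t $ i * f t \<omega> $ i"]) auto
    qed
  qed
  from int[OF \<phi>] int[OF \<psi>] AE_space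
  show "AE \<omega> in Pr. regular s0 f \<chi> \<omega> = a * regular s0 f \<phi> \<omega> + b * regular s0 f \<psi> \<omega>"
  proof eventually_elim
    case (elim \<omega>)
    then have i: "set_integrable lborel {s0..} (\<lambda>t. a * (\<phi> t \<bullet> f t \<omega>))" "set_integrable lborel {s0..} (\<lambda>t. b * (\<psi> t \<bullet> f t \<omega>))"
      by auto
    have "regular s0 f \<chi> \<omega> = (LINT t:{s0..}|lborel. a * (\<phi> t \<bullet> f t \<omega>) + b * (\<psi> t \<bullet> f t \<omega>))"
      unfolding regular_def
    proof (rule set_lebesgue_integral_cong)
      show "\<forall>t. t \<in> {s0..} \<longrightarrow> \<chi> t \<bullet> f t \<omega> = a * (\<phi> t \<bullet> f t \<omega>) + b * (\<psi> t \<bullet> f t \<omega>)"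
      proof (intro allI impI)
        fix t assume "t \<in> {s0..}"
        then have c: "\<phi> t \<in> carrier_vec k" "\<psi> t \<in> carrier_vec k" "f t \<omega> \<in> carrier_vec k"
          using \<phi> \<psi> assms elim by (auto simp: test_fun_iff process_def)
        then show "\<chi> t \<bullet> f t \<omega> = a * (\<phi> t \<bullet> f t \<omega>) + b * (\<psi> t \<bullet> f t \<omega>)"
          using eq \<open>t \<in> {s0..}\<close> by (simp add: add_scalar_prod_distrib[of _ k])
      qed
    qed auto
    also have "\<dots> = a * regular s0 f \<phi> \<omega> + b * regular s0 f \<psi> \<omega>"
      using i by (simp add: regular_def)
    finally show ?case .
  qed
qed

text \<open>
  \<open>rep k \<zeta> a\<close> expresses a process \<open>\<zeta>\<close> of dimension \<open>k\<close> as \<open>\<Sum>\<^sub>j a\<^sub>j(t) base\<^sub>j(t)\<close> up to a part of zero mean.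
  Knowing the coefficients \<open>a\<close> of a process suffices to compute its expectation, and they can be computed
  from the definition of the process by matrix algebra.
\<close>

locale signal_calculus =
  fixes Pr :: "'w measure" and s0 :: real and base :: "'j \<Rightarrow> 'w gproc" and bdim :: "'j \<Rightarrow> nat"
  assumes finite_signals: "finite (UNIV :: 'j set)"
    and base_linear: "\<And>j. linear_gproc Pr s0 (bdim j) (base j)"
begin

definition combination :: "('j \<Rightarrow> real \<Rightarrow> real mat) \<Rightarrow> (real \<Rightarrow> real vec) \<Rightarrow> 'w \<Rightarrow> real" where
  "combination a \<phi> \<omega> = (\<Sum>j\<in>UNIV. base j (\<lambda>t. transpose_mat (a j t) *\<^sub>v \<phi> t) \<omega>)"

definition rep :: "nat \<Rightarrow> 'w gproc \<Rightarrow> ('j \<Rightarrow> real \<Rightarrow> real mat) \<Rightarrow> bool" where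
  "rep k \<zeta> a \<longleftrightarrow> (\<forall>j. cont_mat s0 k (bdim j) (a j)) \<and>
     (\<forall>\<phi>. test_fun s0 k \<phi> \<longrightarrow>
        (\<exists>Z. integrable Pr Z \<and> (LINT \<omega>|Pr. Z \<omega>) = 0 \<and> (AE \<omega> in Pr. \<zeta> \<phi> \<omega> = combination a \<phi> \<omega> + Z \<omega>)))"

lemma rep_cont: "rep k \<zeta> a \<Longrightarrow> cont_mat s0 k (bdim j) (a j)"
  by (simp add: rep_def)

lemma rep_test: "rep k \<zeta> a \<Longrightarrow> test_fun s0 k \<phi> \<Longrightarrow> test_fun s0 (bdim j) (\<lambda>t. transpose_mat (a j t) *\<^sub>v \<phi> t)"
  using test_fun_mult rep_cont by blast

lemma repE:
  assumes "rep k \<zeta> a" "test_fun s0 k \<phi>"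
  obtains Z where "integrable Pr Z" "(LINT \<omega>|Pr. Z \<omega>) = 0" "AE \<omega> in Pr. \<zeta> \<phi> \<omega> = combination a \<phi> \<omega> + Z \<omega>"
  using assms unfolding rep_def by blast

lemma AE_all_signals:
  fixes Q :: "'j \<Rightarrow> 'w \<Rightarrow> bool"
  shows "(\<And>j. AE \<omega> in Pr. Q j \<omega>) \<Longrightarrow> AE \<omega> in Pr. \<forall>j. Q j \<omega>"
  using AE_finite_allI[OF finite_signals, of Q Pr] by simp

lemma combination_cong:
  assumes \<phi>: "test_fun s0 k \<phi>" and a: "\<And>j. cont_mat s0 k (bdim j) (a j)"
    and eq: "\<And>j t. t \<ge> s0 \<Longrightarrow> b j t = a j t"
  shows "AE \<omega> in Pr. combination b \<phi> \<omega> = combination a \<phi> \<omega>"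
proof -
  have b: "cont_mat s0 k (bdim j) (b j)" for j by (rule cont_mat_cong[OF a eq])
  have "AE \<omega> in Pr. \<forall>j. base j (\<lambda>t. transpose_mat (b j t) *\<^sub>v \<phi> t) \<omega> = base j (\<lambda>t. transpose_mat (a j t) *\<^sub>v \<phi> t) \<omega>"
    by (intro AE_all_signals linear_gproc_cong[OF base_linear] test_fun_mult[OF a \<phi>] test_fun_mult[OF b \<phi>]) (simp add: eq)
  then show ?thesis by eventually_elim (simp add: combination_def)
qed

lemma rep_cong:
  assumes rep: "rep k \<zeta> a" and eq: "\<And>j t. t \<ge> s0 \<Longrightarrow> b j t = a j t"
  shows "rep k \<zeta> b"
  unfolding rep_def
proof (intro conjI allI impI)
  show "cont_mat s0 k (bdim j) (b j)" for j by (rule cont_mat_cong[OF rep_cont[OF rep] eq])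
  fix \<phi> assume \<phi>: "test_fun s0 k \<phi>"
  obtain Z where Z: "integrable Pr Z" "(LINT \<omega>|Pr. Z \<omega>) = 0" "AE \<omega> in Pr. \<zeta> \<phi> \<omega> = combination a \<phi> \<omega> + Z \<omega>"
    using repE[OF rep \<phi>] .
  have "AE \<omega> in Pr. \<zeta> \<phi> \<omega> = combination b \<phi> \<omega> + Z \<omega>"
    using Z(3) combination_cong[where b = b, OF \<phi> rep_cont[OF rep], OF eq, simplified]
    by eventually_elim simp
  with Z show "\<exists>Z. integrable Pr Z \<and> (LINT \<omega>|Pr. Z \<omega>) = 0 \<and> (AE \<omega> in Pr. \<zeta> \<phi> \<omega> = combination b \<phi> \<omega> + Z \<omega>)" by blast
qed

text \<open>The common form of sums (\<open>u = 1\<close>) and differences (\<open>u = - 1\<close>).\<close>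

lemma rep_linear:
  assumes \<zeta>: "rep k \<zeta> a" and \<eta>: "rep k \<eta> b"
    and c: "\<And>j. cont_mat s0 k (bdim j) (c j)"
    and eq: "\<And>j t x. t \<ge> s0 \<Longrightarrow> x \<in> carrier_vec k \<Longrightarrow>
      transpose_mat (c j t) *\<^sub>v x = 1 \<cdot>\<^sub>v (transpose_mat (a j t) *\<^sub>v x) + u \<cdot>\<^sub>v (transpose_mat (b j t) *\<^sub>v x)"
    and \<theta>: "\<And>\<phi> \<omega>. \<theta> \<phi> \<omega> = \<zeta> \<phi> \<omega> + u * \<eta> \<phi> \<omega>"
  shows "rep k \<theta> c"
  unfolding rep_def
proof (intro conjI allI impI)
  show "cont_mat s0 k (bdim j) (c j)" for j by (rule c)
  fix \<phi> assume \<phi>: "test_fun s0 k \<phi>"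
  obtain Z where Z: "integrable Pr Z" "(LINT \<omega>|Pr. Z \<omega>) = 0" "AE \<omega> in Pr. \<zeta> \<phi> \<omega> = combination a \<phi> \<omega> + Z \<omega>"
    using repE[OF \<zeta> \<phi>] .
  obtain Y where Y: "integrable Pr Y" "(LINT \<omega>|Pr. Y \<omega>) = 0" "AE \<omega> in Pr. \<eta> \<phi> \<omega> = combination b \<phi> \<omega> + Y \<omega>"
    using repE[OF \<eta> \<phi>] .
  have "AE \<omega> in Pr. \<forall>j. base j (\<lambda>t. transpose_mat (c j t) *\<^sub>v \<phi> t) \<omega> =
      1 * base j (\<lambda>t. transpose_mat (a j t) *\<^sub>v \<phi> t) \<omega> + u * base j (\<lambda>t. transpose_mat (b j t) *\<^sub>v \<phi> t) \<omega>"
    using \<phi> by (intro AE_all_signals linear_gprocD[OF base_linear] rep_test[OF \<zeta> \<phi>] rep_test[OF \<eta> \<phi>] test_fun_mult[OF c \<phi>] eq)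
      (auto simp: test_fun_iff)
  then have "AE \<omega> in Pr. combination c \<phi> \<omega> = combination a \<phi> \<omega> + u * combination b \<phi> \<omega>"
    by eventually_elim (simp add: combination_def sum.distrib sum_distrib_left)
  with Z(3) Y(3) have "AE \<omega> in Pr. \<theta> \<phi> \<omega> = combination c \<phi> \<omega> + (Z \<omega> + u * Y \<omega>)"
    by eventually_elim (simp add: \<theta> algebra_simps)
  moreover have "integrable Pr (\<lambda>\<omega>. Z \<omega> + u * Y \<omega>)" "(LINT \<omega>|Pr. Z \<omega> + u * Y \<omega>) = 0" using Z Y by simp_all
  ultimately show "\<exists>Z. integrable Pr Z \<and> (LINT \<omega>|Pr. Z \<omega>) = 0 \<and> (AE \<omega> in Pr. \<theta> \<phi> \<omega> = combination c \<phi> \<omega> + Z \<omega>)" by blast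
qed

lemma rep_add:
  assumes \<zeta>: "rep k \<zeta> a" and \<eta>: "rep k \<eta> b"
  shows "rep k (\<zeta> + \<eta>) (\<lambda>j t. a j t + b j t)"
proof (rule rep_linear[OF \<zeta> \<eta>, where u = 1])
  fix j t and x :: "real vec" assume "t \<ge> s0" and x: "x \<in> carrier_vec k"
  then have c: "a j t \<in> carrier_mat k (bdim j)" "b j t \<in> carrier_mat k (bdim j)"
    by (auto intro: cont_mat_carrier rep_cont[OF \<zeta>] rep_cont[OF \<eta>])
  then show "transpose_mat (a j t + b j t) *\<^sub>v x = 1 \<cdot>\<^sub>v (transpose_mat (a j t) *\<^sub>v x) + 1 \<cdot>\<^sub>v (transpose_mat (b j t) *\<^sub>v x)"
    using x by (simp add: transpose_add[of _ k "bdim j"] add_mult_distrib_mat_vec[of _ "bdim j" k])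
qed (auto intro: cont_mat_add rep_cont[OF \<zeta>] rep_cont[OF \<eta>])

lemma rep_diff:
  assumes \<zeta>: "rep k \<zeta> a" and \<eta>: "rep k \<eta> b"
  shows "rep k (\<zeta> - \<eta>) (\<lambda>j t. a j t - b j t)"
proof (rule rep_linear[OF \<zeta> \<eta>, where u = "-1"])
  fix j t and x :: "real vec" assume "t \<ge> s0" and x: "x \<in> carrier_vec k"
  then have c: "a j t \<in> carrier_mat k (bdim j)" "b j t \<in> carrier_mat k (bdim j)"
    by (auto intro: cont_mat_carrier rep_cont[OF \<zeta>] rep_cont[OF \<eta>])
  then have "transpose_mat (a j t - b j t) *\<^sub>v x = transpose_mat (a j t) *\<^sub>v x - transpose_mat (b j t) *\<^sub>v x"
    using x by (simp add: transpose_minus[of _ k "bdim j"] minus_mult_distrib_mat_vec[of _ "bdim j" k])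
  then show "transpose_mat (a j t - b j t) *\<^sub>v x = 1 \<cdot>\<^sub>v (transpose_mat (a j t) *\<^sub>v x) + (-1) \<cdot>\<^sub>v (transpose_mat (b j t) *\<^sub>v x)"
    using c by auto
qed (auto intro: cont_mat_minus rep_cont[OF \<zeta>] rep_cont[OF \<eta>])

lemma rep_mult:
  assumes K: "cont_mat s0 k' k K" and \<zeta>: "rep k \<zeta> a"
  shows "rep k' (K \<odot> \<zeta>) (\<lambda>j t. K t * a j t)"
  unfolding rep_def
proof (intro conjI allI impI)
  show c: "cont_mat s0 k' (bdim j) (\<lambda>t. K t * a j t)" for j by (rule cont_mat_mult[OF K rep_cont[OF \<zeta>]])
  fix \<phi> assume \<phi>: "test_fun s0 k' \<phi>"
  have \<psi>: "test_fun s0 k (\<lambda>t. transpose_mat (K t) *\<^sub>v \<phi> t)" by (rule test_fun_mult[OF K \<phi>])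
  obtain Z where Z: "integrable Pr Z" "(LINT \<omega>|Pr. Z \<omega>) = 0"
    "AE \<omega> in Pr. \<zeta> (\<lambda>t. transpose_mat (K t) *\<^sub>v \<phi> t) \<omega> = combination a (\<lambda>t. transpose_mat (K t) *\<^sub>v \<phi> t) \<omega> + Z \<omega>"
    using repE[OF \<zeta> \<psi>] .
  have "AE \<omega> in Pr. \<forall>j. base j (\<lambda>t. transpose_mat (K t * a j t) *\<^sub>v \<phi> t) \<omega> =
      base j (\<lambda>t. transpose_mat (a j t) *\<^sub>v (transpose_mat (K t) *\<^sub>v \<phi> t)) \<omega>"
  proof (intro AE_all_signals linear_gproc_cong[OF base_linear] rep_test[OF \<zeta> \<psi>] test_fun_mult[OF c \<phi>])
    fix j t assume t: "t \<ge> s0"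
    have c: "K t \<in> carrier_mat k' k" "a j t \<in> carrier_mat k (bdim j)" "\<phi> t \<in> carrier_vec k'"
      using t \<phi> cont_mat_carrier[OF K t] cont_mat_carrier[OF rep_cont[OF \<zeta>] t] by (auto simp: test_fun_iff)
    show "transpose_mat (K t * a j t) *\<^sub>v \<phi> t = transpose_mat (a j t) *\<^sub>v (transpose_mat (K t) *\<^sub>v \<phi> t)"
      unfolding transpose_mult[OF c(1,2)] by (rule assoc_mult_mat_vec) (use c in auto)
  qed
  then have "AE \<omega> in Pr. combination (\<lambda>j t. K t * a j t) \<phi> \<omega> = combination a (\<lambda>t. transpose_mat (K t) *\<^sub>v \<phi> t) \<omega>"
    by eventually_elim (simp add: combination_def)
  with Z(3) have "AE \<omega> in Pr. (K \<odot> \<zeta>) \<phi> \<omega> = combination (\<lambda>j t. K t * a j t) \<phi> \<omega> + Z \<omega>"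
    by eventually_elim (simp add: gmult_def)
  with Z show "\<exists>Z. integrable Pr Z \<and> (LINT \<omega>|Pr. Z \<omega>) = 0 \<and> (AE \<omega> in Pr. (K \<odot> \<zeta>) \<phi> \<omega> = combination (\<lambda>j t. K t * a j t) \<phi> \<omega> + Z \<omega>)"
    by blast
qed

lemma base_zero:
  assumes \<phi>: "test_fun s0 k \<phi>"
  shows "AE \<omega> in Pr. base j (\<lambda>t. transpose_mat (0\<^sub>m k (bdim j)) *\<^sub>v \<phi> t) \<omega> = 0"
proof (rule linear_gproc_zero[OF base_linear test_fun_mult[OF cont_mat_const \<phi>]])
  fix t assume "t \<ge> s0"
  then have "\<phi> t \<in> carrier_vec k" using \<phi> by (simp add: test_fun_iff)
  then show "transpose_mat (0\<^sub>m k (bdim j)) *\<^sub>v \<phi> t = 0\<^sub>v (bdim j)" by auto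
qed simp

lemma rep_base:
  assumes K: "cont_mat s0 k (bdim i) K"
  shows "rep k (K \<odot> base i) (\<lambda>j t. if j = i then K t else 0\<^sub>m k (bdim j))"
  unfolding rep_def
proof (intro conjI allI impI)
  show "cont_mat s0 k (bdim j) (\<lambda>t. if j = i then K t else 0\<^sub>m k (bdim j))" for j
    using K by (cases "j = i") (auto intro: cont_mat_const)
  fix \<phi> assume \<phi>: "test_fun s0 k \<phi>"
  have "AE \<omega> in Pr. \<forall>j. base j (\<lambda>t. transpose_mat (0\<^sub>m k (bdim j)) *\<^sub>v \<phi> t) \<omega> = 0"
    by (intro AE_all_signals base_zero \<phi>)
  then have "AE \<omega> in Pr. (K \<odot> base i) \<phi> \<omega> = combination (\<lambda>j t. if j = i then K t else 0\<^sub>m k (bdim j)) \<phi> \<omega> + 0"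
  proof eventually_elim
    case (elim \<omega>)
    have "combination (\<lambda>j t. if j = i then K t else 0\<^sub>m k (bdim j)) \<phi> \<omega> =
        (\<Sum>j\<in>UNIV. if j = i then base i (\<lambda>t. transpose_mat (K t) *\<^sub>v \<phi> t) \<omega> else 0)"
      unfolding combination_def using elim by (intro sum.cong) auto
    then show ?case using finite_signals by (simp add: gmult_def)
  qed
  then show "\<exists>Z. integrable Pr Z \<and> (LINT \<omega>|Pr. Z \<omega>) = 0 \<and>
      (AE \<omega> in Pr. (K \<odot> base i) \<phi> \<omega> = combination (\<lambda>j t. if j = i then K t else 0\<^sub>m k (bdim j)) \<phi> \<omega> + Z \<omega>)"
    by (intro exI[of _ "\<lambda>_. 0"]) simp
qed

lemma rep_zero_mean:
  assumes \<zeta>: "zero_mean Pr s0 k \<zeta>"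
  shows "rep k \<zeta> (\<lambda>j t. 0\<^sub>m k (bdim j))"
  unfolding rep_def
proof (intro conjI allI impI)
  show "cont_mat s0 k (bdim j) (\<lambda>t. 0\<^sub>m k (bdim j))" for j by (auto intro: cont_mat_const)
  fix \<phi> assume \<phi>: "test_fun s0 k \<phi>"
  have "AE \<omega> in Pr. \<forall>j. base j (\<lambda>t. transpose_mat (0\<^sub>m k (bdim j)) *\<^sub>v \<phi> t) \<omega> = 0"
    by (intro AE_all_signals base_zero \<phi>)
  then have "AE \<omega> in Pr. \<zeta> \<phi> \<omega> = combination (\<lambda>j t. 0\<^sub>m k (bdim j)) \<phi> \<omega> + \<zeta> \<phi> \<omega>"
    by eventually_elim (simp add: combination_def)
  with \<zeta> \<phi> show "\<exists>Z. integrable Pr Z \<and> (LINT \<omega>|Pr. Z \<omega>) = 0 \<and> (AE \<omega> in Pr. \<zeta> \<phi> \<omega> = combination (\<lambda>j t. 0\<^sub>m k (bdim j)) \<phi> \<omega> + Z \<omega>)"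
    by (intro exI[of _ "\<zeta> \<phi>"]) (simp add: zero_mean_def)
qed

end

section \<open>Expectations\<close>

text \<open>Fubini's theorem, applied on the strip where the test function is supported.\<close>

lemma expectation_regular:
  assumes pr: "prob_space Pr" and f: "integrable_process Pr s0 k f" and \<psi>: "test_fun s0 k \<psi>"
  shows "integrable Pr (regular s0 f \<psi>)"
    and "(LINT \<omega>|Pr. regular s0 f \<psi> \<omega>) = (LINT t:{s0..}|lborel. \<Sum>i<k. \<psi> t $ i * (LINT \<omega>|Pr. f t \<omega> $ i))"
    and "set_integrable lborel {s0..} (\<lambda>t. \<Sum>i<k. \<psi> t $ i * (LINT \<omega>|Pr. f t \<omega> $ i))"
proof -
  interpret prob_space Pr by fact
  interpret pair_sigma_finite lborel Pr by standard
  let ?g = "\<lambda>i z. (indicator {s0..} (fst z) *\<^sub>R \<psi> (fst z) $ i) * (f (fst z) (snd z) $ i)"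
  have gi: "integrable (lborel \<Otimes>\<^sub>M Pr) (?g i)" if i: "i < k" for i
  proof -
    have s: "scalar_test_fun s0 (\<lambda>t. \<psi> t $ i)" using \<psi> i by (simp add: test_fun_iff)
    then obtain T where T: "\<And>t. t \<ge> s0 \<Longrightarrow> t > T \<Longrightarrow> \<psi> t $ i = 0" by (auto simp: scalar_test_fun_def)
    obtain B where B: "\<And>t. t \<ge> s0 \<Longrightarrow> \<bar>\<psi> t $ i\<bar> \<le> B"
      using s by (auto simp: scalar_test_fun_def bounded_from_def bounded_iff)
    have meas: "(\<lambda>t. indicator {s0..} t *\<^sub>R \<psi> t $ i) \<in> borel_measurable lborel"
      using s by (simp add: scalar_test_fun_def set_borel_measurable_def)
    have "set_integrable (lborel \<Otimes>\<^sub>M Pr) ({s0..T} \<times> space Pr) (\<lambda>(t, \<omega>). f t \<omega> $ i)"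
      using f i by (simp add: integrable_process_def)
    then have fi: "integrable (lborel \<Otimes>\<^sub>M Pr) (\<lambda>z. indicator ({s0..T} \<times> space Pr) z *\<^sub>R (case z of (t, \<omega>) \<Rightarrow> f t \<omega> $ i))"
      by (simp add: set_integrable_def)
    let ?h = "\<lambda>z. (indicator {s0..} (fst z) *\<^sub>R \<psi> (fst z) $ i) *
        (indicator ({s0..T} \<times> space Pr) z *\<^sub>R (case z of (t, \<omega>) \<Rightarrow> f t \<omega> $ i))"
    have h: "integrable (lborel \<Otimes>\<^sub>M Pr) ?h"
    proof (rule Bochner_Integration.integrable_bound[OF integrable_mult_right[OF integrable_abs[OF fi], of B]])
      show "?h \<in> borel_measurable (lborel \<Otimes>\<^sub>M Pr)"
        by (intro borel_measurable_times borel_measurable_integrable[OF fi] measurable_compose[OF measurable_fst meas])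
      show "AE z in lborel \<Otimes>\<^sub>M Pr. norm (?h z)
          \<le> norm (B * \<bar>indicator ({s0..T} \<times> space Pr) z *\<^sub>R (case z of (t, \<omega>) \<Rightarrow> f t \<omega> $ i)\<bar>)"
        using B by (intro AE_I2) (auto simp: indicator_def abs_mult intro!: mult_right_mono order.trans[OF B])
    qed
    have "?h z = ?g i z" if "z \<in> space (lborel \<Otimes>\<^sub>M Pr)" for z
      using that T[of "fst z"] by (cases "fst z > T") (auto simp: indicator_def space_pair_measure)
    then show ?thesis by (rule iffD1[OF Bochner_Integration.integrable_cong[OF refl] h])
  qed
  define g where "g = (\<lambda>z. \<Sum>i<k. ?g i z)"
  have g: "integrable (lborel \<Otimes>\<^sub>M Pr) g" unfolding g_def using gi by (intro Bochner_Integration.integrable_sum) auto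
  have reg: "regular s0 f \<psi> \<omega> = (\<integral>t. g (t, \<omega>) \<partial>lborel)" if \<omega>: "\<omega> \<in> space Pr" for \<omega>
    unfolding regular_def set_lebesgue_integral_def
  proof (rule Bochner_Integration.integral_cong[OF refl])
    fix t
    have "f t \<omega> \<in> carrier_vec k" if "t \<ge> s0"
      using f \<omega> that by (simp add: integrable_process_def process_def)
    then show "indicator {s0..} t *\<^sub>R (\<psi> t \<bullet> f t \<omega>) = g (t, \<omega>)"
      by (auto simp: g_def indicator_def scalar_prod_def atLeast0LessThan)
  qed
  have "integrable Pr (\<lambda>\<omega>. \<integral>t. g (t, \<omega>) \<partial>lborel)" using integrable_snd[of "\<lambda>t \<omega>. g (t, \<omega>)"] g by simp
  then show "integrable Pr (regular s0 f \<psi>)" by (subst Bochner_Integration.integrable_cong[OF refl reg])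
  have inner: "(\<integral>\<omega>. g (t, \<omega>) \<partial>Pr) = indicator {s0..} t *\<^sub>R (\<Sum>i<k. \<psi> t $ i * (LINT \<omega>|Pr. f t \<omega> $ i))" for t
  proof (cases "t \<ge> s0")
    case True
    have "integrable Pr (\<lambda>\<omega>. f t \<omega> $ i)" if "i < k" for i
      using f True that by (simp add: integrable_process_def)
    then show ?thesis using True by (simp add: g_def)
  qed (simp add: g_def)
  have "(LINT \<omega>|Pr. regular s0 f \<psi> \<omega>) = (\<integral>\<omega>. (\<integral>t. g (t, \<omega>) \<partial>lborel) \<partial>Pr)"
    by (rule Bochner_Integration.integral_cong[OF refl reg])
  also have "\<dots> = (\<integral>t. (\<integral>\<omega>. g (t, \<omega>) \<partial>Pr) \<partial>lborel)"
    using Fubini_integral[of "\<lambda>t \<omega>. g (t, \<omega>)"] g by simp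
  finally show "(LINT \<omega>|Pr. regular s0 f \<psi> \<omega>) = (LINT t:{s0..}|lborel. \<Sum>i<k. \<psi> t $ i * (LINT \<omega>|Pr. f t \<omega> $ i))"
    unfolding inner set_lebesgue_integral_def .
  have "integrable lborel (\<lambda>t. \<integral>\<omega>. g (t, \<omega>) \<partial>Pr)" using integrable_fst[of "\<lambda>t \<omega>. g (t, \<omega>)"] g by simp
  then show "set_integrable lborel {s0..} (\<lambda>t. \<Sum>i<k. \<psi> t $ i * (LINT \<omega>|Pr. f t \<omega> $ i))"
    unfolding inner set_integrable_def .
qed

text \<open>An integral equation with locally integrable right-hand side \<open>A b\<close> and continuous \<open>A\<close> is a differential equation:
  its solutions are continuous, hence so is the integrand.\<close>

lemma integral_equation_lin_solution:
  assumes A: "cont_mat s0 n n A" and b: "\<And>t. t \<ge> s0 \<Longrightarrow> b t \<in> carrier_vec n"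
    and int: "\<And>i t. i < n \<Longrightarrow> t \<ge> s0 \<Longrightarrow> set_integrable lborel {s0..t} (\<lambda>s. (A s *\<^sub>v b s) $ i)"
    and eq: "\<And>i t. i < n \<Longrightarrow> t \<ge> s0 \<Longrightarrow> b t $ i = b s0 $ i + (LINT s:{s0..t}|lborel. (A s *\<^sub>v b s) $ i)"
  shows "lin_solution n A s0 b"
proof -
  have hk: "(\<lambda>s. (A s *\<^sub>v b s) $ i) integrable_on {s0..t}"
    "b t $ i = b s0 $ i + integral {s0..t} (\<lambda>s. (A s *\<^sub>v b s) $ i)" if "i < n" "t \<ge> s0" for i t
    using set_borel_integral_eq_integral[OF int[OF that]] eq[OF that] by auto
  have cont: "continuous_on {s0..t} (\<lambda>s. b s $ i)" if "i < n" for i t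
  proof -
    have "continuous_on {s0..t} (\<lambda>u. b s0 $ i + integral {s0..u} (\<lambda>s. (A s *\<^sub>v b s) $ i))"
      using hk(1)[OF that] by (cases "t \<ge> s0") (auto intro!: continuous_intros indefinite_integral_continuous_1)
    then show ?thesis
      by (rule continuous_on_eq) (rule hk(2)[OF that, symmetric], simp)
  qed
  have contA: "continuous_on {s0..t} (\<lambda>s. (A s *\<^sub>v b s) $ i)" if i: "i < n" for i t
  proof -
    have "continuous_on {s0..t} (\<lambda>s. \<Sum>j<n. A s $$ (i, j) * b s $ j)"
      using i by (intro continuous_intros cont continuous_on_subset[OF cont_mat_entry[OF A]]) auto
    then show ?thesis
      by (rule continuous_on_eq) (rule mult_mat_vec_index_sum[OF cont_mat_carrier[OF A] b i, symmetric], auto)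
  qed
  show ?thesis unfolding lin_solution_def
  proof (intro allI impI conjI)
    fix t i assume t: "t \<ge> s0" and i: "i < n"
    have "((\<lambda>u. integral {s0..u} (\<lambda>s. (A s *\<^sub>v b s) $ i)) has_real_derivative (A t *\<^sub>v b t) $ i) (at t within {s0..t + 1})"
      by (rule integral_has_real_derivative[OF contA[OF i]]) (use t in auto)
    then have "((\<lambda>u. b s0 $ i + integral {s0..u} (\<lambda>s. (A s *\<^sub>v b s) $ i)) has_real_derivative (A t *\<^sub>v b t) $ i) (at t within {s0..t + 1})"
      by (auto intro!: derivative_eq_intros)
    then have "((\<lambda>u. b u $ i) has_real_derivative (A t *\<^sub>v b t) $ i) (at t within {s0..t + 1})"
      by (rule has_field_derivative_transform_within[where d = 1]) (use t in \<open>auto intro!: hk(2)[OF i, symmetric]\<close>)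
    moreover have "at t within {s0..t + 1} = at t within {s0..}"
      by (rule at_within_nhd[of t "{..<t + 1}"]) auto
    ultimately show "((\<lambda>u. b u $ i) has_real_derivative (A t *\<^sub>v b t) $ i) (at t within {s0..})" by simp
  qed (use b in auto)
qed

section \<open>The estimation error\<close>

lemma cont_mat_dims:
  assumes "cont_mat s0 a b F" "t \<ge> s0"
  shows "dim_row (F t) = a" "dim_col (F t) = b"
  using cont_mat_carrier[OF assms] by auto

text \<open>
  Identities between products of rectangular matrices are proved by expanding both sides into sums of
  right-nested products and comparing entries. The following forms of the ring laws have side conditions
  on dimensions only, so that rewriting discharges them.
\<close>

lemma mult_assoc_dim:
  fixes A :: "real mat"
  assumes "dim_col A = dim_row B" "dim_col B = dim_row C"
  shows "A * B * C = A * (B * C)"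
  by (rule assoc_mult_mat[of _ "dim_row A" "dim_col A" _ "dim_col B" _ "dim_col C"]) (use assms in auto)

lemma mult_add_dim:
  fixes A :: "real mat"
  assumes "dim_col A = dim_row B" "dim_row B = dim_row C" "dim_col B = dim_col C"
  shows "A * (B + C) = A * B + A * C"
  by (rule mult_add_distrib_mat[of _ "dim_row A" "dim_col A" _ "dim_col B"]) (use assms in auto)

lemma add_mult_dim:
  fixes A :: "real mat"
  assumes "dim_row A = dim_row B" "dim_col A = dim_col B" "dim_col B = dim_row C"
  shows "(A + B) * C = A * C + B * C"
  by (rule add_mult_distrib_mat[of _ "dim_row A" "dim_col A" _ _ "dim_col C"]) (use assms in auto)

lemma mult_minus_dim:
  fixes A :: "real mat"
  assumes "dim_col A = dim_row B" "dim_row B = dim_row C" "dim_col B = dim_col C"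
  shows "A * (B - C) = A * B - A * C"
  by (rule mult_minus_distrib_mat[of _ "dim_row A" "dim_col A" _ "dim_col B"]) (use assms in auto)

lemma minus_mult_dim:
  fixes A :: "real mat"
  assumes "dim_row A = dim_row B" "dim_col A = dim_col B" "dim_col B = dim_row C"
  shows "(A - B) * C = A * C - B * C"
  by (rule minus_mult_distrib_mat[of _ "dim_row A" "dim_col A" _ _ "dim_col C"]) (use assms in auto)

lemma mult_uminus_dim:
  fixes A :: "real mat"
  assumes "dim_col A = dim_row B"
  shows "A * (- B) = - (A * B)"
  using assms by simp

lemma mult_zero_dim:
  fixes A :: "real mat"
  assumes "dim_col A = r"
  shows "A * 0\<^sub>m r c = 0\<^sub>m (dim_row A) c"
  by (rule right_mult_zero_mat) (use assms in auto)

lemma one_mult_dim: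
  fixes A :: "real mat"
  assumes "dim_row A = r"
  shows "1\<^sub>m r * A = A"
  by (rule left_mult_one_mat[of _ _ "dim_col A"]) (use assms in auto)

lemmas mat_expand = mult_assoc_dim mult_add_dim add_mult_dim mult_minus_dim minus_mult_dim
  mult_uminus_dim mult_zero_dim one_mult_dim

context elise_model begin

lemmas cont_all = cont_system cont_additional cont_blocks cont_G1 cont_G2 cont_T1 cont_T2 cont_C1 cont_C2
  cont_D1 cont_D2 cont_T2bar cont_C2bar cont_D2bar cont_M1 cont_Ahat cont_M2 cont_L cont_Abreve

lemmas carriers = cont_all[THEN cont_mat_carrier]
lemmas mat_dims = cont_all[THEN cont_mat_dims(1)] cont_all[THEN cont_mat_dims(2)]

lemma T2_H: assumes t: "t \<ge> s0" shows "T2 M t * matH M t = 0\<^sub>m (l - r) p"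
  unfolding T2_def U2_def by (rule is_svd_decoupling(2)[OF svd[OF t]])

text \<open>The second term of \<open>T\<^sub>1\<close> is a multiple of \<open>U\<^sub>2\<^sup>T\<close>, which annihilates \<open>H\<close>, and \<open>U\<^sub>1\<^sup>T H = \<Sigma> V\<^sub>1\<^sup>T\<close>.\<close>

lemma M1_T1_H:
  assumes t: "t \<ge> s0"
  shows "M1 M t * (T1 M t * matH M t) = transpose_mat (V1 M t)"
proof -
  define N where "N = transpose_mat (U1 M t) * matR M t * U2 M t * minv (transpose_mat (U2 M t) * matR M t * U2 M t)"
  have N: "N \<in> carrier_mat r (l - r)"
    unfolding N_def
  proof -
    have "cont_mat s0 (l - r) (l - r) (\<lambda>t. minv (transpose_mat (U2 M t) * matR M t * U2 M t))"
      by (intro cont_mat_minv U2RU2_det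
        cont_mat_mult[OF cont_mat_mult[OF cont_mat_transpose[OF cont_blocks(2)] cont_additional(11)] cont_blocks(2)])
    from cont_mat_dims[OF this t]
    show "transpose_mat (U1 M t) * matR M t * U2 M t * minv (transpose_mat (U2 M t) * matR M t * U2 M t) \<in> carrier_mat r (l - r)"
      by (intro carrier_matI) (simp_all add: mat_dims[OF t])
  qed
  have UH: "transpose_mat (U2 M t) * matH M t = 0\<^sub>m (l - r) p" using T2_H[OF t] by (simp add: T2_def)
  have "T1 M t * matH M t = transpose_mat (U1 M t) * matH M t - N * (transpose_mat (U2 M t) * matH M t)"
    unfolding T1_def N_def[symmetric] using N by (simp add: mat_dims[OF t] minus_mult_dim mult_assoc_dim)
  also have "\<dots> = transpose_mat (U1 M t) * matH M t"
    unfolding UH using N by (simp add: mat_dims[OF t] mult_zero_dim) (auto intro!: eq_matI simp: mat_dims[OF t])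
  also have "\<dots> = svd\<Sigma> M t * transpose_mat (V1 M t)"
    unfolding U1_def V1_def by (rule is_svd_decoupling(1)[OF svd[OF t]])
  finally have "M1 M t * (T1 M t * matH M t) = M1 M t * svd\<Sigma> M t * transpose_mat (V1 M t)"
    using cont_mat_dims[OF cont_\<Sigma> t] by (simp add: mat_dims[OF t] mult_assoc_dim)
  then show ?thesis by (simp add: M1_\<Sigma>[OF t] one_mult_dim mat_dims[OF t])
qed

lemma T2bar_Hbar: assumes t: "t \<ge> s0" shows "T2bar M t * Hbar M t = 0\<^sub>m (lb - rb) p"
  unfolding T2bar_def by (rule is_svd_decoupling(2)[OF svdbar[OF t]])

text \<open>This is \<open>G = G\<^sub>1 V\<^sub>1\<^sup>T + G\<^sub>2 V\<^sub>2\<^sup>T\<close>, oriented so that rewriting with it eliminates \<open>V\<^sub>1\<close>.\<close>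

lemma G1_V1:
  assumes t: "t \<ge> s0"
  shows "G1 M t * transpose_mat (V1 M t) = matG M t - G2 M t * transpose_mat (V2 M t)"
proof -
  have "matG M t = matG M t * (V1 M t * transpose_mat (V1 M t) + V2 M t * transpose_mat (V2 M t))"
    unfolding V_complete[OF t] by (rule right_mult_one_mat[symmetric, OF carriers(3)[OF t]])
  also have "\<dots> = G1 M t * transpose_mat (V1 M t) + G2 M t * transpose_mat (V2 M t)"
    by (simp add: G1_def G2_def mat_expand mat_dims[OF t])
  finally have *: "matG M t = G1 M t * transpose_mat (V1 M t) + G2 M t * transpose_mat (V2 M t)" .
  show ?thesis
    by (rule eq_matI) (simp_all add: arg_cong[OF *, of "\<lambda>A. A $$ (_, _)"] mat_dims[OF t] del: index_mult_mat(1))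
qed

text \<open>\<open>M\<^sub>2\<close> is the left inverse of \<open>C2bar G\<^sub>2\<close> that solves the least squares problem with weight \<open>R2tilde\<^sup>-\<^sup>1\<close>.\<close>

lemma M2_C2bar_G2:
  assumes t: "t \<ge> s0"
  shows "M2 M P t * (C2bar M t * G2 M t) = 1\<^sub>m (p - r)"
proof -
  have "M2 M P t * (C2bar M t * G2 M t) = minv (M2_gram M P t) * M2_gram M P t"
    using invertible_obtain_inverse(1)[OF cont_mat_carrier[OF cont_M2_gram t] M2_gram_det[OF t]]
      cont_mat_dims[OF cont_R2tilde_inv t]
    by (simp add: M2_def M2_gram_def mult_assoc_dim mat_dims[OF t])
  then show ?thesis
    using invertible_obtain_inverse(3)[OF cont_mat_carrier[OF cont_M2_gram t] M2_gram_det[OF t]] by simp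
qed

end

text \<open>The signals other than noise. \<open>SdU\<close> and \<open>SdD\<close> are the derivatives of the known and of the unknown input.\<close>

datatype signal = SX | SXhat | SU | SD | SdU | SdD

lemma UNIV_signal: "(UNIV :: signal set) = {SX, SXhat, SU, SD, SdU, SdD}"
  using signal.exhaust by auto

locale elise =
  fixes M :: ise_model and \<Xi> :: "'w ise_signals" and P :: "real \<Rightarrow> real mat" and xh :: "real \<Rightarrow> 'w \<Rightarrow> real vec"
  assumes sys: "ise_system M \<Xi>" and filt: "elise_filter M \<Xi> P xh"
begin

sublocale elise_model M P
  by standard (use sys filt in \<open>auto simp: ise_system_def elise_filter_def\<close>)

abbreviation "Pr \<equiv> prob \<Xi>"

definition base :: "signal \<Rightarrow> 'w gproc" where
  "base j = (case j of SX \<Rightarrow> regular s0 (sigX \<Xi>) | SXhat \<Rightarrow> regular s0 xh | SU \<Rightarrow> regular s0 (sigU \<Xi>)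
     | SD \<Rightarrow> regular s0 (sigD \<Xi>) | SdU \<Rightarrow> derU \<Xi> | SdD \<Rightarrow> derD \<Xi>)"

definition bdim :: "signal \<Rightarrow> nat" where
  "bdim j = (case j of SX \<Rightarrow> n | SXhat \<Rightarrow> n | SU \<Rightarrow> m | SD \<Rightarrow> p | SdU \<Rightarrow> m | SdD \<Rightarrow> p)"

lemma x_integrable: "integrable_process Pr s0 n (sigX \<Xi>)" and xh_integrable: "integrable_process Pr s0 n xh"
  using sys filt by (auto simp: ise_system_def elise_filter_def)

sublocale signal_calculus Pr s0 base bdim
proof
  show "finite (UNIV :: signal set)" by (simp add: UNIV_signal)
  show "linear_gproc Pr s0 (bdim j) (base j)" for j
    using sys x_integrable xh_integrable
    by (cases j) (auto simp: base_def bdim_def ise_system_def input_assms_def integrable_process_def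
        intro: regular_linear gproc_imp_linear)
qed

lemma rep_signal:
  shows "cont_mat s0 k n K \<Longrightarrow> rep k (K \<odot> regular s0 (sigX \<Xi>)) (\<lambda>j t. if j = SX then K t else 0\<^sub>m k (bdim j))"
    and "cont_mat s0 k n K \<Longrightarrow> rep k (K \<odot> regular s0 xh) (\<lambda>j t. if j = SXhat then K t else 0\<^sub>m k (bdim j))"
    and "cont_mat s0 k m K \<Longrightarrow> rep k (K \<odot> regular s0 (sigU \<Xi>)) (\<lambda>j t. if j = SU then K t else 0\<^sub>m k (bdim j))"
    and "cont_mat s0 k p K \<Longrightarrow> rep k (K \<odot> regular s0 (sigD \<Xi>)) (\<lambda>j t. if j = SD then K t else 0\<^sub>m k (bdim j))"
    and "cont_mat s0 k m K \<Longrightarrow> rep k (K \<odot> derU \<Xi>) (\<lambda>j t. if j = SdU then K t else 0\<^sub>m k (bdim j))"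
    and "cont_mat s0 k p K \<Longrightarrow> rep k (K \<odot> derD \<Xi>) (\<lambda>j t. if j = SdD then K t else 0\<^sub>m k (bdim j))"
  using rep_base[of k SX K] rep_base[of k SXhat K] rep_base[of k SU K] rep_base[of k SD K]
    rep_base[of k SdU K] rep_base[of k SdD K]
  by (simp_all add: base_def bdim_def)

lemma noise_zero_mean:
  "zero_mean Pr s0 (dimW M) (noiseW \<Xi>)" "zero_mean Pr s0 l (noiseV \<Xi>)" "zero_mean Pr s0 lb (noiseVbar \<Xi>)"
  using sys by (auto simp: ise_system_def noise_assms_def Let_def)

lemma rep_xdot:
  "rep n (xdot M \<Xi>) (\<lambda>j t. case j of SX \<Rightarrow> matA M t | SU \<Rightarrow> matB M t | SD \<Rightarrow> matG M t | _ \<Rightarrow> 0\<^sub>m n (bdim j))"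
  unfolding xdot_def
proof (rule rep_cong[OF rep_add[OF rep_add[OF rep_add[OF rep_signal(1) rep_signal(3)] rep_signal(4)]
      rep_mult[OF _ rep_zero_mean[OF noise_zero_mean(1)]]]])
  fix j t assume t: "t \<ge> s0"
  show "(case j of SX \<Rightarrow> matA M t | SU \<Rightarrow> matB M t | SD \<Rightarrow> matG M t | _ \<Rightarrow> 0\<^sub>m n (bdim j)) =
      (if j = SX then matA M t else 0\<^sub>m n (bdim j)) + (if j = SU then matB M t else 0\<^sub>m n (bdim j))
      + (if j = SD then matG M t else 0\<^sub>m n (bdim j)) + matW M t * 0\<^sub>m (dimW M) (bdim j)"
    by (cases j; rule eq_matI) (simp_all add: bdim_def mat_dims[OF t] mat_expand del: index_mult_mat(1))
qed (rule cont_all)+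

lemma rep_output_y:
  "rep l (output_y M \<Xi>) (\<lambda>j t. case j of SX \<Rightarrow> matC M t | SU \<Rightarrow> matD M t | SD \<Rightarrow> matH M t | _ \<Rightarrow> 0\<^sub>m l (bdim j))"
  unfolding output_y_def
proof (rule rep_cong[OF rep_add[OF rep_add[OF rep_add[OF rep_signal(1) rep_signal(3)] rep_signal(4)]
      rep_zero_mean[OF noise_zero_mean(2)]]])
  fix j t assume t: "t \<ge> s0"
  show "(case j of SX \<Rightarrow> matC M t | SU \<Rightarrow> matD M t | SD \<Rightarrow> matH M t | _ \<Rightarrow> 0\<^sub>m l (bdim j)) =
      (if j = SX then matC M t else 0\<^sub>m l (bdim j)) + (if j = SU then matD M t else 0\<^sub>m l (bdim j))
      + (if j = SD then matH M t else 0\<^sub>m l (bdim j)) + 0\<^sub>m l (bdim j)"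
    by (cases j; rule eq_matI) (simp_all add: bdim_def mat_dims[OF t] mat_expand del: index_mult_mat(1))
qed (rule cont_all)+

lemma rep_output_ybar:
  "rep lb (output_ybar M \<Xi>) (\<lambda>j t. case j of
      SX \<Rightarrow> Cbar M t * matA M t + Cbarbar M t
    | SXhat \<Rightarrow> 0\<^sub>m lb (bdim j)
    | SU \<Rightarrow> Cbar M t * matB M t + Dbarbar M t
    | SD \<Rightarrow> Cbar M t * matG M t + Hbarbar M t
    | SdU \<Rightarrow> Dbar M t
    | SdD \<Rightarrow> Hbar M t)"
  unfolding output_ybar_def
proof (rule rep_cong[OF rep_add[OF rep_add[OF rep_add[OF rep_add[OF rep_add[OF rep_add[OF
      rep_mult[OF _ rep_xdot] rep_signal(1)] rep_signal(5)] rep_signal(3)] rep_signal(6)] rep_signal(4)]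
      rep_zero_mean[OF noise_zero_mean(3)]]])
  fix j t assume t: "t \<ge> s0"
  show "(case j of
      SX \<Rightarrow> Cbar M t * matA M t + Cbarbar M t
    | SXhat \<Rightarrow> 0\<^sub>m lb (bdim j)
    | SU \<Rightarrow> Cbar M t * matB M t + Dbarbar M t
    | SD \<Rightarrow> Cbar M t * matG M t + Hbarbar M t
    | SdU \<Rightarrow> Dbar M t
    | SdD \<Rightarrow> Hbar M t) =
      Cbar M t * (case j of SX \<Rightarrow> matA M t | SU \<Rightarrow> matB M t | SD \<Rightarrow> matG M t | _ \<Rightarrow> 0\<^sub>m n (bdim j))
      + (if j = SX then Cbarbar M t else 0\<^sub>m lb (bdim j)) + (if j = SdU then Dbar M t else 0\<^sub>m lb (bdim j))
      + (if j = SU then Dbarbar M t else 0\<^sub>m lb (bdim j)) + (if j = SdD then Hbar M t else 0\<^sub>m lb (bdim j))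
      + (if j = SD then Hbarbar M t else 0\<^sub>m lb (bdim j)) + 0\<^sub>m lb (bdim j)"
    by (cases j; rule eq_matI) (simp_all add: bdim_def mat_dims[OF t] mat_expand del: index_mult_mat(1))
qed (rule cont_all)+

text \<open>Coefficients of a process \<open>K (x - xhat) + E d\<close>.\<close>

definition err :: "nat \<Rightarrow> (real \<Rightarrow> real mat) \<Rightarrow> (real \<Rightarrow> real mat) \<Rightarrow> signal \<Rightarrow> real \<Rightarrow> real mat" where
  "err k K E j t = (case j of SX \<Rightarrow> K t | SXhat \<Rightarrow> - K t | SD \<Rightarrow> E t | _ \<Rightarrow> 0\<^sub>m k (bdim j))"

text \<open>The known input cancels, and \<open>d\<close> enters as \<open>M\<^sub>1 T\<^sub>1 H d = V\<^sub>1\<^sup>T d\<close>: up to the error caused by \<open>x - xhat\<close> and zero-mean noise,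
  the filter recovers \<open>d\<^sub>1\<close>.\<close>

lemma rep_d1hat:
  "rep r (d1hat M \<Xi> xh) (err r (\<lambda>t. M1 M t * C1 M t) (\<lambda>t. transpose_mat (V1 M t)))"
  unfolding d1hat_def
proof (rule rep_cong[OF rep_mult[OF _ rep_diff[OF rep_diff[OF rep_mult[OF _ rep_output_y] rep_signal(2)] rep_signal(3)]]])
  fix j t assume t: "t \<ge> s0"
  show "err r (\<lambda>t. M1 M t * C1 M t) (\<lambda>t. transpose_mat (V1 M t)) j t =
      M1 M t * (T1 M t * (case j of SX \<Rightarrow> matC M t | SU \<Rightarrow> matD M t | SD \<Rightarrow> matH M t | _ \<Rightarrow> 0\<^sub>m l (bdim j))
        - (if j = SXhat then C1 M t else 0\<^sub>m r (bdim j)) - (if j = SU then D1 M t else 0\<^sub>m r (bdim j)))"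
    by (cases j; rule eq_matI)
      (simp_all add: err_def bdim_def mat_dims[OF t] mat_expand M1_T1_H[OF t] C1_def D1_def del: index_mult_mat(1))
qed (rule cont_all)+

text \<open>The correction term of the filter is free of \<open>d\<close>, because \<open>T\<^sub>2 H = 0\<close>.\<close>

lemma rep_innovation2:
  "rep (l - r) (T2 M \<odot> output_y M \<Xi> - C2 M \<odot> regular s0 xh - D2 M \<odot> regular s0 (sigU \<Xi>))
     (err (l - r) (C2 M) (\<lambda>t. 0\<^sub>m (l - r) p))"
proof (rule rep_cong[OF rep_diff[OF rep_diff[OF rep_mult[OF _ rep_output_y] rep_signal(2)] rep_signal(3)]])
  fix j t assume t: "t \<ge> s0"
  show "err (l - r) (C2 M) (\<lambda>t. 0\<^sub>m (l - r) p) j t =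
      T2 M t * (case j of SX \<Rightarrow> matC M t | SU \<Rightarrow> matD M t | SD \<Rightarrow> matH M t | _ \<Rightarrow> 0\<^sub>m l (bdim j))
        - (if j = SXhat then C2 M t else 0\<^sub>m (l - r) (bdim j)) - (if j = SU then D2 M t else 0\<^sub>m (l - r) (bdim j))"
    by (cases j; rule eq_matI)
      (simp_all add: err_def bdim_def mat_dims[OF t] mat_expand T2_H[OF t] C2_def D2_def del: index_mult_mat(1))
qed (rule cont_all)+

text \<open>The factor \<open>T2bar\<close> removes \<open>Hbar dd/dt\<close> and \<open>Hbarbar d\<close>. The remaining occurrence of \<open>d\<close> is \<open>C2bar G d\<close>; subtracting
  \<open>C2bar G\<^sub>1\<close> times the estimate of \<open>d\<^sub>1\<close> leaves \<open>C2bar G\<^sub>2 V\<^sub>2\<^sup>T d\<close>, from which \<open>M\<^sub>2\<close> recovers \<open>d\<^sub>2 = V\<^sub>2\<^sup>T d\<close>.\<close>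

lemma rep_d2hat:
  "rep (p - r) (d2hat M \<Xi> P xh)
     (err (p - r) (\<lambda>t. M2 M P t * (C2bar M t * Ahat M t + T2bar M t * Cbarbar M t)) (\<lambda>t. transpose_mat (V2 M t)))"
  unfolding d2hat_def
proof (rule rep_cong[OF rep_mult[OF _ rep_diff[OF rep_diff[OF rep_diff[OF rep_diff[OF rep_diff[OF
      rep_mult[OF _ rep_output_ybar] rep_signal(2)] rep_signal(3)] rep_mult[OF _ rep_d1hat]] rep_signal(5)] rep_signal(3)]]])
  fix j t assume t: "t \<ge> s0"
  let ?y = "case j of
      SX \<Rightarrow> Cbar M t * matA M t + Cbarbar M t
    | SXhat \<Rightarrow> 0\<^sub>m lb (bdim j)
    | SU \<Rightarrow> Cbar M t * matB M t + Dbarbar M t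
    | SD \<Rightarrow> Cbar M t * matG M t + Hbarbar M t
    | SdU \<Rightarrow> Dbar M t
    | SdD \<Rightarrow> Hbar M t"
  let ?e = "T2bar M t * ?y
      - (if j = SXhat then C2bar M t * matA M t + T2bar M t * Cbarbar M t else 0\<^sub>m (lb - rb) (bdim j))
      - (if j = SU then C2bar M t * matB M t else 0\<^sub>m (lb - rb) (bdim j))
      - C2bar M t * G1 M t * err r (\<lambda>t. M1 M t * C1 M t) (\<lambda>t. transpose_mat (V1 M t)) j t
      - (if j = SdU then D2bar M t else 0\<^sub>m (lb - rb) (bdim j))
      - (if j = SU then T2bar M t * Dbarbar M t else 0\<^sub>m (lb - rb) (bdim j))"
  have "?e = err (lb - rb) (\<lambda>t. C2bar M t * Ahat M t + T2bar M t * Cbarbar M t)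
      (\<lambda>t. C2bar M t * (G2 M t * transpose_mat (V2 M t))) j t"
    by (cases j; rule eq_matI)
      (simp_all add: err_def bdim_def mat_dims[OF t] mat_expand G1_V1[OF t] T2bar_Hbarbar[OF t] T2bar_Hbar[OF t]
        C2bar_def D2bar_def Ahat_def del: index_mult_mat(1))
  moreover have "M2 M P t * (C2bar M t * (G2 M t * transpose_mat (V2 M t))) = transpose_mat (V2 M t)"
  proof -
    have "M2 M P t * (C2bar M t * (G2 M t * transpose_mat (V2 M t))) = M2 M P t * (C2bar M t * G2 M t) * transpose_mat (V2 M t)"
      by (simp add: mult_assoc_dim mat_dims[OF t])
    then show ?thesis unfolding M2_C2bar_G2[OF t] by (simp add: one_mult_dim mat_dims[OF t])
  qed
  ultimately show "err (p - r) (\<lambda>t. M2 M P t * (C2bar M t * Ahat M t + T2bar M t * Cbarbar M t)) (\<lambda>t. transpose_mat (V2 M t)) j t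
      = M2 M P t * ?e"
    by (cases j; simp add: err_def bdim_def mat_dims[OF t] mult_uminus_dim mult_zero_dim)
qed (rule cont_all cont_mat_mult[OF cont_C2bar cont_G1] cont_mat_mult[OF cont_C2bar cont_system(2)]
    cont_mat_mult[OF cont_T2bar cont_additional(6)]
    cont_mat_add[OF cont_mat_mult[OF cont_C2bar cont_system(1)] cont_mat_mult[OF cont_T2bar cont_additional(4)]])+

text \<open>The two estimates of the unknown input contribute \<open>G\<^sub>1 V\<^sub>1\<^sup>T d + G\<^sub>2 V\<^sub>2\<^sup>T d = G d\<close>, which is what enters the state equation.\<close>

lemma rep_error:
  "rep n (xdot M \<Xi> - xhatdot M \<Xi> P xh) (err n (Abreve M P) (\<lambda>t. 0\<^sub>m n p))"
  unfolding xhatdot_def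
proof (rule rep_cong[OF rep_diff[OF rep_xdot rep_add[OF rep_add[OF rep_add[OF rep_add[OF rep_signal(2) rep_signal(3)]
      rep_mult[OF _ rep_d1hat]] rep_mult[OF _ rep_d2hat]] rep_mult[OF _ rep_innovation2]]]])
  fix j t assume t: "t \<ge> s0"
  show "err n (Abreve M P) (\<lambda>t. 0\<^sub>m n p) j t =
      (case j of SX \<Rightarrow> matA M t | SU \<Rightarrow> matB M t | SD \<Rightarrow> matG M t | _ \<Rightarrow> 0\<^sub>m n (bdim j))
      - ((if j = SXhat then matA M t else 0\<^sub>m n (bdim j)) + (if j = SU then matB M t else 0\<^sub>m n (bdim j))
        + G1 M t * err r (\<lambda>t. M1 M t * C1 M t) (\<lambda>t. transpose_mat (V1 M t)) j t
        + G2 M t * err (p - r) (\<lambda>t. M2 M P t * (C2bar M t * Ahat M t + T2bar M t * Cbarbar M t)) (\<lambda>t. transpose_mat (V2 M t)) j t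
        + gainL M P t * err (l - r) (C2 M) (\<lambda>t. 0\<^sub>m (l - r) p) j t)"
    by (cases j; rule eq_matI)
      (simp_all add: err_def bdim_def mat_dims[OF t] mat_expand G1_V1[OF t]
        Abreve_def Abar_def Ahat_def del: index_mult_mat(1))
qed (rule cont_all)+

end

section \<open>The bias\<close>

context elise begin

lemma combination_err:
  assumes \<phi>: "test_fun s0 k \<phi>"
  shows "AE \<omega> in Pr. combination (err k K (\<lambda>t. 0\<^sub>m k p)) \<phi> \<omega> =
    regular s0 (sigX \<Xi>) (\<lambda>t. transpose_mat (K t) *\<^sub>v \<phi> t) \<omega> + regular s0 xh (\<lambda>t. transpose_mat (- K t) *\<^sub>v \<phi> t) \<omega>"
proof -
  have "AE \<omega> in Pr. \<forall>j. base j (\<lambda>t. transpose_mat (0\<^sub>m k (bdim j)) *\<^sub>v \<phi> t) \<omega> = 0"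
    by (intro AE_all_signals base_zero \<phi>)
  then show ?thesis
  proof eventually_elim
    case (elim \<omega>)
    from elim[rule_format, of SU] elim[rule_format, of SD] elim[rule_format, of SdU] elim[rule_format, of SdD]
    show ?case
      by (simp add: combination_def UNIV_signal err_def bdim_def) (simp add: base_def)
  qed
qed

lemma bias_carrier: "bias M \<Xi> xh t \<in> carrier_vec n"
  by (simp add: bias_def)

lemma bias_entry:
  assumes t: "t \<ge> s0" and i: "i < n"
  shows "bias M \<Xi> xh t $ i = (LINT \<omega>|Pr. sigX \<Xi> t \<omega> $ i) - (LINT \<omega>|Pr. xh t \<omega> $ i)"
proof -
  have "(LINT \<omega>|Pr. (sigX \<Xi> t \<omega> - xh t \<omega>) $ i) = (LINT \<omega>|Pr. sigX \<Xi> t \<omega> $ i - xh t \<omega> $ i)"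
  proof (rule Bochner_Integration.integral_cong[OF refl])
    fix \<omega> assume "\<omega> \<in> space Pr"
    then have "xh t \<omega> \<in> carrier_vec n" using xh_integrable t by (simp add: integrable_process_def process_def)
    then show "(sigX \<Xi> t \<omega> - xh t \<omega>) $ i = sigX \<Xi> t \<omega> $ i - xh t \<omega> $ i" using i by simp
  qed
  also have "\<dots> = (LINT \<omega>|Pr. sigX \<Xi> t \<omega> $ i) - (LINT \<omega>|Pr. xh t \<omega> $ i)"
    using x_integrable xh_integrable t i by (intro Bochner_Integration.integral_diff) (auto simp: integrable_process_def)
  finally show ?thesis using i by (simp add: bias_def)
qed

text \<open>The error equation is tested with the indicator of \<open>[s0, t]\<close> in the direction of the \<open>i\<close>-th unit vector, which gives the
  increment of the \<open>i\<close>-th component of the error; then expectations are taken.\<close>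

lemma bias_increment:
  assumes t: "t \<ge> s0" and i: "i < n"
  shows "set_integrable lborel {s0..t} (\<lambda>s. (Abreve M P s *\<^sub>v bias M \<Xi> xh s) $ i)"
    and "bias M \<Xi> xh t $ i = bias M \<Xi> xh s0 $ i + (LINT s:{s0..t}|lborel. (Abreve M P s *\<^sub>v bias M \<Xi> xh s) $ i)"
proof -
  have ps: "prob_space Pr" using sys by (simp add: ise_system_def)
  let ?A = "Abreve M P"
  define \<phi> where "\<phi> = (\<lambda>s. indicator {s0..t} s \<cdot>\<^sub>v unit_vec n i :: real vec)"
  have \<phi>: "test_fun s0 n \<phi>" unfolding \<phi>_def by (rule test_fun_indicator)
  let ?\<psi> = "\<lambda>s. transpose_mat (?A s) *\<^sub>v \<phi> s" and ?\<psi>' = "\<lambda>s. transpose_mat (- ?A s) *\<^sub>v \<phi> s"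
  have nA: "cont_mat s0 n n (\<lambda>s. - ?A s)"
    by (rule cont_mat_cong[OF cont_mat_minus[OF cont_mat_const[of "0\<^sub>m n n"] cont_Abreve]])
      (auto intro!: eq_matI simp: mat_dims)
  have \<psi>: "test_fun s0 n ?\<psi>" and \<psi>': "test_fun s0 n ?\<psi>'"
    by (rule test_fun_mult[OF cont_Abreve \<phi>] test_fun_mult[OF nA \<phi>])+
  have entry: "?\<psi> s $ j = indicator {s0..t} s * ?A s $$ (i, j)" "?\<psi>' s $ j = - (indicator {s0..t} s * ?A s $$ (i, j))"
    if s: "s \<ge> s0" and j: "j < n" for s j
  proof -
    have c: "?A s \<in> carrier_mat n n" by (rule cont_mat_carrier[OF cont_Abreve s])
    show "?\<psi> s $ j = indicator {s0..t} s * ?A s $$ (i, j)" using c i j by (simp add: \<phi>_def)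
    show "?\<psi>' s $ j = - (indicator {s0..t} s * ?A s $$ (i, j))" using c i j by (simp add: \<phi>_def)
  qed
  note X = expectation_regular[OF ps x_integrable \<psi>] and Xh = expectation_regular[OF ps xh_integrable \<psi>']
  let ?f = "\<lambda>s. \<Sum>j<n. ?\<psi> s $ j * (LINT \<omega>|Pr. sigX \<Xi> s \<omega> $ j)"
  let ?g = "\<lambda>s. \<Sum>j<n. ?\<psi>' s $ j * (LINT \<omega>|Pr. xh s \<omega> $ j)"
  have fg: "indicator {s0..} s *\<^sub>R (?f s + ?g s) = indicator {s0..t} s *\<^sub>R (?A s *\<^sub>v bias M \<Xi> xh s) $ i" for s
  proof (cases "s \<ge> s0")
    case True
    have "?f s + ?g s = (\<Sum>j<n. indicator {s0..t} s * (?A s $$ (i, j) * bias M \<Xi> xh s $ j))"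
      unfolding sum.distrib[symmetric]
      by (intro sum.cong refl) (simp add: entry[OF True] bias_entry[OF True] algebra_simps del: index_mult_mat_vec)
    also have "\<dots> = indicator {s0..t} s * (?A s *\<^sub>v bias M \<Xi> xh s) $ i"
      using mult_mat_vec_index_sum[OF cont_mat_carrier[OF cont_Abreve True] bias_carrier i]
      by (simp only: sum_distrib_left)
    finally show ?thesis using True by simp
  qed (simp add: indicator_def)
  have "set_integrable lborel {s0..} (\<lambda>s. ?f s + ?g s)"
    using X(3) Xh(3) by (rule set_integral_add)
  then show "set_integrable lborel {s0..t} (\<lambda>s. (?A s *\<^sub>v bias M \<Xi> xh s) $ i)"
    unfolding set_integrable_def fg .
  obtain Z where Z: "integrable Pr Z" "(LINT \<omega>|Pr. Z \<omega>) = 0"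
    "AE \<omega> in Pr. (xdot M \<Xi> - xhatdot M \<Xi> P xh) \<phi> \<omega> = combination (err n ?A (\<lambda>t. 0\<^sub>m n p)) \<phi> \<omega> + Z \<omega>"
    using repE[OF rep_error \<phi>] .
  have dx: "AE \<omega> in Pr. sigX \<Xi> t \<omega> $ i = sigX \<Xi> s0 \<omega> $ i + xdot M \<Xi> \<phi> \<omega>"
    using sys t i by (simp add: ise_system_def has_gderiv_def \<phi>_def)
  have dxh: "AE \<omega> in Pr. xh t \<omega> $ i = xh s0 \<omega> $ i + xhatdot M \<Xi> P xh \<phi> \<omega>"
    using filt t i by (simp add: elise_filter_def has_gderiv_def \<phi>_def)
  have ix: "integrable Pr (\<lambda>\<omega>. sigX \<Xi> u \<omega> $ i)" "integrable Pr (\<lambda>\<omega>. xh u \<omega> $ i)" if "u \<ge> s0" for u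
    using x_integrable xh_integrable i that by (auto simp: integrable_process_def)
  have "(LINT \<omega>|Pr. (sigX \<Xi> t \<omega> $ i - xh t \<omega> $ i) - (sigX \<Xi> s0 \<omega> $ i - xh s0 \<omega> $ i)) =
      (LINT \<omega>|Pr. regular s0 (sigX \<Xi>) ?\<psi> \<omega> + regular s0 xh ?\<psi>' \<omega> + Z \<omega>)"
  proof (rule integral_cong_AE)
    show "AE \<omega> in Pr. (sigX \<Xi> t \<omega> $ i - xh t \<omega> $ i) - (sigX \<Xi> s0 \<omega> $ i - xh s0 \<omega> $ i) =
        regular s0 (sigX \<Xi>) ?\<psi> \<omega> + regular s0 xh ?\<psi>' \<omega> + Z \<omega>"
      using dx dxh Z(3) combination_err[OF \<phi>, of ?A] by eventually_elim simp
  qed (use ix t X(1) Xh(1) Z(1) in \<open>auto intro!: borel_measurable_integrable\<close>)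
  also have "\<dots> = (LINT s:{s0..}|lborel. ?f s) + (LINT s:{s0..}|lborel. ?g s)"
    using X(1,2) Xh(1,2) Z by simp
  also have "\<dots> = (LINT s:{s0..}|lborel. ?f s + ?g s)"
    using X(3) Xh(3) by (rule set_integral_add(2)[symmetric])
  also have "\<dots> = (LINT s:{s0..t}|lborel. (?A s *\<^sub>v bias M \<Xi> xh s) $ i)"
    unfolding set_lebesgue_integral_def fg ..
  finally show "bias M \<Xi> xh t $ i = bias M \<Xi> xh s0 $ i + (LINT s:{s0..t}|lborel. (?A s *\<^sub>v bias M \<Xi> xh s) $ i)"
    using ix t i by (simp add: bias_entry)
qed

lemma bias_solution: "lin_solution n (Abreve M P) s0 (bias M \<Xi> xh)"
  by (rule integral_equation_lin_solution[OF cont_Abreve bias_carrier bias_increment])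

end

theorem lemma1:
  fixes M :: ise_model
    and \<Xi> :: "'w ise_signals"
    and P :: "real \<Rightarrow> real mat"
    and xh :: "real \<Rightarrow> 'w \<Rightarrow> real vec"
  assumes "ise_system M \<Xi>"
    and "elise_filter M \<Xi> P xh"
    and "elise_unif_asymp_stable M P"
  shows "(\<exists>\<beta> \<gamma>. \<gamma> > 0 \<and>
            (\<forall>t\<ge>t0 M. vnorm (bias M \<Xi> xh t) \<le> \<beta> * exp (- \<gamma> * (t - t0 M)))) \<and>
         (bounded_mat (t0 M) (dimX M) (dimX M) (Abreve M P) \<longrightarrow>
           (\<forall>\<Phi> S \<beta> \<gamma>.
              state_transition (t0 M) (dimX M) (Abreve M P) \<Phi> \<and>
              S = gram (dimX M) \<Phi> \<and>
              \<beta> = sqrt ((bias M \<Xi> xh (t0 M) \<bullet> (S (t0 M) *\<^sub>v bias M \<Xi> xh (t0 M)))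
                        / lambda_min_inf (t0 M) S) \<and>
              \<gamma> = 1 / (2 * lambda_max_sup (t0 M) S) \<longrightarrow>
              (\<forall>t\<ge>t0 M. \<forall>i<dimX M. \<forall>j<dimX M.
                 ((\<lambda>T. gram_to (dimX M) \<Phi> t T $$ (i, j)) \<longlongrightarrow> S t $$ (i, j)) at_top) \<and>
              (\<forall>t\<ge>t0 M. pos_def (dimX M) (S t)) \<and>
              lambda_min_inf (t0 M) S > 0 \<and>
              bdd_above ((\<lambda>t. Max (spectrum (S t))) ` {t0 M..}) \<and>
              \<gamma> > 0 \<and>
              (\<forall>t\<ge>t0 M. vnorm (bias M \<Xi> xh t) \<le> \<beta> * exp (- \<gamma> * (t - t0 M)))))"
proof -
  interpret elise M \<Xi> P xh by standard fact+
  have uas: "unif_asymp_stable s0 n (Abreve M P)"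
    using assms(3) by (simp add: elise_unif_asymp_stable_def)
  obtain k \<kappa> where "k > 0" and \<kappa>: "\<kappa> > 0"
    and decay: "\<And>s \<xi> t. s \<ge> s0 \<Longrightarrow> lin_solution n (Abreve M P) s \<xi> \<Longrightarrow> t \<ge> s \<Longrightarrow>
      vnorm (\<xi> t) \<le> k * exp (- \<kappa> * (t - s)) * vnorm (\<xi> s)"
    using unif_asymp_stable_imp_exponential[OF uas cont_mat_carrier[OF cont_Abreve]] by blast
  interpret stable: exp_stable_system s0 n "Abreve M P" k \<kappa>
    by standard (use \<kappa> decay cont_mat_carrier[OF cont_Abreve] in auto)
  show ?thesis
  proof (intro conjI impI allI)
    show "\<exists>\<beta> \<gamma>. \<gamma> > 0 \<and> (\<forall>t\<ge>s0. vnorm (bias M \<Xi> xh t) \<le> \<beta> * exp (- \<gamma> * (t - s0)))"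
      using \<kappa> decay[OF order_refl bias_solution]
      by (intro exI[of _ "k * vnorm (bias M \<Xi> xh s0)"] exI[of _ \<kappa>]) (simp add: mult.commute mult.left_commute)
    fix \<Phi> S and \<beta> \<gamma> :: real
    assume bd: "bounded_mat s0 n n (Abreve M P)"
      and *: "state_transition s0 n (Abreve M P) \<Phi> \<and> S = gram n \<Phi> \<and>
        \<beta> = sqrt ((bias M \<Xi> xh s0 \<bullet> (S s0 *\<^sub>v bias M \<Xi> xh s0)) / lambda_min_inf s0 S) \<and>
        \<gamma> = 1 / (2 * lambda_max_sup s0 S)"
    interpret transition: exp_stable_transition s0 n "Abreve M P" k \<kappa> \<Phi>
      by standard (use * in simp)
    have n: "n > 0" using dims by simp
    note bounds = transition.gram_bounds[OF bd n bias_solution]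
    show "((\<lambda>T. gram_to n \<Phi> t T $$ (i, j)) \<longlongrightarrow> S t $$ (i, j)) at_top"
      if "t \<ge> s0" "i < n" "j < n" for t i j
      using transition.gram_to_tendsto_gram[OF that] * by simp
    show "pos_def n (S t)" if "t \<ge> s0" for t using bounds(1) * that by simp
    show "lambda_min_inf s0 S > 0" using bounds(2) * by simp
    show "bdd_above ((\<lambda>t. Max (spectrum (S t))) ` {s0..})" using bounds(3) * by simp
    show "\<gamma> > 0" using bounds(4) * by simp
    show "vnorm (bias M \<Xi> xh t) \<le> \<beta> * exp (- \<gamma> * (t - s0))" if "t \<ge> s0" for t
      using bounds(5) * that by simp
  qed
qed

end
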